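(* Let $f:\overline{\mathbb{C}}\to\overline{\mathbb{C}}$ be a rational map of degree at least $2$ satisfying the Topological Collet-Eckmann condition. Then the set $J(f)\setminus J_{\mathrm{con}}(f)$ of points in the Julia set that are not in the conical Julia set has Hausdorff dimension $0$.
   Context: Distances, balls and diameters on the Riemann sphere $\overline{\mathbb{C}}$ are taken with respect to the spherical metric; $J(f)$ is the Julia set of $f$. Topological Collet-Eckmann (TCE) condition, in its equivalent form of Exponential Shrinking of Components: there exist $\lambda_{\mathrm{Exp}}>1$ and $r_0>0$ such that for every $x\in J(f)$, every integer $n\ge 1$ and every connected component $W$ of $f^{-n}(B(x,r_0))$ we have $\mathrm{diam}(W)\le\lambda_{\mathrm{Exp}}^{-n}$. Conical Julia set $J_{\mathrm{con}}(f)$: the set of points $x\in J(f)$ for which there exist $\rho(x)>0$ and arbitrarily large positive integers $n$ such that $f^n$ is univalent (injective) on the connected component of $f^{-n}(B(f^n(x),\rho(x)))$ containing $x$. *)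

theory Defs
  imports "HOL-Analysis.Analysis" "HOL-Computational_Algebra.Polynomial"
begin

section \<open>The Riemann sphere with the spherical metric\<close>

datatype riemann_sphere = Fin complex | Infty

text \<open>Stereographic projection onto the unit sphere of \<open>\<complex> \<times> \<real>\<close>, the north pole being \<open>\<infinity>\<close>.\<close>

primrec stereo :: "riemann_sphere \<Rightarrow> complex \<times> real" where
  "stereo (Fin z) =
     ((2 / (1 + (cmod z)\<^sup>2)) *\<^sub>R z, ((cmod z)\<^sup>2 - 1) / (1 + (cmod z)\<^sup>2))"
| "stereo Infty = (0, 1)"

lemma one_plus_norm_sq_pos [simp]: "1 + (cmod z)\<^sup>2 > 0"
  by (simp add: add_pos_nonneg)

lemma one_plus_norm_sq_nz [simp]: "1 + (cmod z)\<^sup>2 \<noteq> 0"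
  using one_plus_norm_sq_pos[of z] by linarith

lemma inner_stereo_Fin:
  "stereo (Fin z) \<bullet> stereo (Fin w) =
     1 - 2 * (cmod (z - w))\<^sup>2 / ((1 + (cmod z)\<^sup>2) * (1 + (cmod w)\<^sup>2))"
proof -
  define a b where "a = (cmod z)\<^sup>2" and "b = (cmod w)\<^sup>2"
  have nz: "1 + a \<noteq> 0" "1 + b \<noteq> 0"
    by (simp_all add: a_def b_def)
  have zw: "(cmod (z - w))\<^sup>2 = a + b - 2 * (z \<bullet> w)"
    by (simp add: a_def b_def power2_norm_eq_inner inner_diff inner_commute)
  have "stereo (Fin z) \<bullet> stereo (Fin w) =
     (4 * (z \<bullet> w) + (a - 1) * (b - 1)) / ((1 + a) * (1 + b))"
    by (simp add: inner_prod_def a_def [symmetric] b_def [symmetric] add_divide_distrib)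
  also have "\<dots> = 1 - 2 * (a + b - 2 * (z \<bullet> w)) / ((1 + a) * (1 + b))"
    using nz by (simp add: divide_simps) (simp add: algebra_simps)
  finally show ?thesis by (simp add: zw a_def b_def)
qed

lemma inner_stereo_Infty:
  "stereo (Fin z) \<bullet> stereo Infty = 1 - 2 / (1 + (cmod z)\<^sup>2)"
proof -
  have "((cmod z)\<^sup>2 - 1) / (1 + (cmod z)\<^sup>2) = 1 - 2 / (1 + (cmod z)\<^sup>2)"
    by (simp add: field_simps)
  then show ?thesis by (simp add: inner_prod_def)
qed

lemma norm_stereo [simp]: "norm (stereo x) = 1"
proof (cases x)
  case (Fin z)
  then show ?thesis using inner_stereo_Fin[of z z] by (simp add: norm_eq_1)
qed (simp add: norm_Pair)

lemma stereo_eq_iff [simp]: "stereo x = stereo y \<longleftrightarrow> x = y"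
proof
  assume eq: "stereo x = stereo y"
  then have 1: "stereo x \<bullet> stereo y = 1"
    using norm_stereo[of y] unfolding norm_eq_1 by simp
  show "x = y"
  proof (cases x; cases y)
    fix z w assume "x = Fin z" "y = Fin w"
    then show ?thesis using 1 by (simp add: inner_stereo_Fin del: stereo.simps)
  next
    fix z assume "x = Fin z" "y = Infty"
    then show ?thesis using 1 by (simp add: inner_stereo_Infty del: stereo.simps)
  next
    fix z assume "y = Fin z" "x = Infty"
    then show ?thesis using 1
      by (simp add: inner_stereo_Infty inner_commute[of "stereo Infty"] del: stereo.simps)
  qed simp
qed simp

lemma arccos_inner_triangle:
  fixes u v w :: "'a::real_inner"
  assumes [simp]: "norm u = 1" "norm v = 1" "norm w = 1"
  shows "arccos (u \<bullet> w) \<le> arccos (u \<bullet> v) + arccos (v \<bullet> w)"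
proof -
  have bd: "\<bar>x \<bullet> y\<bar> \<le> 1" if "norm x = 1" "norm y = 1" for x y :: 'a
    using Cauchy_Schwarz_ineq2[of x y] that by simp
  have [simp]: "u \<bullet> u = 1" "v \<bullet> v = 1" "w \<bullet> w = 1"
    using assms unfolding norm_eq_1 by simp_all
  define a b where "a = u \<bullet> v" and "b = v \<bullet> w"
  have ab: "\<bar>a\<bar> \<le> 1" "\<bar>b\<bar> \<le> 1" "\<bar>u \<bullet> w\<bar> \<le> 1"
    unfolding a_def b_def by (simp_all add: bd)
  have rng: "0 \<le> arccos a" "0 \<le> arccos b" "arccos (u \<bullet> w) \<le> pi"
    using ab by (auto intro!: arccos_lbound arccos_ubound simp: abs_le_iff)
  show ?thesis
  proof (cases "arccos a + arccos b \<ge> pi")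
    case True
    then show ?thesis using rng by (simp add: a_def b_def)
  next
    case False
    have na: "norm (u - a *\<^sub>R v) = sqrt (1 - a\<^sup>2)"
      by (simp add: norm_eq_sqrt_inner inner_diff a_def inner_commute power2_eq_square)
    have nb: "norm (w - b *\<^sub>R v) = sqrt (1 - b\<^sup>2)"
      by (simp add: norm_eq_sqrt_inner inner_diff b_def inner_commute power2_eq_square)
    have "(u - a *\<^sub>R v) \<bullet> (w - b *\<^sub>R v) = u \<bullet> w - a * b"
      by (simp add: inner_diff a_def b_def inner_commute)
    moreover have "\<bar>(u - a *\<^sub>R v) \<bullet> (w - b *\<^sub>R v)\<bar> \<le> sqrt (1 - a\<^sup>2) * sqrt (1 - b\<^sup>2)"
      using Cauchy_Schwarz_ineq2[of "u - a *\<^sub>R v" "w - b *\<^sub>R v"] by (simp add: na nb)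
    ultimately have "a * b - sqrt (1 - a\<^sup>2) * sqrt (1 - b\<^sup>2) \<le> u \<bullet> w"
      by linarith
    then have "cos (arccos a + arccos b) \<le> u \<bullet> w"
      using ab by (simp add: cos_add cos_arccos_abs sin_arccos_abs)
    then have "arccos (u \<bullet> w) \<le> arccos (cos (arccos a + arccos b))"
      using ab by (intro arccos_le_arccos) (auto simp: abs_le_iff)
    also have "\<dots> = arccos a + arccos b"
      using False rng by (intro arccos_cos) auto
    finally show ?thesis by (simp add: a_def b_def)
  qed
qed

text \<open>The distance is the angle between the stereographic images, i.e. the geodesic distance of the
  Riemannian metric \<open>2 |dz| / (1 + |z|\<^sup>2)\<close>.\<close>

instantiation riemann_sphere :: metric_space
begin

definition dist_riemann_sphere :: "riemann_sphere \<Rightarrow> riemann_sphere \<Rightarrow> real" where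
  "dist x y = arccos (stereo x \<bullet> stereo y)"

definition uniformity_riemann_sphere :: "(riemann_sphere \<times> riemann_sphere) filter" where
  "uniformity = (INF e\<in>{0<..}. principal {(x :: riemann_sphere, y). dist x y < e})"

definition open_riemann_sphere :: "riemann_sphere set \<Rightarrow> bool" where
  "open (U :: riemann_sphere set) = (\<forall>x\<in>U. eventually (\<lambda>(x', y). x' = x \<longrightarrow> y \<in> U) uniformity)"

instance
proof
  fix x y z :: riemann_sphere
  have bd: "\<bar>stereo x \<bullet> stereo y\<bar> \<le> 1"
    using Cauchy_Schwarz_ineq2[of "stereo x" "stereo y"] by simp
  show "dist x y = 0 \<longleftrightarrow> x = y"
  proof
    assume "dist x y = 0"
    then have "stereo x \<bullet> stereo y = 1"
      using bd cos_arccos_abs[of "stereo x \<bullet> stereo y"] by (simp add: dist_riemann_sphere_def)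
    then have "(norm (stereo x - stereo y))\<^sup>2 = 0"
      using norm_stereo[of x] norm_stereo[of y]
      unfolding power2_norm_eq_inner norm_eq_1 by (simp add: inner_diff inner_commute)
    then show "x = y" by simp
  next
    assume "x = y"
    then show "dist x y = 0"
      using norm_stereo[of y] unfolding norm_eq_1 by (simp add: dist_riemann_sphere_def)
  qed
  show "dist x y \<le> dist x z + dist y z"
    using arccos_inner_triangle[of "stereo x" "stereo z" "stereo y"]
    by (simp add: dist_riemann_sphere_def inner_commute)
qed (rule uniformity_riemann_sphere_def open_riemann_sphere_def)+

end

lemma dist_le_pi: "dist x y \<le> pi" for x y :: riemann_sphere
  unfolding dist_riemann_sphere_def
  using Cauchy_Schwarz_ineq2[of "stereo x" "stereo y"]
  by (intro arccos_ubound) (auto simp: abs_le_iff)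

lemma arccos_half_angle:
  assumes "0 \<le> t" "t \<le> 1" shows "arccos (1 - 2 * t\<^sup>2) = 2 * arcsin t"
proof -
  have "1 - 2 * t\<^sup>2 = cos (2 * arcsin t)"
    using assms by (simp add: cos_double_sin)
  moreover have "0 \<le> 2 * arcsin t" "2 * arcsin t \<le> pi"
    using assms arcsin_le_arcsin[of 0 t] arcsin_ubound[of t] by auto
  ultimately show ?thesis by (simp add: arccos_cos)
qed

lemma dist_Fin_Fin:
  "dist (Fin z) (Fin w) =
     2 * arcsin (cmod (z - w) / sqrt ((1 + (cmod z)\<^sup>2) * (1 + (cmod w)\<^sup>2)))" (is "_ = 2 * arcsin ?t")
proof -
  have sq: "?t\<^sup>2 = (cmod (z - w))\<^sup>2 / ((1 + (cmod z)\<^sup>2) * (1 + (cmod w)\<^sup>2))"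
    by (simp add: power_divide)
  have "stereo (Fin z) \<bullet> stereo (Fin w) \<ge> -1"
    using Cauchy_Schwarz_ineq2[of "stereo (Fin z)" "stereo (Fin w)"] by (simp del: stereo.simps)
  then have "?t\<^sup>2 \<le> 1" unfolding inner_stereo_Fin sq by linarith
  then have "?t \<le> 1" by (rule power2_le_imp_le[where y = 1, simplified]) 
  moreover have "0 \<le> ?t" by simp
  ultimately show ?thesis
    using arccos_half_angle[of ?t] unfolding dist_riemann_sphere_def inner_stereo_Fin sq by simp
qed

lemma dist_Fin_Infty:
  "dist (Fin z) Infty = 2 * arcsin (1 / sqrt (1 + (cmod z)\<^sup>2))" (is "_ = 2 * arcsin ?t")
proof -
  have sq: "?t\<^sup>2 = 1 / (1 + (cmod z)\<^sup>2)"
    by (simp add: power_divide)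
  have "0 \<le> ?t" "?t \<le> 1" by simp_all
  then show ?thesis
    using arccos_half_angle[of ?t] unfolding dist_riemann_sphere_def inner_stereo_Infty sq by simp
qed


section \<open>Rational maps and their Julia sets\<close>

text \<open>In homogeneous coordinates the value at \<open>\<infinity>\<close> is the ratio of the coefficients of degree
  \<open>max (degree p) (degree q)\<close>.\<close>

definition rat_fun :: "complex poly \<Rightarrow> complex poly \<Rightarrow> riemann_sphere \<Rightarrow> riemann_sphere" where
  "rat_fun p q x =
     (case x of
        Fin z \<Rightarrow> if poly q z = 0 then Infty else Fin (poly p z / poly q z)
      | Infty \<Rightarrow>
          (let d = max (degree p) (degree q)
           in if coeff q d = 0 then Infty else Fin (coeff p d / coeff q d)))"

definition rational_map :: "(riemann_sphere \<Rightarrow> riemann_sphere) \<Rightarrow> nat \<Rightarrow> bool" where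
  "rational_map f d \<longleftrightarrow>
     (\<exists>p q. coprime p q \<and> max (degree p) (degree q) = d \<and> f = rat_fun p q)"

definition normal_family :: "'a::metric_space set \<Rightarrow> ('a \<Rightarrow> 'b::metric_space) set \<Rightarrow> bool" where
  "normal_family U \<F> \<longleftrightarrow>
     (\<forall>s :: nat \<Rightarrow> 'a \<Rightarrow> 'b. range s \<subseteq> \<F> \<longrightarrow>
        (\<exists>(r :: nat \<Rightarrow> nat) g. strict_mono r \<and>
           (\<forall>K. compact K \<and> K \<subseteq> U \<longrightarrow> uniform_limit K (s \<circ> r) g sequentially)))"

definition fatou_set :: "('a::metric_space \<Rightarrow> 'a) \<Rightarrow> 'a set" where
  "fatou_set f = {x. \<exists>U. open U \<and> x \<in> U \<and> normal_family U (range (\<lambda>n. f ^^ n))}"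

definition julia_set :: "('a::metric_space \<Rightarrow> 'a) \<Rightarrow> 'a set" where
  "julia_set f = - fatou_set f"

definition conical_julia_set :: "('a::metric_space \<Rightarrow> 'a) \<Rightarrow> 'a set" where
  "conical_julia_set f =
     {x \<in> julia_set f. \<exists>\<rho>>0. \<forall>N. \<exists>n>N.
        inj_on (f ^^ n)
          (connected_component_set ((f ^^ n) -` ball ((f ^^ n) x) \<rho>) x)}"

text \<open>The Topological Collet-Eckmann condition, in its equivalent form of Exponential Shrinking of
  Components.\<close>

definition TCE :: "('a::metric_space \<Rightarrow> 'a) \<Rightarrow> bool" where
  "TCE f \<longleftrightarrow>
     (\<exists>\<Lambda>>1. \<exists>r\<^sub>0>0. \<forall>x\<in>julia_set f. \<forall>n\<ge>1.
        \<forall>W\<in>components ((f ^^ n) -` ball x r\<^sub>0). diameter W \<le> 1 / \<Lambda> ^ n)"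


section \<open>Hausdorff dimension\<close>

text \<open>The case distinction realises the conventions \<open>diam {} ^ s = 0\<close> for all \<open>s \<ge> 0\<close> and
  \<open>0 ^ 0 = 1\<close> for nonempty sets (whereas \<open>0 powr 0 = 0\<close>).\<close>

definition diam_powr :: "real \<Rightarrow> 'a::metric_space set \<Rightarrow> ennreal" where
  "diam_powr s U = (if U = {} then 0 else if s = 0 then 1 else ennreal (diameter U powr s))"

text \<open>Covering sets are required to be bounded because \<open>diameter\<close> is unspecified on unbounded
  sets.\<close>

definition hausdorff_premeasure :: "real \<Rightarrow> real \<Rightarrow> 'a::metric_space set \<Rightarrow> ennreal" where
  "hausdorff_premeasure s \<delta> A =
     (INF U \<in> {U :: nat \<Rightarrow> 'a set. A \<subseteq> (\<Union>i. U i) \<and> (\<forall>i. bounded (U i) \<and> diameter (U i) \<le> \<delta>)}.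
        \<Sum>i. diam_powr s (U i))"

definition hausdorff_measure :: "real \<Rightarrow> 'a::metric_space set \<Rightarrow> ennreal" where
  "hausdorff_measure s A = (SUP \<delta> \<in> {0<..}. hausdorff_premeasure s \<delta> A)"

definition hausdorff_dim :: "'a::metric_space set \<Rightarrow> ennreal" where
  "hausdorff_dim A = (INF s \<in> {s. 0 \<le> s \<and> hausdorff_measure s A = 0}. ennreal s)"

end

(*  Let C be the finite set of points at which f is not locally injective. If f^n is not injective on the
    pullback of a small ball along the orbit of x, then at some time k < n the pullback surrounds a point
    of f(C), and by the maximum principle a point c of C stays close to the orbit of x from time k on:
    f^(t-k)(c) is close to f^t(x) for k <= t < n. If this happens for all n > N, we find a chain of such
    times k along which points of C shadow x from time N on. By the shrinking of components no point of
    C in the Julia set is periodic, so the orbit of x approaches C only rarely. Hence the chain and the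
    branches of the inverse of f chosen near C are words with few nontrivial letters, and away from C the
    shadowing points determine the branch. Thus, for each N, the points x that are bad for all n > N lie
    in subexponentially many components of f^(-n) of small balls, each of exponentially small diameter. *)

theory Submission
  imports Defs "HOL-Complex_Analysis.Complex_Analysis"
    "HOL-Computational_Algebra.Polynomial_Factorial" "HOL-Computational_Algebra.Field_as_Ring"
begin

section \<open>Hausdorff measure and counting\<close>

text \<open>A component at level \<open>n\<close> has diameter at most
  \<open>1 / \<Lambda> ^ n\<close>, so for exponent \<open>s\<close> the number of components must
  grow more slowly than \<open>(\<Lambda> powr s) ^ n\<close>, for every \<open>s > 0\<close>. The
  bound \<open>D ^ n\<close> on inverse branches is far too large: the growth rate has to come
  arbitrarily close to 1. This dictates the order of the choices. The exponent \<open>s\<close>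
  fixes the weight \<open>\<theta>\<close> of a nontrivial letter, then a time \<open>M\<close>;
  only afterwards come the distance \<open>e\<close> below which a return to the same point of
  \<open>C\<close> takes at least \<open>M\<close> steps, and the radius \<open>\<rho>\<close> of
  the univalence test. That \<open>\<rho>\<close> depends on \<open>s\<close> does no harm, since a
  nonconical point fails the test for every radius. At trivial letters the branch is inherited:
  points with a common shadowing point are close to each other, and away from \<open>C\<close> close
  points with equal images coincide. All this takes place in a locale on compact metric spaces;
  complex analysis serves to verify the assumptions of that locale for rational maps.\<close>

lemma hausdorff_measure_eq_0I:
  fixes A :: "'a::metric_space set"
  assumes s: "0 < s" and A: "A \<subseteq> (\<Union>N::nat. A' N)"
    and small: "\<And>N \<delta> e. 0 < \<delta> \<Longrightarrow> 0 < e \<Longrightarrow> \<exists>F. finite F \<and> A' N \<subseteq> \<Union>F \<and>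
      (\<forall>W\<in>F. bounded W \<and> diameter W \<le> \<delta>) \<and> (\<Sum>W\<in>F. diameter W powr s) \<le> e"
  shows "hausdorff_measure s A = 0"
proof -
  have "hausdorff_premeasure s \<delta> A \<le> 0 + ennreal e" if \<delta>: "0 < \<delta>" and e: "0 < e" for \<delta> e
  proof -
    define \<epsilon> where "\<epsilon> N = e * (1 / 2) ^ Suc N" for N
    have "\<forall>N. \<exists>F. finite F \<and> A' N \<subseteq> \<Union>F \<and> (\<forall>W\<in>F. bounded W \<and> diameter W \<le> \<delta>) \<and>
        (\<Sum>W\<in>F. diameter W powr s) \<le> \<epsilon> N"
      using e unfolding \<epsilon>_def by (intro allI small[OF \<delta>]) simp
    then obtain F where F: "\<And>N. finite (F N)" "\<And>N. A' N \<subseteq> \<Union>(F N)"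
      "\<And>N W. W \<in> F N \<Longrightarrow> bounded W \<and> diameter W \<le> \<delta>"
      "\<And>N. (\<Sum>W\<in>F N. diameter W powr s) \<le> \<epsilon> N"
      by metis
    have "\<forall>N. \<exists>h. bij_betw h {0..<card (F N)} (F N)"
      using ex_bij_betw_nat_finite[OF F(1)] by blast
    then obtain h where h: "\<And>N. bij_betw (h N) {0..<card (F N)} (F N)" by metis
    \<comment> \<open>The finite families are padded with empty sets, which \<open>diam_powr\<close>
      counts as 0, so that one enumeration of pairs lists them all.\<close>
    define U where "U = (\<lambda>(N, i). if i < card (F N) then h N i else {})"
    have hF: "h N i \<in> F N" if "i < card (F N)" for N i
      using bij_betwE[OF h[of N]] that by auto
    have row: "(\<Sum>i. diam_powr s (U (N, i))) \<le> ennreal (\<epsilon> N)" for N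
    proof -
      have "(\<Sum>i. diam_powr s (U (N, i))) = (\<Sum>i\<in>{0..<card (F N)}. diam_powr s (U (N, i)))"
        by (rule suminf_finite) (auto simp: U_def diam_powr_def)
      also have "\<dots> \<le> (\<Sum>i\<in>{0..<card (F N)}. ennreal (diameter (h N i) powr s))"
        using s by (intro sum_mono) (auto simp: U_def diam_powr_def)
      also have "\<dots> = ennreal (\<Sum>i\<in>{0..<card (F N)}. diameter (h N i) powr s)"
        by simp
      also have "(\<Sum>i\<in>{0..<card (F N)}. diameter (h N i) powr s) = (\<Sum>W\<in>F N. diameter W powr s)"
        using sum.reindex_bij_betw[OF h[of N], of "\<lambda>W. diameter W powr s"] .
      finally show ?thesis using F(4)[of N] by (meson ennreal_leI order_trans)
    qed
    have "A \<subseteq> (\<Union>i. U (prod_decode i))"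
    proof
      fix x assume "x \<in> A"
      then obtain N where "x \<in> A' N" using A by blast
      then obtain W where W: "W \<in> F N" "x \<in> W" using F(2) by blast
      then obtain i where "i < card (F N)" "h N i = W"
        using h[of N] by (metis atLeastLessThan_iff bij_betw_imp_surj_on imageE)
      then have "x \<in> U (prod_decode (prod_encode (N, i)))" using W by (simp add: U_def)
      then show "x \<in> (\<Union>i. U (prod_decode i))" by blast
    qed
    moreover have "bounded (U p) \<and> diameter (U p) \<le> \<delta>" for p
      using F(3) hF \<delta> by (cases p) (auto simp: U_def)
    ultimately have "hausdorff_premeasure s \<delta> A \<le> (\<Sum>i. diam_powr s (U (prod_decode i)))"
      unfolding hausdorff_premeasure_def by (intro INF_lower) auto
    also have "\<dots> = (\<Sum>N. \<Sum>i. diam_powr s (U (N, i)))"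
      by (rule suminf_ennreal_2dimen) simp
    also have "\<dots> \<le> (\<Sum>N. ennreal (\<epsilon> N))"
      by (intro suminf_le row) auto
    also have "\<dots> = ennreal e"
    proof -
      have "(\<lambda>N. e * (1 / 2) ^ Suc N) sums (e * 1)"
        by (intro sums_mult power_half_series)
      then show ?thesis
        using e by (intro suminf_ennreal_eq) (simp_all add: \<epsilon>_def less_imp_le)
    qed
    finally show ?thesis by simp
  qed
  then have "hausdorff_premeasure s \<delta> A = 0" if "0 < \<delta>" for \<delta>
    using that by (metis ennreal_le_epsilon le_zero_eq)
  then show ?thesis by (auto simp: hausdorff_measure_def intro!: SUP_eqI)
qed

lemma hausdorff_dim_eq_0I:
  assumes "\<And>s. 0 < s \<Longrightarrow> hausdorff_measure s A = 0"
  shows "hausdorff_dim A = 0"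
proof -
  have "hausdorff_dim A \<le> 0 + ennreal e" if "0 < e" for e
    unfolding hausdorff_dim_def using that assms by (intro INF_lower2[of e]) auto
  then show ?thesis by (metis ennreal_le_epsilon le_zero_eq)
qed

text \<open>Giving weight \<open>\<theta>\<close> to every letter other than \<open>z\<close>, the words of length \<open>n\<close> have total weight
  \<open>(1 + \<theta> * card A) ^ n\<close>.\<close>

lemma card_sparse_words:
  fixes \<theta> :: real
  assumes A: "finite A" "z \<notin> A" and \<theta>: "0 < \<theta>" "\<theta> \<le> 1"
  shows "card {g \<in> {..<n} \<rightarrow>\<^sub>E insert z A. card {t. t < n \<and> g t \<noteq> z} \<le> B} * \<theta> ^ B
    \<le> (1 + \<theta> * card A) ^ n"
proof -
  let ?P = "{..<n} \<rightarrow>\<^sub>E insert z A"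
  let ?Q = "{g \<in> ?P. card {t. t < n \<and> g t \<noteq> z} \<le> B}"
  define w where "w y = (if y = z then 1 else \<theta>)" for y
  have finP: "finite ?P" using A by (intro finite_PiE) auto
  have w: "(\<Prod>t<n. w (g t)) = \<theta> ^ card {t. t < n \<and> g t \<noteq> z}" for g
  proof -
    have "(\<Prod>t<n. w (g t)) = (\<Prod>t\<in>{t. t < n \<and> g t \<noteq> z}. \<theta>)"
      unfolding w_def by (intro prod.mono_neutral_cong_right) auto
    then show ?thesis by simp
  qed
  \<comment> \<open>As in Markov's inequality: since \<open>\<theta> \<le> 1\<close>, each counted
    word has weight at least \<open>\<theta> ^ B\<close>.\<close>
  have "card ?Q * \<theta> ^ B = (\<Sum>g\<in>?Q. \<theta> ^ B)" by simp
  also have "\<dots> \<le> (\<Sum>g\<in>?Q. \<Prod>t<n. w (g t))"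
    unfolding w using \<theta> by (intro sum_mono power_decreasing) auto
  also have "\<dots> \<le> (\<Sum>g\<in>?P. \<Prod>t<n. w (g t))"
  proof (rule sum_mono2[OF finP])
    show "0 \<le> (\<Prod>t<n. w (g t))" for g
      using \<theta> by (intro prod_nonneg) (simp add: w_def)
  qed blast
  also have "\<dots> = (\<Prod>t<n. \<Sum>y\<in>insert z A. w y)"
    using A by (subst prod_sum_PiE) auto
  also have "(\<Sum>y\<in>insert z A. w y) = 1 + \<theta> * card A"
  proof -
    have "(\<Sum>y\<in>A. w y) = (\<Sum>y\<in>A. \<theta>)" using A by (intro sum.cong) (auto simp: w_def)
    then show ?thesis using A by (simp add: w_def mult.commute)
  qed
  finally show ?thesis by simp
qed

text \<open>Apply the hypothesis to \<open>n\<close>, then to the \<open>k\<close> it yields, and so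
  on until a time at most \<open>N\<close> is reached. The intervals so obtained cover the times
  from \<open>N\<close> on, and each time belongs to the interval that starts at the last entry up
  to it. As \<open>\<kappa>\<close> stores the starting times with their \<open>c\<close>, the pair
  valid at \<open>t\<close> can be read off from \<open>\<kappa>\<close> at times up to
  \<open>t\<close>.\<close>

lemma last_entry_chain:
  fixes P :: "nat \<Rightarrow> 'b \<Rightarrow> nat \<Rightarrow> bool"
  assumes "\<And>n. N < n \<Longrightarrow> \<exists>k<n. \<exists>c\<in>A. \<forall>t. k \<le> t \<and> t < n \<longrightarrow> P k c t"
  shows "\<exists>\<kappa>. (\<forall>j c. \<kappa> j = Some c \<longrightarrow> j < n \<and> c \<in> A \<and> P j c j) \<and>
    (\<forall>t. N \<le> t \<and> t < n \<longrightarrow>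
      (\<exists>k\<le>t. \<exists>c. \<kappa> k = Some c \<and> (\<forall>j. k < j \<and> j \<le> t \<longrightarrow> \<kappa> j = None) \<and> P k c t))"
proof (induction n rule: less_induct)
  case (less n)
  show ?case
  proof (cases "N < n")
    case True
    then obtain k c where k: "k < n" "c \<in> A" "\<And>t. k \<le> t \<Longrightarrow> t < n \<Longrightarrow> P k c t"
      using assms by blast
    obtain \<kappa> where \<kappa>': "\<forall>j c. \<kappa> j = Some c \<longrightarrow> j < k \<and> c \<in> A \<and> P j c j"
      "\<forall>t. N \<le> t \<and> t < k \<longrightarrow>
      (\<exists>i\<le>t. \<exists>c. \<kappa> i = Some c \<and> (\<forall>j. i < j \<and> j \<le> t \<longrightarrow> \<kappa> j = None) \<and> P i c t)"
      using less.IH[OF k(1)] by (elim exE conjE)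
    note \<kappa> = \<kappa>'(1)[rule_format] \<kappa>'(2)[rule_format, OF conjI]
    have none: "\<kappa> j = None" if "k \<le> j" for j
      using \<kappa>(1)[of j] that by (cases "\<kappa> j") auto
    let ?\<kappa> = "\<kappa>(k := Some c)"
    show ?thesis
    proof (intro exI[of _ ?\<kappa>] conjI allI impI)
      fix j c' assume "?\<kappa> j = Some c'"
      then show "j < n" "c' \<in> A" "P j c' j"
        using k \<kappa>(1)[of j c'] by (auto split: if_splits)
    next
      fix t assume t: "N \<le> t \<and> t < n"
      show "\<exists>i\<le>t. \<exists>c'. ?\<kappa> i = Some c' \<and> (\<forall>j. i < j \<and> j \<le> t \<longrightarrow> ?\<kappa> j = None) \<and> P i c' t"
      proof (cases "k \<le> t")
        case True
        then show ?thesis using k t none by (intro exI[of _ k]) auto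
      next
        case False
        then obtain i c' where "i \<le> t" "\<kappa> i = Some c'" "\<forall>j. i < j \<and> j \<le> t \<longrightarrow> \<kappa> j = None" "P i c' t"
          using \<kappa>(2)[of t] t by auto
        then show ?thesis using False by (intro exI[of _ i]) auto
      qed
    qed
  qed (intro exI[of _ "\<lambda>_. None"], auto)
qed

text \<open>\<open>P a\<close> may fail to be monotone, so the hypothesis speaks of all smaller
  radii; this is what makes the minimum work.\<close>

lemma finite_uniform_radius:
  fixes P :: "'b \<Rightarrow> real \<Rightarrow> bool"
  assumes "finite A" "\<And>a. a \<in> A \<Longrightarrow> \<exists>e>0. \<forall>e'. 0 < e' \<and> e' \<le> e \<longrightarrow> P a e'"
  shows "\<exists>e>0. \<forall>a\<in>A. \<forall>e'. 0 < e' \<and> e' \<le> e \<longrightarrow> P a e'"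
  using assms
proof (induction A)
  case (insert a A)
  have "\<exists>e>0. \<forall>b\<in>A. \<forall>e'. 0 < e' \<and> e' \<le> e \<longrightarrow> P b e'"
    by (rule insert.IH) (rule insert.prems, simp)
  moreover have "\<exists>e>0. \<forall>e'. 0 < e' \<and> e' \<le> e \<longrightarrow> P a e'"
    by (rule insert.prems) simp
  ultimately obtain e1 e2 where "0 < e1" "\<forall>b\<in>A. \<forall>e'. 0 < e' \<and> e' \<le> e1 \<longrightarrow> P b e'"
    "0 < e2" "\<forall>e'. 0 < e' \<and> e' \<le> e2 \<longrightarrow> P a e'" by (elim exE conjE)
  then show ?case by (intro exI[of _ "min e1 e2"]) auto
qed (auto intro: exI[of _ 1])

text \<open>Serves to bound the number of components by the number of code words, as the code
  determines the component.\<close>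

lemma card_image_le_if_factors:
  assumes "finite K" "h ` X \<subseteq> K" "\<And>x y. x \<in> X \<Longrightarrow> y \<in> X \<Longrightarrow> h x = h y \<Longrightarrow> g x = g y"
  shows "finite (g ` X)" "card (g ` X) \<le> card K"
proof -
  define k where "k = (\<lambda>w. g (SOME x. x \<in> X \<and> h x = w))"
  have k: "k (h x) = g x" if "x \<in> X" for x
  proof -
    have "(SOME y. y \<in> X \<and> h y = h x) \<in> X \<and> h (SOME y. y \<in> X \<and> h y = h x) = h x"
      by (rule someI[of _ x]) (use that in auto)
    then show ?thesis unfolding k_def using assms(3) that by blast
  qed
  then have "g ` X = k ` (h ` X)" by (force simp: image_image)
  then have *: "g ` X \<subseteq> k ` K" using assms(2) by (simp add: image_mono)
  show "finite (g ` X)" using * assms(1) finite_surj by blast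
  show "card (g ` X) \<le> card K"
    using * assms(1) by (meson card_image_le card_mono finite_imageI order_trans)
qed

section \<open>Julia sets of continuous maps\<close>

lemma continuous_on_funpow:
  fixes f :: "'a::topological_space \<Rightarrow> 'a"
  assumes "continuous_on UNIV f"
  shows "continuous_on UNIV (f ^^ n)"
proof (induction n)
  case (Suc n)
  then show ?case
    using continuous_on_compose[of UNIV "f ^^ n" f] continuous_on_subset[OF assms] by simp
qed (simp add: id_def)

lemma closed_julia_set: "closed (julia_set f)"
proof -
  have "fatou_set f = \<Union>{U. open U \<and> normal_family U (range (\<lambda>n. f ^^ n))}"
    by (auto simp: fatou_set_def)
  then have "open (fatou_set f)"
    by (metis (no_types, lifting) mem_Collect_eq open_Union)
  then show ?thesis
    by (simp add: julia_set_def closed_Compl)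
qed

text \<open>Composing with \<open>f\<close> turns locally uniform limits of iterates near
  \<open>f x\<close> into limits of the next iterates near \<open>x\<close>. The exponent 0 is the
  only one not reached in this way, whence the case split.\<close>

lemma fatou_set_vimage:
  assumes cont: "continuous_on UNIV f" and "f x \<in> fatou_set f"
  shows "x \<in> fatou_set f"
proof -
  obtain U where U: "open U" "f x \<in> U" "normal_family U (range (\<lambda>n. f ^^ n))"
    using assms by (auto simp: fatou_set_def)
  have "normal_family (f -` U) (range (\<lambda>n. f ^^ n))"
    unfolding normal_family_def
  proof (intro allI impI)
    fix s :: "nat \<Rightarrow> 'a \<Rightarrow> 'a" assume "range s \<subseteq> range (\<lambda>n. f ^^ n)"
    then have "\<forall>i. \<exists>n. s i = f ^^ n" by blast
    then obtain m where m: "\<And>i. s i = f ^^ m i" by metis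
    show "\<exists>(r :: nat \<Rightarrow> nat) g. strict_mono r \<and>
           (\<forall>K. compact K \<and> K \<subseteq> f -` U \<longrightarrow> uniform_limit K (s \<circ> r) g sequentially)"
    proof (cases "infinite {i. m i = 0}")
      case True
      define r where "r = enumerate {i. m i = 0}"
      have "strict_mono r" "\<And>i. m (r i) = 0"
        using True enumerate_in_set[OF True] by (auto simp: r_def strict_mono_enumerate)
      moreover from this have "s \<circ> r = (\<lambda>_. id)"
        by (auto simp: m)
      ultimately show ?thesis
        by (intro exI[of _ r] exI[of _ id]) (simp add: uniform_limit_const)
    next
      case False
      then have "finite {i. m i = 0}" by simp
      then obtain N where "\<forall>i\<in>{i. m i = 0}. i < N"
        using finite_nat_set_iff_bounded by blast
      then have N: "\<And>i. m i = 0 \<Longrightarrow> i < N" by blast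
      \<comment> \<open>Beyond \<open>N\<close> the exponent 0 no longer occurs, so one
        \<open>f\<close> can be split off from each iterate.\<close>
      define s' where "s' i = f ^^ (m (i + N) - 1)" for i
      have "range s' \<subseteq> range (\<lambda>n. f ^^ n)" by (auto simp: s'_def)
      with U(3) have "\<exists>(r :: nat \<Rightarrow> nat) g. strict_mono r \<and>
           (\<forall>K. compact K \<and> K \<subseteq> U \<longrightarrow> uniform_limit K (s' \<circ> r) g sequentially)"
        unfolding normal_family_def by (elim allE[of _ s'] impE)
      then obtain r :: "nat \<Rightarrow> nat" and g where r: "strict_mono r"
        and "\<forall>K. compact K \<and> K \<subseteq> U \<longrightarrow> uniform_limit K (s' \<circ> r) g sequentially"
        by (elim exE conjE)
      then have g: "\<And>K. compact K \<Longrightarrow> K \<subseteq> U \<Longrightarrow> uniform_limit K (s' \<circ> r) g sequentially"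
        by simp
      have s: "s (r i + N) x = s' (r i) (f x)" for i x
      proof -
        have "m (r i + N) \<noteq> 0" using N[of "r i + N"] by auto
        then obtain k where "m (r i + N) = Suc k" using not0_implies_Suc by blast
        then show ?thesis
          by (simp add: m s'_def funpow_swap1)
      qed
      show ?thesis
      proof (intro exI conjI allI impI)
        show "strict_mono (\<lambda>i. r i + N)" using r by (simp add: strict_mono_def)
        fix K :: "'a set" assume K: "compact K \<and> K \<subseteq> f -` U"
        then have "compact (f ` K)" "f ` K \<subseteq> U"
          using compact_continuous_image continuous_on_subset[OF cont] by blast+
        from g[OF this] show "uniform_limit K (s \<circ> (\<lambda>i. r i + N)) (g \<circ> f) sequentially"
          unfolding uniform_limit_iff by (simp add: s)
      qed
    qed
  qed
  moreover have "open (f -` U)"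
    using U(1) cont by (simp add: continuous_on_open_vimage)
  ultimately show ?thesis
    using U(2) by (auto simp: fatou_set_def)
qed

lemma julia_set_funpow:
  assumes "continuous_on UNIV f" "x \<in> julia_set f"
  shows "(f ^^ n) x \<in> julia_set f"
  using assms(2) fatou_set_vimage[OF assms(1)]
  by (induction n) (auto simp: julia_set_def)

section \<open>Finite branched maps of compact spaces\<close>

text \<open>The assumption \<open>enclose\<close> is a topological substitute for the normal form \<open>z ^ k\<close> of a holomorphic
  map: a loop that is the image of a short non-closed path winds around the critical value.\<close>

locale branched_map =
  fixes f :: "'a::metric_space \<Rightarrow> 'a" and C :: "'a set" and D :: nat and R :: real
  assumes compact_UNIV: "compact (UNIV :: 'a set)"
    and locally_path_connected_UNIV: "locally path_connected (UNIV :: 'a set)"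
    and R_pos: "0 < R"
    and connected_cap: "\<And>y :: 'a. \<And>r. r < R \<Longrightarrow> connected (- cball y r)"
    and far_point: "\<And>y :: 'a. \<exists>z. R \<le> dist y z"
    and not_isolated: "\<And>(x :: 'a) e. 0 < e \<Longrightarrow> \<exists>y. y \<noteq> x \<and> dist x y < e"
    and cont: "continuous_on UNIV f"
    and open_map: "\<And>U. open U \<Longrightarrow> open (f ` U)"
    and finite_fibre: "\<And>y. finite (f -` {y})"
    and card_fibre: "\<And>y. card (f -` {y}) \<le> D"
    and finite_C: "finite C"
    and locally_inj: "\<And>a. a \<notin> C \<Longrightarrow> \<exists>e>0. inj_on f (ball a e)"
    and lipschitz_at: "\<And>a. \<exists>K>0. \<exists>e>0. \<forall>z. dist z a < e \<longrightarrow> dist (f z) (f a) \<le> K * dist z a"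
    and critical_at: "\<And>c e. c \<in> C \<Longrightarrow> 0 < e \<Longrightarrow>
            \<exists>\<delta>>0. \<forall>z. dist z c < \<delta> \<longrightarrow> dist (f z) (f c) \<le> e * dist z c"
    and enclose: "\<And>c e. 0 < e \<Longrightarrow> \<exists>\<delta>>0. \<forall>g. path g \<and> path_image g \<subseteq> ball c \<delta> \<and>
            pathstart g \<noteq> pathfinish g \<and> f (pathstart g) = f (pathfinish g) \<longrightarrow>
            (\<exists>G. open G \<and> G \<subseteq> ball (f c) e \<and> frontier G \<subseteq> f ` path_image g \<and>
              f c \<in> G \<union> f ` path_image g)"
begin

abbreviation "J \<equiv> julia_set f"

section \<open>Components of preimages and inverse branches\<close>

lemma cont_funpow: "continuous_on A (f ^^ n)"
  using continuous_on_funpow[OF cont] continuous_on_subset by blast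

lemma open_vimage_funpow: "open U \<Longrightarrow> open ((f ^^ n) -` U)"
  using cont_funpow[of UNIV] by (simp add: continuous_on_open_vimage)

lemma open_connected_component_set: "open U \<Longrightarrow> open (connected_component_set U (x :: 'a))"
proof (cases "x \<in> U")
  case True
  assume "open U"
  have *: "\<forall>t x. open t \<and> x \<in> t \<longrightarrow> open (connected_component_set t (x :: 'a))"
    using locally_path_connected_imp_locally_connected[OF locally_path_connected_UNIV]
    unfolding locally_connected_open_connected_component by simp
  show ?thesis by (rule *[THEN spec, THEN spec, THEN mp]) (use True \<open>open U\<close> in simp)
qed (metis connected_component_eq_empty open_empty)

lemma open_connected_imp_path_connected:
  fixes U :: "'a set"
  assumes "open U" "connected U" shows "path_connected U"
proof -
  have "locally path_connected U"
    using locally_open_subset[OF locally_path_connected_UNIV] assms(1) by simp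
  then show ?thesis
    using assms(2) path_component_eq_connected_component[of U]
    by (metis connected_iff_connected_component path_connected_component)
qed

lemma uniform_cont:
  assumes "0 < e"
  shows "\<exists>\<delta>>0. \<forall>x y. dist x y < \<delta> \<longrightarrow> dist (f x) (f y) < e"
  using compact_uniformly_continuous[OF cont compact_UNIV] assms
  unfolding uniformly_continuous_on_def by (metis UNIV_I dist_commute)

lemma closed_image:
  assumes "closed K" shows "closed (f ` K)"
proof -
  have "compact K" using compact_UNIV assms compact_Int_closed[of UNIV K] by simp
  then show ?thesis
    using compact_continuous_image compact_imp_closed continuous_on_subset[OF cont] by blast
qed

text \<open>The image of \<open>W\<close> is open because \<open>f\<close> is an open map. It is
  closed in \<open>U\<close> because \<open>W\<close> is relatively closed in the preimage and the
  image of its compact closure is closed. Connectedness of \<open>U\<close> does the rest.\<close>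

lemma component_image:
  assumes U: "open U" "connected U" and W: "W \<in> components (f -` U)"
  shows "f ` W = U"
proof -
  have opV: "open (f -` U)"
    using open_vimage_funpow[OF U(1), of 1] by simp
  have opW: "open W"
    using W open_connected_component_set[OF opV] by (auto simp: components_iff)
  have sub: "f ` W \<subseteq> U" "W \<noteq> {}"
    using W in_components_subset in_components_nonempty by auto
  \<comment> \<open>A limit point of \<open>W\<close> in the preimage has an open component, which
    meets \<open>W\<close> and so equals it.\<close>
  have cl: "closure W \<inter> f -` U \<subseteq> W"
  proof
    fix b assume b: "b \<in> closure W \<inter> f -` U"
    define B where "B = connected_component_set (f -` U) b"
    have "open B" "b \<in> B" using b open_connected_component_set[OF opV] by (auto simp: B_def)
    then have "B \<inter> W \<noteq> {}" using b by (metis IntD1 disjoint_iff open_Int_closure_eq_empty)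
    then have "B = W"
      using W b components_nonoverlap[of B "f -` U" W]
      by (auto simp: B_def components_iff)
    then show "b \<in> W" using \<open>b \<in> B\<close> by simp
  qed
  have clo: "closed (f ` closure W)" by (rule closed_image) simp
  have "f ` W = U \<inter> f ` closure W"
    using sub cl closure_subset[of W] by auto
  then have "closedin (top_of_set U) (f ` W)" using clo by (metis closedin_closed_Int)
  moreover have "openin (top_of_set U) (f ` W)"
    using open_map[OF opW] sub by (simp add: open_subset)
  ultimately show ?thesis
    using U(2) sub unfolding connected_clopen by blast
qed

text \<open>Every component maps onto \<open>U\<close> and hence meets the fibre over any fixed
  point of \<open>U\<close>, so the points of one fibre label all components.\<close>

lemma components_vimage_bound:
  assumes "open U" "connected U"
  shows "finite (components (f -` U)) \<and> card (components (f -` U)) \<le> D"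
proof (cases "U = {}")
  case False
  then obtain y where y: "y \<in> U" by blast
  have *: "components (f -` U) \<subseteq> (\<lambda>x. connected_component_set (f -` U) x) ` (f -` {y})"
  proof
    fix W assume W: "W \<in> components (f -` U)"
    from component_image[OF assms W] y obtain x where x: "x \<in> W" "f x = y" by auto
    then have "W = connected_component_set (f -` U) x"
      using W by (metis components_iff connected_component_eq)
    then show "W \<in> (\<lambda>x. connected_component_set (f -` U) x) ` (f -` {y})"
      using x by auto
  qed
  show ?thesis
    using finite_subset[OF *] card_mono[OF _ *] card_image_le[OF finite_fibre[of y]]
      finite_fibre[of y] card_fibre[of y] by (meson finite_imageI order_trans)
qed simp

text \<open>Numbering for all \<open>U\<close> at once turns the choice of an inverse branch into a
  letter of a fixed alphabet. The number depends on \<open>U\<close> and \<open>W\<close> alone, so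
  orbits with the same \<open>U\<close> and the same number use the same branch.\<close>

lemma branch_index:
  obtains idx :: "'a set \<Rightarrow> 'a set \<Rightarrow> nat" where
    "\<And>U. open U \<Longrightarrow> connected U \<Longrightarrow> inj_on (idx U) (components (f -` U))"
    "\<And>U W. open U \<Longrightarrow> connected U \<Longrightarrow> W \<in> components (f -` U) \<Longrightarrow> idx U W < D"
proof -
  have "\<exists>i :: 'a set \<Rightarrow> nat. inj_on i (components (f -` U)) \<and> (\<forall>W\<in>components (f -` U). i W < D)"
    if "open U" "connected U" for U
  proof -
    obtain h where h: "bij_betw h (components (f -` U)) {0..<card (components (f -` U))}"
      using ex_bij_betw_finite_nat components_vimage_bound[OF \<open>open U\<close> \<open>connected U\<close>] by blast
    have "h W < D" if "W \<in> components (f -` U)" for W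
      using bij_betwE[OF h] that components_vimage_bound[OF \<open>open U\<close> \<open>connected U\<close>] by fastforce
    then show ?thesis using h by (auto simp: bij_betw_def)
  qed
  then obtain idx :: "'a set \<Rightarrow> 'a set \<Rightarrow> nat" where "\<forall>U. open U \<longrightarrow> connected U \<longrightarrow>
      inj_on (idx U) (components (f -` U)) \<and> (\<forall>W\<in>components (f -` U). idx U W < D)"
    by metis
  then show thesis using that by blast
qed

text \<open>Outside the \<open>e\<close>-balls around \<open>C\<close> every point has a ball on
  which \<open>f\<close> is injective; a Lebesgue number of this cover of a compact set makes the
  size uniform.\<close>

lemma near_critical:
  assumes "0 < e"
  shows "\<exists>\<delta>>0. \<forall>a b. a \<noteq> b \<and> f a = f b \<and> dist a b < \<delta> \<longrightarrow> (\<exists>c\<in>C. dist a c < e)"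
proof -
  define K where "K = UNIV - (\<Union>c\<in>C. ball c e)"
  have "compact K"
    unfolding K_def using compact_UNIV by (intro compact_diff) auto
  define \<G> where "\<G> = {ball a r |a r. 0 < r \<and> inj_on f (ball a r)}"
  have "K \<subseteq> \<Union>\<G>"
  proof
    fix a assume "a \<in> K"
    then have "a \<notin> C" using assms by (auto simp: K_def)
    then obtain r where "0 < r" "inj_on f (ball a r)" using locally_inj by blast
    then show "a \<in> \<Union>\<G>" using centre_in_ball unfolding \<G>_def by blast
  qed
  moreover have "\<And>G. G \<in> \<G> \<Longrightarrow> open G" by (auto simp: \<G>_def)
  ultimately obtain \<delta> where \<delta>: "0 < \<delta>" "\<And>x. x \<in> K \<Longrightarrow> \<exists>G\<in>\<G>. ball x \<delta> \<subseteq> G"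
    using Heine_Borel_lemma[OF \<open>compact K\<close>] by metis
  have "\<exists>c\<in>C. dist a c < e" if ab: "a \<noteq> b" "f a = f b" "dist a b < \<delta>" for a b
  proof (rule ccontr)
    assume "\<not> (\<exists>c\<in>C. dist a c < e)"
    then have "a \<in> K" by (auto simp: K_def dist_commute)
    then obtain G where G: "G \<in> \<G>" "ball a \<delta> \<subseteq> G" using \<delta> by blast
    then have "inj_on f (ball a \<delta>)" by (auto simp: \<G>_def intro: inj_on_subset)
    then show False using ab \<delta>(1) by (auto simp: inj_on_def)
  qed
  then show ?thesis using \<delta>(1) by blast
qed

text \<open>Around the finite fibre over \<open>y\<close> choose disjoint balls. A connected
  \<open>W\<close> with image near \<open>y\<close> lies in their union, hence in a single one. A
  Lebesgue number removes the dependence on \<open>y\<close>.\<close>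

lemma small_component_step:
  assumes "0 < e"
  shows "\<exists>\<delta>>0. \<forall>W. connected W \<and> (\<forall>a\<in>W. \<forall>b\<in>W. dist (f a) (f b) < \<delta>) \<longrightarrow>
    (\<forall>a\<in>W. \<forall>b\<in>W. dist a b < e)"
proof -
  have loc: "\<exists>r>0. \<forall>W. connected W \<and> f ` W \<subseteq> ball y r \<longrightarrow> (\<forall>a\<in>W. \<forall>b\<in>W. dist a b < e)" for y
  proof -
    let ?F = "f -` {y}"
    have "\<forall>a. \<exists>d>0. \<forall>x\<in>?F. x \<noteq> a \<longrightarrow> d \<le> dist a x"
      using finite_set_avoid[OF finite_fibre[of y]] by blast
    then obtain d where d: "\<And>a. d a > 0" "\<And>a x. x \<in> ?F \<Longrightarrow> x \<noteq> a \<Longrightarrow> d a \<le> dist a x"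
      by metis
    \<comment> \<open>Half the separation makes the balls around the fibre disjoint;
      \<open>e / 2\<close> keeps two points of one ball at distance less than
      \<open>e\<close>.\<close>
    define \<eta> where "\<eta> = Min (insert (e / 2) ((\<lambda>a. d a / 2) ` ?F))"
    have \<eta>: "0 < \<eta>" "\<eta> \<le> e / 2" "\<And>a. a \<in> ?F \<Longrightarrow> \<eta> \<le> d a / 2"
    proof -
      have fin: "finite (insert (e / 2) ((\<lambda>a. d a / 2) ` ?F))" using finite_fibre[of y] by simp
      show "0 < \<eta>" unfolding \<eta>_def using fin d(1) assms by (subst Min_gr_iff) auto
      show "\<eta> \<le> e / 2" unfolding \<eta>_def using fin by (intro Min_le) auto
      show "\<eta> \<le> d a / 2" if "a \<in> ?F" for a unfolding \<eta>_def using fin that by (intro Min_le) auto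
    qed
    \<comment> \<open>The rest of the space is compact and its image misses \<open>y\<close>, hence
      also a ball around \<open>y\<close>.\<close>
    define K where "K = UNIV - (\<Union>a\<in>?F. ball a \<eta>)"
    have "closed (f ` K)" unfolding K_def by (intro closed_image closed_Diff) auto
    moreover have "y \<notin> f ` K" using \<eta>(1) by (auto simp: K_def)
    ultimately obtain r where r: "0 < r" "ball y r \<subseteq> - f ` K"
      by (metis ComplI open_Compl openE)
    have "dist a b < e" if W: "connected W" "f ` W \<subseteq> ball y r" and ab: "a \<in> W" "b \<in> W" for W a b
    proof -
      have WU: "W \<subseteq> (\<Union>a\<in>?F. ball a \<eta>)"
      proof
        fix w assume "w \<in> W"
        then have "f w \<notin> f ` K" using r W by blast
        then show "w \<in> (\<Union>a\<in>?F. ball a \<eta>)" by (auto simp: K_def)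
      qed
      then obtain p where p: "p \<in> ?F" "a \<in> ball p \<eta>" using ab by blast
      define B where "B = (\<Union>q\<in>?F - {p}. ball q \<eta>)"
      have "ball p \<eta> \<inter> B = {}"
      proof (rule ccontr)
        assume "ball p \<eta> \<inter> B \<noteq> {}"
        then obtain x where x: "x \<in> ball p \<eta>" "x \<in> B" by blast
        then obtain q where q: "q \<in> ?F" "q \<noteq> p" "dist p x < \<eta>" "dist q x < \<eta>"
          unfolding B_def by (metis DiffE UN_E insertI1 mem_ball)
        then have "dist p q < d p"
          using dist_triangle[of p q x] \<eta>(3)[OF p(1)] by (simp add: dist_commute)
        then show False using d(2)[of q p] q by auto
      qed
      moreover have "W \<subseteq> ball p \<eta> \<union> B" using WU by (auto simp: B_def)
      moreover have "open B" by (auto simp: B_def)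
      ultimately have "W \<inter> B = {}"
        using connectedD[OF W(1), of "ball p \<eta>" B] p ab by auto
      then have "b \<in> ball p \<eta>" using \<open>W \<subseteq> ball p \<eta> \<union> B\<close> ab by blast
      then show "dist a b < e"
        using p \<eta>(2) dist_triangle[of a b p] by (simp add: dist_commute)
    qed
    then show ?thesis using r(1) by blast
  qed
  then obtain r where r: "\<And>y. 0 < r y"
    "\<And>y W. connected W \<Longrightarrow> f ` W \<subseteq> ball y (r y) \<Longrightarrow> (\<forall>a\<in>W. \<forall>b\<in>W. dist a b < e)"
    by metis
  define \<G> where "\<G> = range (\<lambda>y. ball y (r y))"
  have "UNIV \<subseteq> \<Union>\<G>" "\<And>G. G \<in> \<G> \<Longrightarrow> open G" using r(1) by (auto simp: \<G>_def)
  then obtain \<delta> where \<delta>: "0 < \<delta>" "\<And>x. \<exists>G\<in>\<G>. ball x \<delta> \<subseteq> G"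
    using Heine_Borel_lemma[OF compact_UNIV] by (metis UNIV_I)
  have "dist a b < e" if W: "connected W" "\<forall>a\<in>W. \<forall>b\<in>W. dist (f a) (f b) < \<delta>" "a \<in> W" "b \<in> W" for W a b
  proof -
    obtain y where "ball (f a) \<delta> \<subseteq> ball y (r y)" using \<delta>(2) by (auto simp: \<G>_def)
    then have "f ` W \<subseteq> ball y (r y)" using W by fastforce
    then show ?thesis using r(2) W by blast
  qed
  then show ?thesis using \<delta>(1) by blast
qed

lemma small_component_funpow:
  assumes "0 < e"
  shows "\<exists>\<delta>>0. \<forall>n\<le>m. \<forall>W. connected W \<and> (\<forall>a\<in>W. \<forall>b\<in>W. dist ((f ^^ n) a) ((f ^^ n) b) < \<delta>) \<longrightarrow>
    (\<forall>a\<in>W. \<forall>b\<in>W. dist a b < e)"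
  using assms
proof (induction m arbitrary: e)
  case (Suc m)
  obtain \<delta>1 where \<delta>1: "0 < \<delta>1" "\<forall>W. connected W \<and> (\<forall>a\<in>W. \<forall>b\<in>W. dist (f a) (f b) < \<delta>1) \<longrightarrow>
    (\<forall>a\<in>W. \<forall>b\<in>W. dist a b < e)" using small_component_step[OF Suc.prems] by (elim exE conjE)
  obtain \<delta>2 where \<delta>2: "0 < \<delta>2" "\<forall>n\<le>m. \<forall>W. connected W \<and>
     (\<forall>a\<in>W. \<forall>b\<in>W. dist ((f ^^ n) a) ((f ^^ n) b) < \<delta>2) \<longrightarrow> (\<forall>a\<in>W. \<forall>b\<in>W. dist a b < \<delta>1)"
    using Suc.IH[OF \<delta>1(1)] by (elim exE conjE)
  \<comment> \<open>The minimum with \<open>e\<close> takes care of \<open>n = 0\<close>, where the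
    iterate is the identity.\<close>
  have "\<forall>a\<in>W. \<forall>b\<in>W. dist a b < e" if "n \<le> Suc m" and W: "connected W"
    "\<forall>a\<in>W. \<forall>b\<in>W. dist ((f ^^ n) a) ((f ^^ n) b) < min e \<delta>2" for n W
  proof (cases n)
    case (Suc k)
    have "connected (f ` W)" using W(1) cont connected_continuous_image continuous_on_subset by blast
    moreover have "\<forall>a\<in>f ` W. \<forall>b\<in>f ` W. dist ((f ^^ k) a) ((f ^^ k) b) < \<delta>2"
      using W(2) by (auto simp: Suc funpow_swap1)
    ultimately have "\<forall>a\<in>f ` W. \<forall>b\<in>f ` W. dist a b < \<delta>1"
      using \<delta>2(2)[rule_format, of k "f ` W"] that(1) Suc by (metis Suc_le_mono)
    then show ?thesis using \<delta>1(2)[rule_format, of W] W(1) by blast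
  qed (use that in auto)
  then show ?case using Suc.prems \<delta>2(1) by (intro exI[of _ "min e \<delta>2"]) auto
qed auto

text \<open>The complement of the small ball is connected and misses the frontier of
  \<open>G\<close>, so it lies in \<open>G\<close> as soon as it meets \<open>G\<close>. But it
  contains a point at distance at least \<open>R\<close> from \<open>y\<close>, which the a priori
  bound \<open>G \<subseteq> ball y R\<close> excludes. This replaces the maximum modulus
  principle.\<close>

lemma maximum_principle:
  fixes G :: "'a set"
  assumes "open G" "frontier G \<subseteq> cball y r" "r < R" "G \<subseteq> ball y R"
  shows "G \<subseteq> cball y r"
proof (rule ccontr)
  assume "\<not> G \<subseteq> cball y r"
  then have "- cball y r \<inter> G \<noteq> {}" by blast
  moreover have "- cball y r \<inter> frontier G = {}" using assms(2) by blast
  ultimately have "- cball y r \<subseteq> G"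
    using connected_Int_frontier[OF connected_cap[OF assms(3), of y], of G] by blast
  moreover obtain z where z: "R \<le> dist y z" using far_point by blast
  moreover have "z \<in> - cball y r" using z assms(3) by simp
  ultimately have "z \<in> ball y R" using assms(4) by blast
  then show False using z by simp
qed

text \<open>The image of the closure is closed, so it covers the closure of the image; the image of
  \<open>G\<close> is open, so only the image of the frontier is left.\<close>

lemma frontier_image:
  assumes "open G"
  shows "frontier (f ` G) \<subseteq> f ` frontier G"
proof -
  have "closed (f ` closure G)" by (rule closed_image) simp
  then have "closure (f ` G) \<subseteq> f ` closure G"
    by (simp add: closure_minimal closure_subset image_mono)
  moreover have "f ` closure G = f ` G \<union> f ` frontier G"
    by (simp add: closure_Un_frontier image_Un)
  moreover have "frontier (f ` G) = closure (f ` G) - f ` G"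
    using interior_open[OF open_map[OF assms]] by (simp add: frontier_def)
  ultimately show ?thesis by auto
qed

section \<open>Consequences of exponential shrinking\<close>

lemma bounded_any: "bounded (W :: 'a set)"
  using compact_imp_bounded[OF compact_UNIV] bounded_subset by blast

text \<open>A connected set mapped into the ball lies in one component. In this form the condition
  applies to pullbacks of smaller sets, which need not be full components.\<close>

lemma TCE_connected:
  assumes "TCE f"
  shows "\<exists>\<Lambda>>1. \<exists>r>0. \<forall>y\<in>J. \<forall>n\<ge>1. \<forall>W. connected W \<and> (f ^^ n) ` W \<subseteq> ball y r \<longrightarrow>
    diameter W \<le> 1 / \<Lambda> ^ n"
proof -
  obtain \<Lambda> r where *: "1 < \<Lambda>" "0 < r" "\<forall>x\<in>J. \<forall>n\<ge>1. \<forall>W\<in>components ((f ^^ n) -` ball x r). diameter W \<le> 1 / \<Lambda> ^ n"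
    using assms unfolding TCE_def by (elim exE conjE)
  have "diameter W \<le> 1 / \<Lambda> ^ n"
    if y: "y \<in> J" "1 \<le> n" and W: "connected W" "(f ^^ n) ` W \<subseteq> ball y r" for y n W
  proof (cases "W = {}")
    case False
    then obtain a where a: "a \<in> W" by blast
    let ?V = "(f ^^ n) -` ball y r"
    have sub: "W \<subseteq> connected_component_set ?V a"
      using a W by (intro connected_component_maximal) auto
    have "connected_component_set ?V a \<in> components ?V"
      unfolding components_iff using a W(2) by (intro exI[of _ a]) auto
    then have "diameter (connected_component_set ?V a) \<le> 1 / \<Lambda> ^ n"
      using *(3) y by blast
    then show ?thesis
      using diameter_subset[OF sub bounded_any] by linarith
  qed (use *(1) in auto)
  then show ?thesis using *(1,2) by blast
qed

text \<open>Exponential shrinking gives this beyond some level \<open>n0\<close>, and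
  \<open>small_component_funpow\<close> settles the finitely many other levels; so one radius serves
  all \<open>n\<close>.\<close>

lemma small_pullbacks:
  assumes "TCE f" "0 < e"
  shows "\<exists>\<rho>>0. \<forall>y\<in>J. \<forall>n. \<forall>W. connected W \<and> (f ^^ n) ` W \<subseteq> ball y \<rho> \<longrightarrow>
    (\<forall>a\<in>W. \<forall>b\<in>W. dist a b \<le> e)"
proof -
  obtain \<Lambda> r where \<Lambda>: "1 < \<Lambda>" "0 < r" "\<forall>y\<in>J. \<forall>n\<ge>1. \<forall>W. connected W \<and> (f ^^ n) ` W \<subseteq> ball y r \<longrightarrow>
    diameter W \<le> 1 / \<Lambda> ^ n"
    using TCE_connected[OF assms(1)] by (elim exE conjE)
  obtain n0 where n0: "1 / e < \<Lambda> ^ n0"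
    using real_arch_pow[OF \<Lambda>(1)] by blast
  obtain \<delta> where \<delta>: "0 < \<delta>" "\<forall>n\<le>n0. \<forall>W. connected W \<and> (\<forall>a\<in>W. \<forall>b\<in>W. dist ((f ^^ n) a) ((f ^^ n) b) < \<delta>) \<longrightarrow>
    (\<forall>a\<in>W. \<forall>b\<in>W. dist a b < e)"
    using small_component_funpow[OF assms(2), of n0] by (elim exE conjE)
  have "dist a b \<le> e" if y: "y \<in> J" and W: "connected W" "(f ^^ n) ` W \<subseteq> ball y (min r (\<delta> / 2))"
    and ab: "a \<in> W" "b \<in> W" for y n W a b
  proof (cases "n \<le> n0")
    case True
    have "\<forall>a\<in>W. \<forall>b\<in>W. dist ((f ^^ n) a) ((f ^^ n) b) < \<delta>"
    proof (intro ballI)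
      fix a b assume "a \<in> W" "b \<in> W"
      then have "(f ^^ n) a \<in> ball y (\<delta> / 2)" "(f ^^ n) b \<in> ball y (\<delta> / 2)" using W(2) by auto
      then show "dist ((f ^^ n) a) ((f ^^ n) b) < \<delta>"
        using dist_triangle_half_r[of y "(f ^^ n) a" \<delta> "(f ^^ n) b"] by simp
    qed
    then have "\<forall>a\<in>W. \<forall>b\<in>W. dist a b < e"
      using \<delta>(2)[rule_format, of n W] True W(1) by blast
    then show ?thesis using ab by (simp add: less_imp_le)
  next
    case False
    have "(f ^^ n) ` W \<subseteq> ball y r" using W(2) by auto
    then have "diameter W \<le> 1 / \<Lambda> ^ n"
      using \<Lambda>(3) y W(1) False by auto
    also have "\<dots> \<le> 1 / \<Lambda> ^ n0"
      using False \<Lambda>(1) by (intro divide_left_mono power_increasing mult_pos_pos) auto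
    also have "\<dots> \<le> e"
      using n0 assms(2) \<Lambda>(1) by (simp add: field_simps)
    finally show ?thesis
      using diameter_bounded_bound[OF bounded_any ab] by linarith
  qed
  then show ?thesis using \<Lambda>(2) \<delta>(1) by (intro exI[of _ "min r (\<delta> / 2)"]) auto
qed

section \<open>Recurrence to \<open>C\<close> and shadowing\<close>

lemma lipschitz_funpow:
  "\<exists>K>0. \<exists>e>0. \<forall>z. dist z c < e \<longrightarrow> dist ((f ^^ n) z) ((f ^^ n) c) \<le> K * dist z c"
proof (induction n)
  case 0
  show ?case by (intro exI[of _ 1]) (auto intro: exI[of _ 1])
next
  case (Suc n)
  then obtain K e where K: "0 < K" "0 < e" "\<forall>z. dist z c < e \<longrightarrow> dist ((f ^^ n) z) ((f ^^ n) c) \<le> K * dist z c"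
    by (elim exE conjE)
  obtain L d where L: "0 < L" "0 < d" "\<forall>z. dist z ((f ^^ n) c) < d \<longrightarrow> dist (f z) (f ((f ^^ n) c)) \<le> L * dist z ((f ^^ n) c)"
    using lipschitz_at by metis
  have "dist ((f ^^ Suc n) z) ((f ^^ Suc n) c) \<le> (L * K) * dist z c" if z: "dist z c < min e (d / K)" for z
  proof -
    have le: "dist ((f ^^ n) z) ((f ^^ n) c) \<le> K * dist z c" using K z by simp
    also have "\<dots> < d" using z K(1) by (simp add: field_simps)
    finally have "dist ((f ^^ Suc n) z) ((f ^^ Suc n) c) \<le> L * dist ((f ^^ n) z) ((f ^^ n) c)"
      using L(3) by simp
    also have "\<dots> \<le> L * (K * dist z c)" using le L(1) by (intro mult_left_mono) auto
    finally show ?thesis by simp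
  qed
  then show ?case using K L by (intro exI[of _ "L * K"] conjI exI[of _ "min e (d / K)"]) auto
qed

text \<open>A periodic point of \<open>C\<close> would be attracting, so small balls around it could not be shrunk by
  taking preimages.\<close>

lemma critical_not_periodic:
  assumes "TCE f" and c: "c \<in> C" "c \<in> J" and n: "1 \<le> n"
  shows "(f ^^ n) c \<noteq> c"
proof
  assume per: "(f ^^ n) c = c"
  obtain m where m: "n = Suc m" using n by (cases n) auto
  obtain \<Lambda> r where \<Lambda>: "1 < \<Lambda>" "0 < r" "\<forall>y\<in>J. \<forall>n\<ge>1. \<forall>W. connected W \<and> (f ^^ n) ` W \<subseteq> ball y r \<longrightarrow>
    diameter W \<le> 1 / \<Lambda> ^ n"
    using TCE_connected[OF assms(1)] by (elim exE conjE)
  obtain K e where K: "0 < K" "0 < e"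
    "\<forall>z. dist z (f c) < e \<longrightarrow> dist ((f ^^ m) z) ((f ^^ m) (f c)) \<le> K * dist z (f c)"
    using lipschitz_funpow[of "f c" m] by (elim exE conjE)
  \<comment> \<open>The slope \<open>1 / K\<close> at \<open>c\<close> cancels the Lipschitz
    constant of the remaining \<open>m\<close> steps, so one period does not increase the distance
    to \<open>c\<close>.\<close>
  have "0 < 1 / K" using K(1) by simp
  from critical_at[OF c(1) this] obtain d where d: "0 < d"
    "\<forall>z. dist z c < d \<longrightarrow> dist (f z) (f c) \<le> (1 / K) * dist z c" by (elim exE conjE)
  define \<delta> where "\<delta> = min r (min d (e * K))"
  have \<delta>: "0 < \<delta>" using \<Lambda>(2) d(1) K by (simp add: \<delta>_def)
  have step: "(f ^^ n) z \<in> ball c \<delta>" if "z \<in> ball c \<delta>" for z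
  proof -
    have z: "dist z c < \<delta>" using that by (simp add: dist_commute)
    then have 1: "dist (f z) (f c) \<le> (1 / K) * dist z c" using d(2) by (simp add: \<delta>_def)
    also have "\<dots> < e" using z K(1) by (simp add: \<delta>_def field_simps)
    finally have "dist ((f ^^ m) (f z)) ((f ^^ m) (f c)) \<le> K * dist (f z) (f c)" using K(3) by blast
    also have "\<dots> \<le> K * ((1 / K) * dist z c)" using 1 K(1) by (intro mult_left_mono) auto
    also have "\<dots> = dist z c" using K(1) by simp
    finally have "dist ((f ^^ n) z) c \<le> dist z c"
      using per by (simp add: m funpow_swap1)
    then show ?thesis using z by (simp add: dist_commute)
  qed
  have iter: "(f ^^ (k * n)) ` ball c \<delta> \<subseteq> ball c \<delta>" for k
  proof (induction k)
    case (Suc k)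
    then show ?case using step by (auto simp: funpow_add image_subset_iff)
  qed auto
  \<comment> \<open>A connected open neighbourhood of \<open>c\<close> whose images under all
    multiples of the period stay near \<open>c\<close>. Its diameter is thus at most every
    \<open>1 / \<Lambda> ^ (k * n)\<close>, yet it contains a second point.\<close>
  define W where "W = connected_component_set (ball c \<delta>) c"
  have W: "connected W" "W \<subseteq> ball c \<delta>" "c \<in> W"
    using \<delta> connected_component_subset by (auto simp: W_def)
  have "open W" unfolding W_def by (intro open_connected_component_set open_ball)
  then obtain \<eta> where \<eta>: "0 < \<eta>" "ball c \<eta> \<subseteq> W" using W(3) openE by blast
  obtain y where y: "y \<noteq> c" "dist c y < \<eta>" using not_isolated[OF \<eta>(1)] by blast
  have le: "dist c y \<le> 1 / \<Lambda> ^ (k * n)" if "1 \<le> k" for k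
  proof -
    have "(f ^^ (k * n)) ` W \<subseteq> ball c \<delta>"
      using iter[of k] W(2) by (meson image_mono order_trans)
    also have "\<dots> \<subseteq> ball c r" by (simp add: \<delta>_def subset_ball)
    finally have "(f ^^ (k * n)) ` W \<subseteq> ball c r" .
    then have "diameter W \<le> 1 / \<Lambda> ^ (k * n)"
      using \<Lambda>(3)[rule_format, of c "k * n" W] c(2) W(1) that n by simp
    moreover have "dist c y \<le> diameter W"
      using diameter_bounded_bound[OF bounded_any] W(3) \<eta>(2) y(2) by (simp add: subset_iff)
    ultimately show ?thesis by linarith
  qed
  obtain k where k: "1 / dist c y < \<Lambda> ^ k" using real_arch_pow[OF \<Lambda>(1)] by blast
  have "\<Lambda> ^ k \<le> \<Lambda> ^ (Suc k * n)"
    using \<Lambda>(1) n by (intro power_increasing) (cases n; auto)+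
  with k have "1 / dist c y < \<Lambda> ^ (Suc k * n)" by linarith
  moreover have "0 < dist c y" "0 < \<Lambda> ^ (Suc k * n)" using y \<Lambda>(1) by auto
  ultimately have "1 / \<Lambda> ^ (Suc k * n) < dist c y"
    by (simp only: divide_less_eq less_divide_eq) (simp add: mult.commute)
  then show False using le[of "Suc k"] by simp
qed

text \<open>For \<open>0 < g < M\<close> the point \<open>(f ^^ g) c\<close> differs from
  \<open>c\<close>, and by continuity points near \<open>c\<close> are still a definite distance
  away from it after \<open>g\<close> steps. The second clause holds because \<open>J\<close> is
  closed, so the points of \<open>C\<close> outside \<open>J\<close> have positive distance from it:
  orbits in \<open>J\<close> come close only to points of \<open>C\<close> in
  \<open>J\<close>.\<close>

lemma critical_recurrence:
  assumes "TCE f"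
  shows "\<exists>e>0. (\<forall>c\<in>C \<inter> J. \<forall>z g. 0 < g \<and> g < M \<and> dist z c < e \<longrightarrow> e \<le> dist ((f ^^ g) z) c) \<and>
    (\<forall>y\<in>J. \<forall>c\<in>C. dist y c < e \<longrightarrow> c \<in> J)"
proof -
  define Q where "Q = (\<lambda>(c, g) e. \<forall>z. dist z c < e \<longrightarrow> e \<le> dist ((f ^^ g) z) c)"
  have "\<exists>e>0. \<forall>p\<in>(C \<inter> J) \<times> {1..<M}. \<forall>e'. 0 < e' \<and> e' \<le> e \<longrightarrow> Q p e'"
  proof (rule finite_uniform_radius)
    show "finite ((C \<inter> J) \<times> {1..<M})" using finite_C by simp
    fix p assume "p \<in> (C \<inter> J) \<times> {1..<M}"
    then obtain c g where p: "p = (c, g)" "c \<in> C" "c \<in> J" "1 \<le> g" by auto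
    define \<delta> where "\<delta> = dist ((f ^^ g) c) c / 2"
    have \<delta>: "0 < \<delta>" using critical_not_periodic[OF assms p(2-4)] by (simp add: \<delta>_def)
    have "continuous (at c) (f ^^ g)"
      using cont_funpow[of UNIV g] by (simp add: continuous_on_eq_continuous_within)
    then obtain d where d: "0 < d" "\<And>z. dist z c < d \<Longrightarrow> dist ((f ^^ g) z) ((f ^^ g) c) < \<delta>"
      using \<delta> unfolding continuous_at_eps_delta by (metis dist_commute)
    show "\<exists>e>0. \<forall>e'. 0 < e' \<and> e' \<le> e \<longrightarrow> Q p e'"
    proof (intro exI[of _ "min d \<delta>"] conjI allI impI)
      fix e' assume e': "0 < e' \<and> e' \<le> min d \<delta>"
      show "Q p e'"
        unfolding Q_def p
      proof (clarsimp)
        fix z assume "dist z c < e'"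
        then have "dist ((f ^^ g) z) ((f ^^ g) c) < \<delta>" using d(2) e' by auto
        then have "\<delta> \<le> dist ((f ^^ g) z) c"
          using dist_triangle[of "(f ^^ g) c" c "(f ^^ g) z"] by (simp add: \<delta>_def dist_commute)
        then show "e' \<le> dist ((f ^^ g) z) c" using e' by simp
      qed
    qed (use d \<delta> in auto)
  qed
  then obtain e1 where e1: "0 < e1" "\<forall>p\<in>(C \<inter> J) \<times> {1..<M}. \<forall>e'. 0 < e' \<and> e' \<le> e1 \<longrightarrow> Q p e'"
    by (elim exE conjE)
  have "\<exists>e>0. \<forall>c\<in>C - J. \<forall>e'. 0 < e' \<and> e' \<le> e \<longrightarrow> (\<forall>y\<in>J. \<not> dist y c < e')"
  proof (rule finite_uniform_radius)
    show "finite (C - J)" using finite_C by simp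
    fix c assume "c \<in> C - J"
    then obtain e where "0 < e" "ball c e \<subseteq> - J"
      using closed_julia_set[of f] by (metis ComplI DiffD2 open_Compl openE)
    then show "\<exists>e>0. \<forall>e'. 0 < e' \<and> e' \<le> e \<longrightarrow> (\<forall>y\<in>J. \<not> dist y c < e')"
      by (intro exI[of _ e]) (force simp: dist_commute subset_iff)
  qed
  then obtain e2 where e2: "0 < e2" "\<forall>c\<in>C - J. \<forall>e'. 0 < e' \<and> e' \<le> e2 \<longrightarrow> (\<forall>y\<in>J. \<not> dist y c < e')"
    by (elim exE conjE)
  show ?thesis
  proof (intro exI[of _ "min e1 e2"] conjI ballI allI impI)
    fix c z g assume c: "c \<in> C \<inter> J" and *: "0 < g \<and> g < M \<and> dist z c < min e1 e2"
    have "Q (c, g) (min e1 e2)" using e1 e2(1) c * by auto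
    then show "min e1 e2 \<le> dist ((f ^^ g) z) c" using * unfolding Q_def by blast
  next
    fix y c assume "y \<in> J" "c \<in> C" "dist y c < min e1 e2"
    moreover have "0 < min e1 e2" "min e1 e2 \<le> e2" using e1(1) e2(1) by auto
    ultimately show "c \<in> J" using e2(2)[rule_format, of c "min e1 e2" y] by blast
  qed (use e1(1) e2(1) in simp)
qed

text \<open>Within a block of \<open>M\<close> consecutive times the orbit comes
  \<open>e\<close>-close to a given \<open>c\<close> at most once, and the times below
  \<open>n\<close> meet at most \<open>Suc (n div M)\<close> blocks.\<close>

lemma card_near_critical_times:
  assumes M: "0 < M" and e: "\<forall>c\<in>C \<inter> J. \<forall>z g. 0 < g \<and> g < M \<and> dist z c < e \<longrightarrow> e \<le> dist ((f ^^ g) z) c"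
  shows "card {t. t < n \<and> (\<exists>c\<in>C \<inter> J. dist ((f ^^ t) x) c < e)} \<le> card (C \<inter> J) * Suc (n div M)"
proof -
  define T where "T c = {t. t < n \<and> dist ((f ^^ t) x) c < e}" for c
  have T: "card (T c) \<le> Suc (n div M)" if c: "c \<in> C \<inter> J" for c
  proof -
    have gap: "False" if "t \<in> T c" "u \<in> T c" "t < u" "t div M = u div M" for t u
    proof -
      have "t = t div M * M + t mod M" "u = t div M * M + u mod M"
        using that(4) by (metis div_mult_mod_eq)+
      then have "u - t < M" using mod_less_divisor[OF M, of u] by linarith
      moreover have "(f ^^ (u - t)) ((f ^^ t) x) = (f ^^ u) x"
        using that(3) by (metis comp_apply funpow_add le_add_diff_inverse2 less_imp_le)
      ultimately show False
        using e[rule_format, OF c, of "u - t" "(f ^^ t) x"] that by (auto simp: T_def)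
    qed
    have "inj_on (\<lambda>t. t div M) (T c)"
    proof (rule inj_onI)
      fix t u assume "t \<in> T c" "u \<in> T c" "t div M = u div M"
      then show "t = u" using gap[of t u] gap[of u t] by (cases t u rule: linorder_cases) auto
    qed
    moreover have "(\<lambda>t. t div M) ` T c \<subseteq> {..n div M}"
      by (auto simp: T_def intro: div_le_mono)
    ultimately have "card (T c) \<le> card {..n div M}" by (intro card_inj_on_le) auto
    then show ?thesis by simp
  qed
  have "{t. t < n \<and> (\<exists>c\<in>C \<inter> J. dist ((f ^^ t) x) c < e)} = (\<Union>c\<in>C \<inter> J. T c)"
    by (auto simp: T_def)
  also have "card \<dots> \<le> (\<Sum>c\<in>C \<inter> J. card (T c))"
    using finite_C by (intro card_UN_le) auto
  also have "\<dots> \<le> (\<Sum>c\<in>C \<inter> J. Suc (n div M))"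
    by (intro sum_mono T)
  finally show ?thesis by simp
qed

text \<open>If \<open>f ^^ n\<close> is not injective on the pullback of a small ball along the orbit of \<open>x\<close>, then at some
  time \<open>k\<close> the pullback contains a path joining two points with the same image. Its image encloses the
  value of a nearby \<open>c \<in> C\<close>, and by the maximum principle it keeps doing so under iteration. Hence \<open>c\<close>
  shadows \<open>x\<close> until time \<open>n\<close>.\<close>

lemma critical_shadowing:
  assumes "TCE f" "0 < e"
  shows "\<exists>\<rho>>0. \<forall>x\<in>J. \<forall>n. \<not> inj_on (f ^^ n)
      (connected_component_set ((f ^^ n) -` ball ((f ^^ n) x) \<rho>) x) \<longrightarrow>
    (\<exists>k<n. \<exists>c\<in>C. \<forall>t. k \<le> t \<and> t < n \<longrightarrow> dist ((f ^^ t) x) ((f ^^ (t - k)) c) < e)"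
proof -
  \<comment> \<open>\<open>R / 2\<close> leaves room for two distances, from the orbit to
    \<open>f c\<close> and from there to the points of \<open>G\<close>. Together they give the a
    priori bound that \<open>maximum_principle\<close> requires.\<close>
  obtain \<mu> where \<mu>: "0 < \<mu>" "\<forall>a b. dist a b < \<mu> \<longrightarrow> dist (f a) (f b) < R / 2"
    using uniform_cont[of "R / 2"] R_pos by auto
  define En where "En = (\<lambda>c \<delta>. \<forall>g. path g \<and> path_image g \<subseteq> ball c \<delta> \<and>
            pathstart g \<noteq> pathfinish g \<and> f (pathstart g) = f (pathfinish g) \<longrightarrow>
            (\<exists>G. open G \<and> G \<subseteq> ball (f c) (R / 2) \<and> frontier G \<subseteq> f ` path_image g \<and>
              f c \<in> G \<union> f ` path_image g))"
  have "\<exists>\<delta>>0. \<forall>c\<in>C. \<forall>\<delta>'. 0 < \<delta>' \<and> \<delta>' \<le> \<delta> \<longrightarrow> En c \<delta>'"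
  proof (rule finite_uniform_radius[OF finite_C])
    fix c assume "c \<in> C"
    have "\<exists>\<delta>>0. En c \<delta>" unfolding En_def by (rule enclose) (use R_pos in simp)
    then obtain \<delta> where \<delta>: "0 < \<delta>" "En c \<delta>" by blast
    have "En c \<delta>'" if "\<delta>' \<le> \<delta>" for \<delta>'
      unfolding En_def
    proof (intro allI impI)
      fix g assume "path g \<and> path_image g \<subseteq> ball c \<delta>' \<and>
            pathstart g \<noteq> pathfinish g \<and> f (pathstart g) = f (pathfinish g)"
      then show "\<exists>G. open G \<and> G \<subseteq> ball (f c) (R / 2) \<and> frontier G \<subseteq> f ` path_image g \<and>
              f c \<in> G \<union> f ` path_image g"
        using \<delta>(2)[unfolded En_def, rule_format, of g] subset_ball[OF that, of c] by (meson order_trans)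
    qed
    then show "\<exists>\<delta>>0. \<forall>\<delta>'. 0 < \<delta>' \<and> \<delta>' \<le> \<delta> \<longrightarrow> En c \<delta>'" using \<delta>(1) by blast
  qed
  then obtain \<delta> where \<delta>: "0 < \<delta>" "\<forall>c\<in>C. En c \<delta>" by (metis order_refl)
  \<comment> \<open>The pullback at time \<open>k\<close> will lie within \<open>2 * e'\<close> of
    \<open>c\<close>, which the division by 2 makes at most \<open>e\<close>,
    \<open>\<delta>\<close> and \<open>\<mu>\<close>.\<close>
  define e' where "e' = min e (min \<delta> \<mu>) / 2"
  have e': "0 < e'" "e' \<le> e / 2" "e' \<le> \<delta> / 2" "e' \<le> \<mu> / 2"
    using assms(2) \<delta>(1) \<mu>(1) by (auto simp: e'_def)
  obtain \<nu> where \<nu>: "0 < \<nu>" "\<forall>a b. a \<noteq> b \<and> f a = f b \<and> dist a b < \<nu> \<longrightarrow> (\<exists>c\<in>C. dist a c < e')"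
    using near_critical[OF e'(1)] by (elim exE conjE)
  define \<eta> where "\<eta> = min (min \<nu> e') R / 2"
  have \<eta>: "0 < \<eta>" "\<eta> < \<nu>" "\<eta> < e'" "\<eta> < R"
    using \<nu>(1) e'(1) R_pos by (auto simp: \<eta>_def)
  obtain \<rho> where \<rho>: "0 < \<rho>" "\<forall>y\<in>J. \<forall>n. \<forall>W. connected W \<and> (f ^^ n) ` W \<subseteq> ball y \<rho> \<longrightarrow>
    (\<forall>a\<in>W. \<forall>b\<in>W. dist a b \<le> \<eta>)"
    using small_pullbacks[OF assms(1) \<eta>(1)] by (elim exE conjE)
  have "\<exists>k<n. \<exists>c\<in>C. \<forall>t. k \<le> t \<and> t < n \<longrightarrow> dist ((f ^^ t) x) ((f ^^ (t - k)) c) < e"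
    if x: "x \<in> J" and ninj: "\<not> inj_on (f ^^ n) (connected_component_set ((f ^^ n) -` ball ((f ^^ n) x) \<rho>) x)"
    for x n
  proof -
    define y where "y = (f ^^ n) x"
    have yJ: "y \<in> J" using x by (simp add: y_def julia_set_funpow[OF cont])
    have iter: "(f ^^ (n - t)) ((f ^^ t) z) = (f ^^ n) z" if "t \<le> n" for t z
      using that by (metis comp_apply funpow_add le_add_diff_inverse2)
    \<comment> \<open>The pullback as seen at time \<open>t\<close>: injectivity fails on
      \<open>V 0\<close>, and \<open>f\<close> maps each \<open>V t\<close> with
      \<open>t < n\<close> into the next.\<close>
    define V where "V t = connected_component_set ((f ^^ (n - t)) -` ball y \<rho>) ((f ^^ t) x)" for t
    have V_conn: "connected (V t)" and V_open: "open (V t)" for t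
      unfolding V_def by (intro connected_connected_component open_connected_component_set open_vimage_funpow open_ball)+
    have V_sub: "(f ^^ (n - t)) ` V t \<subseteq> ball y \<rho>" for t
      unfolding V_def using connected_component_subset by fastforce
    have V_in: "(f ^^ t) x \<in> V t" if "t \<le> n" for t
      unfolding V_def using iter[OF that] \<rho>(1) by (simp add: y_def)
    have V_small: "dist a b \<le> \<eta>" if "a \<in> V t" "b \<in> V t" for a b t
      using \<rho>(2) yJ V_conn[of t] V_sub[of t] that by blast
    have V_step: "f ` V t \<subseteq> V (Suc t)" if "t < n" for t
    proof -
      have "n - t = Suc (n - Suc t)" using that by simp
      then have "(f ^^ (n - Suc t)) ` f ` V t \<subseteq> ball y \<rho>"
        using V_sub[of t] by (simp add: image_image funpow_swap1)
      moreover have "connected (f ` V t)"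
        using V_conn[of t] cont connected_continuous_image continuous_on_subset by blast
      moreover have "(f ^^ Suc t) x \<in> f ` V t" using V_in[of t] that by simp
      ultimately show ?thesis
        unfolding V_def[of "Suc t"] by (intro connected_component_maximal) auto
    qed
    have V_iter: "(f ^^ t) ` V 0 \<subseteq> V t" if "t \<le> n" for t
      using that
    proof (induction t)
      case (Suc t)
      then have "(f ^^ Suc t) ` V 0 \<subseteq> f ` V t" by (auto simp: image_subset_iff)
      then show ?case using V_step[of t] Suc.prems by auto
    qed auto
    have V_cball: "V t \<subseteq> cball ((f ^^ t) x) \<eta>" if "t \<le> n" for t
      using V_small V_in[OF that] by auto
    obtain a b where ab: "a \<in> V 0" "b \<in> V 0" "a \<noteq> b" "(f ^^ n) a = (f ^^ n) b"
      using ninj by (auto simp: inj_on_def V_def y_def)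
    \<comment> \<open>The first time at which the two orbits meet; one step earlier they are
      distinct points with the same image.\<close>
    define m where "m = (LEAST j. (f ^^ j) a = (f ^^ j) b)"
    have m: "(f ^^ m) a = (f ^^ m) b" unfolding m_def by (rule LeastI[of _ n]) (rule ab(4))
    have "m \<le> n" unfolding m_def by (rule Least_le) (rule ab(4))
    have "m \<noteq> 0"
    proof
      assume "m = 0" then show False using m ab(3) by simp
    qed
    then obtain k where k: "m = Suc k" using not0_implies_Suc by blast
    have "k < n" using k \<open>m \<le> n\<close> by simp
    define a' b' where "a' = (f ^^ k) a" and "b' = (f ^^ k) b"
    have "a' \<noteq> b'"
      using not_less_Least[of k "\<lambda>j. (f ^^ j) a = (f ^^ j) b"] k by (auto simp: m_def[symmetric] a'_def b'_def)
    have "f a' = f b'" using m by (simp add: k a'_def b'_def)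
    have in_V: "a' \<in> V k" "b' \<in> V k"
      using V_iter[of k] ab(1,2) \<open>k < n\<close> by (auto simp: a'_def b'_def)
    have "dist a' b' < \<nu>" using V_small[OF in_V] \<eta>(2) by simp
    then obtain c where c: "c \<in> C" "dist a' c < e'"
      using \<nu>(2) \<open>a' \<noteq> b'\<close> \<open>f a' = f b'\<close> by blast
    have near: "dist z c < 2 * e'" if "z \<in> V k" for z
      using V_small[OF that in_V(1)] dist_triangle[of z c a'] c(2) \<eta>(3) by simp
    have Vk: "V k \<subseteq> ball c \<delta>"
      using near e'(3) by (force simp: dist_commute)
    \<comment> \<open>The image of a path from \<open>a'\<close> to \<open>b'\<close> is a closed
      loop, to which \<open>enclose\<close> applies.\<close>
    have "path_connected (V k)" by (rule open_connected_imp_path_connected[OF V_open V_conn])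
    then obtain g where g: "path g" "path_image g \<subseteq> V k" "pathstart g = a'" "pathfinish g = b'"
      using in_V unfolding path_connected_def by blast
    have xk: "dist ((f ^^ k) x) c < 2 * e'" using near V_in \<open>k < n\<close> by simp
    have "dist ((f ^^ k) x) c < \<mu>" using xk e'(4) by simp
    then have fc: "dist ((f ^^ Suc k) x) (f c) < R / 2" using \<mu>(2) by simp
    have "path_image g \<subseteq> ball c \<delta>" using g(2) Vk by blast
    then obtain G where G: "open G" "G \<subseteq> ball (f c) (R / 2)" "frontier G \<subseteq> f ` path_image g"
      "f c \<in> G \<union> f ` path_image g"
      using \<delta>(2)[rule_format, OF c(1), unfolded En_def, rule_format, of g] g
        \<open>a' \<noteq> b'\<close> \<open>f a' = f b'\<close> by auto
    have img: "f ` path_image g \<subseteq> V (Suc k)"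
      using g(2) V_step[OF \<open>k < n\<close>] by blast
    \<comment> \<open>The pullbacks control only the frontier: it stays in \<open>V\<close>, hence
      within \<open>\<eta>\<close> of the orbit, and the maximum principle extends this to the whole
      image of \<open>G\<close>. The bound at step \<open>i\<close> in turn supplies the a priori
      bound by \<open>R\<close> at step \<open>i + 1\<close>.\<close>
    have G_iter: "open ((f ^^ i) ` G) \<and> frontier ((f ^^ i) ` G) \<subseteq> V (Suc k + i) \<and>
        (f ^^ i) ` G \<subseteq> cball ((f ^^ (Suc k + i)) x) \<eta>" if "Suc k + i \<le> n" for i
      using that
    proof (induction i)
      case 0
      have fr: "frontier G \<subseteq> V (Suc k)" using G(3) img by blast
      have "G \<subseteq> ball ((f ^^ Suc k) x) R"
      proof
        fix z assume "z \<in> G"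
        then have "dist (f c) z < R / 2" using G(2) by auto
        then show "z \<in> ball ((f ^^ Suc k) x) R"
          using fc dist_triangle[of "(f ^^ Suc k) x" z "f c"] by (simp del: funpow.simps)
      qed
      moreover have "frontier G \<subseteq> cball ((f ^^ Suc k) x) \<eta>"
        using fr V_cball[of "Suc k"] 0 by auto
      ultimately have "G \<subseteq> cball ((f ^^ Suc k) x) \<eta>"
        using maximum_principle[OF G(1) _ \<eta>(4)] by blast
      then show ?case using G(1) fr by simp
    next
      case (Suc i)
      let ?G = "(f ^^ i) ` G" and ?t = "Suc k + i"
      have IH: "open ?G" "frontier ?G \<subseteq> V ?t" "?G \<subseteq> cball ((f ^^ ?t) x) \<eta>"
        using Suc by auto
      have eq: "(f ^^ Suc i) ` G = f ` ?G" by (simp add: image_image)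
      have op: "open (f ` ?G)" by (rule open_map[OF IH(1)])
      have fr: "frontier (f ` ?G) \<subseteq> V (Suc ?t)"
        using frontier_image[OF IH(1)] IH(2) V_step[of ?t] Suc.prems by fastforce
      have "f ` ?G \<subseteq> ball ((f ^^ Suc ?t) x) R"
      proof
        fix w assume "w \<in> f ` ?G"
        then obtain z where z: "w = f z" "z \<in> ?G" by blast
        then have "dist ((f ^^ ?t) x) z < \<mu>" using IH(3) \<eta>(3) e'(1,4) by fastforce
        then show "w \<in> ball ((f ^^ Suc ?t) x) R" using \<mu>(2) R_pos z by fastforce
      qed
      moreover have "frontier (f ` ?G) \<subseteq> cball ((f ^^ Suc ?t) x) \<eta>"
        using fr V_cball[of "Suc ?t"] Suc.prems by auto
      ultimately have "f ` ?G \<subseteq> cball ((f ^^ Suc ?t) x) \<eta>"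
        using maximum_principle[OF op _ \<eta>(4)] by blast
      then show ?case using op fr unfolding eq by simp
    qed
    have V_fwd: "(f ^^ i) ` V (Suc k) \<subseteq> V (Suc k + i)" if "Suc k + i \<le> n" for i
      using that
    proof (induction i)
      case (Suc i)
      then have "(f ^^ Suc i) ` V (Suc k) \<subseteq> f ` V (Suc k + i)" by (auto simp: image_subset_iff)
      then show ?case using V_step[of "Suc k + i"] Suc.prems by auto
    qed auto
    have "dist ((f ^^ t) x) ((f ^^ (t - k)) c) < e" if t: "k \<le> t" "t < n" for t
    proof (cases "t = k")
      case True
      then show ?thesis using xk e'(2) by simp
    next
      case False
      define i where "i = t - Suc k"
      have i: "t = Suc k + i" using t False by (simp add: i_def)
      have eq: "(f ^^ (t - k)) c = (f ^^ i) (f c)" by (simp add: i funpow_swap1)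
      \<comment> \<open>Either \<open>f c\<close> lies in \<open>G\<close>, or it lies on the loop
        itself, which stays in the pullbacks.\<close>
      have "(f ^^ i) (f c) \<in> cball ((f ^^ t) x) \<eta>"
      proof (cases "f c \<in> G")
        case True
        have "Suc k + i \<le> n" using t(2) i by simp
        from G_iter[OF this] have "(f ^^ i) ` G \<subseteq> cball ((f ^^ t) x) \<eta>" unfolding i by blast
        then show ?thesis using True by blast
      next
        case False
        then have "f c \<in> V (Suc k)" using G(4) img by blast
        moreover have "Suc k + i \<le> n" using t(2) i by simp
        ultimately have "(f ^^ i) (f c) \<in> V (Suc k + i)" using V_fwd by blast
        then have "(f ^^ i) (f c) \<in> V t" unfolding i .
        then show ?thesis using V_cball[of t] t by auto
      qed
      then have "dist ((f ^^ t) x) ((f ^^ (t - k)) c) \<le> \<eta>" by (simp add: eq)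
      then show ?thesis using \<eta>(3) e'(2) assms(2) by linarith
    qed
    then show ?thesis using \<open>k < n\<close> c(1) by blast
  qed
  then show ?thesis using \<rho>(1) by blast
qed

section \<open>Counting pullbacks along points without late univalent pullbacks\<close>

definition noninjective_from :: "real \<Rightarrow> nat \<Rightarrow> 'a set" where
  "noninjective_from \<rho> N = {x \<in> J. \<forall>n>N. \<not> inj_on (f ^^ n)
      (connected_component_set ((f ^^ n) -` ball ((f ^^ n) x) \<rho>) x)}"

text \<open>A nonconical point fails the test for every radius, so a single radius may be fixed in
  advance, even one that depends on the exponent of the Hausdorff measure. Only \<open>N\<close>
  varies, over a countable set.\<close>

lemma nonconical_subset:
  assumes "0 < \<rho>"
  shows "J - conical_julia_set f \<subseteq> (\<Union>N. noninjective_from \<rho> N)"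
  using assms by (auto simp: conical_julia_set_def noninjective_from_def)

text \<open>A component of \<open>(f ^^ n) -` B\<close> is determined by a word of length \<open>n\<close>: at each time we record
  a shadowing point of \<open>C\<close> if a new one starts, and the branch of \<open>f\<inverse>\<close> if the orbit is close
  to \<open>C\<close> or the time is less than \<open>N\<close>. At the other times the branch is determined by the shadowing
  point. As points of \<open>C\<close> are not periodic, most letters are trivial.\<close>

lemma card_pullbacks:
  fixes \<theta> :: real
  assumes "TCE f" and \<theta>: "0 < \<theta>" "\<theta> \<le> 1" and M: "0 < M"
  shows "\<exists>\<rho>>0. \<exists>\<rho>'>0. \<forall>N n B. \<forall>y\<in>J. open B \<and> connected B \<and> B \<subseteq> ball y \<rho>' \<longrightarrow>
    finite ((\<lambda>x. connected_component_set ((f ^^ n) -` B) x) ` {x \<in> noninjective_from \<rho> N. (f ^^ n) x \<in> B}) \<and>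
    card ((\<lambda>x. connected_component_set ((f ^^ n) -` B) x) ` {x \<in> noninjective_from \<rho> N. (f ^^ n) x \<in> B})
      * \<theta> ^ (N + card (C \<inter> J) * Suc (n div M)) \<le> (1 + \<theta> * (Suc (card C) * Suc D)) ^ n"
proof -
  obtain e where e: "0 < e"
    "\<forall>c\<in>C \<inter> J. \<forall>z g. 0 < g \<and> g < M \<and> dist z c < e \<longrightarrow> e \<le> dist ((f ^^ g) z) c"
    "\<forall>y\<in>J. \<forall>c\<in>C. dist y c < e \<longrightarrow> c \<in> J"
    using critical_recurrence[OF assms(1), of M] by (elim exE conjE)
  obtain \<delta> where \<delta>: "0 < \<delta>" "\<forall>a b. a \<noteq> b \<and> f a = f b \<and> dist a b < \<delta> \<longrightarrow> (\<exists>c\<in>C. dist a c < e)"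
    using near_critical[OF e(1)] by (elim exE conjE)
  \<comment> \<open>Two orbits with a common shadowing point are less than
    \<open>2 * \<delta> / 3\<close> apart; adding the size \<open>\<delta> / 4\<close> of the
    pullbacks stays below \<open>\<delta>\<close>.\<close>
  define e0 where "e0 = min e (\<delta> / 3)"
  have e0: "0 < e0" "e0 \<le> e" "e0 \<le> \<delta> / 3" using e(1) \<delta>(1) by (auto simp: e0_def)
  obtain \<rho> where \<rho>: "0 < \<rho>" "\<forall>x\<in>J. \<forall>n. \<not> inj_on (f ^^ n)
      (connected_component_set ((f ^^ n) -` ball ((f ^^ n) x) \<rho>) x) \<longrightarrow>
    (\<exists>k<n. \<exists>c\<in>C. \<forall>t. k \<le> t \<and> t < n \<longrightarrow> dist ((f ^^ t) x) ((f ^^ (t - k)) c) < e0)"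
    using critical_shadowing[OF assms(1) e0(1)] by (elim exE conjE)
  have "0 < \<delta> / 4" using \<delta>(1) by simp
  from small_pullbacks[OF assms(1) this] obtain \<rho>' where
    \<rho>': "0 < \<rho>'" "\<forall>y\<in>J. \<forall>n. \<forall>W. connected W \<and> (f ^^ n) ` W \<subseteq> ball y \<rho>' \<longrightarrow>
    (\<forall>a\<in>W. \<forall>b\<in>W. dist a b \<le> \<delta> / 4)" by (elim exE conjE)
  obtain idx :: "'a set \<Rightarrow> 'a set \<Rightarrow> nat" where idx:
    "\<And>U. open U \<Longrightarrow> connected U \<Longrightarrow> inj_on (idx U) (components (f -` U))"
    "\<And>U W. open U \<Longrightarrow> connected U \<Longrightarrow> W \<in> components (f -` U) \<Longrightarrow> idx U W < D"
    using branch_index by blast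
  let ?K = "\<lambda>n B x. connected_component_set ((f ^^ n) -` B) x"
  have "finite (?K n B ` X) \<and>
    card (?K n B ` X) * \<theta> ^ (N + card (C \<inter> J) * Suc (n div M)) \<le> (1 + \<theta> * (Suc (card C) * Suc D)) ^ n"
    if y: "y \<in> J" and B: "open B" "connected B" "B \<subseteq> ball y \<rho>'"
      and X: "X = {x \<in> noninjective_from \<rho> N. (f ^^ n) x \<in> B}" for N n B y X
  proof -
    have XJ: "x \<in> J" "(f ^^ n) x \<in> B" if "x \<in> X" for x
      using that by (auto simp: X noninjective_from_def)
    define near where "near x t \<longleftrightarrow> (\<exists>c\<in>C \<inter> J. dist ((f ^^ t) x) c < e)" for x t
    have iter: "(f ^^ (n - t)) ((f ^^ t) z) = (f ^^ n) z" if "t \<le> n" for t z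
      using that by (metis comp_apply funpow_add le_add_diff_inverse2)
    define W where "W t x = ?K (n - t) B ((f ^^ t) x)" for t x
    have W_conn: "connected (W t x)" and W_open: "open (W t x)" for t x
      unfolding W_def by (intro connected_connected_component open_connected_component_set open_vimage_funpow B)+
    have W_sub: "(f ^^ (n - t)) ` W t x \<subseteq> B" for t x
      unfolding W_def using connected_component_subset by fastforce
    have W_in: "(f ^^ t) x \<in> W t x" if "t \<le> n" "x \<in> X" for t x
      unfolding W_def using iter[OF that(1)] XJ(2)[OF that(2)] by simp
    have W_small: "dist a b \<le> \<delta> / 4" if "a \<in> W t x" "b \<in> W t x" for a b t x
    proof -
      have "(f ^^ (n - t)) ` W t x \<subseteq> ball y \<rho>'" using W_sub B(3) by blast
      then show ?thesis using \<rho>'(2)[rule_format, of y "W t x" "n - t" a b] y W_conn that by blast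
    qed
    \<comment> \<open>The component of the iterated preimage is also obtained by pulling back one
      step at a time, so it is encoded by one branch for each step.\<close>
    have W_comp: "W t x \<in> components (f -` W (Suc t) x)" if t: "t < n" and x: "x \<in> X" for t x
    proof -
      have nt: "n - t = Suc (n - Suc t)" using t by simp
      have "(f ^^ (n - Suc t)) ` f ` W t x \<subseteq> B"
        using W_sub[of t x] by (simp add: nt image_image funpow_swap1)
      moreover have "connected (f ` W t x)"
        using W_conn[of t x] cont connected_continuous_image continuous_on_subset by blast
      moreover have "(f ^^ Suc t) x \<in> f ` W t x" using W_in[of t x] t x by simp
      ultimately have "f ` W t x \<subseteq> W (Suc t) x"
        unfolding W_def[of "Suc t"] by (intro connected_component_maximal) auto
      then have sub: "W t x \<subseteq> f -` W (Suc t) x" by blast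
      have "W t x = connected_component_set (f -` W (Suc t) x) ((f ^^ t) x)"
      proof
        show "W t x \<subseteq> connected_component_set (f -` W (Suc t) x) ((f ^^ t) x)"
          using sub W_conn W_in t x by (intro connected_component_maximal) auto
        have "f -` W (Suc t) x \<subseteq> (f ^^ (n - t)) -` B"
          using W_sub[of "Suc t" x] by (auto simp: nt funpow_Suc_right simp del: funpow.simps)
        then show "connected_component_set (f -` W (Suc t) x) ((f ^^ t) x) \<subseteq> W t x"
          unfolding W_def[of t] by (rule connected_component_mono)
      qed
      moreover have "(f ^^ t) x \<in> f -` W (Suc t) x" using sub W_in[of t x] t x by auto
      ultimately show ?thesis unfolding components_iff by blast
    qed
    have "\<exists>\<kappa>. (\<forall>j c. \<kappa> j = Some c \<longrightarrow> j < n \<and> c \<in> C \<and> dist ((f ^^ j) x) ((f ^^ (j - j)) c) < e0) \<and>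
      (\<forall>t. N \<le> t \<and> t < n \<longrightarrow>
        (\<exists>k\<le>t. \<exists>c. \<kappa> k = Some c \<and> (\<forall>j. k < j \<and> j \<le> t \<longrightarrow> \<kappa> j = None) \<and>
           dist ((f ^^ t) x) ((f ^^ (t - k)) c) < e0))" if "x \<in> X" for x
      by (rule last_entry_chain) (use \<rho>(2) that in \<open>auto simp: X noninjective_from_def\<close>)
    then have "\<forall>x\<in>X. \<exists>\<kappa>. (\<forall>j c. \<kappa> j = Some c \<longrightarrow> j < n \<and> c \<in> C \<and> dist ((f ^^ j) x) ((f ^^ (j - j)) c) < e0) \<and>
      (\<forall>t. N \<le> t \<and> t < n \<longrightarrow>
        (\<exists>k\<le>t. \<exists>c. \<kappa> k = Some c \<and> (\<forall>j. k < j \<and> j \<le> t \<longrightarrow> \<kappa> j = None) \<and>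
           dist ((f ^^ t) x) ((f ^^ (t - k)) c) < e0))" by blast
    from bchoice[OF this] obtain \<kappa> where \<kappa>: "\<forall>x\<in>X. (\<forall>j c. \<kappa> x j = Some c \<longrightarrow> j < n \<and> c \<in> C \<and> dist ((f ^^ j) x) ((f ^^ (j - j)) c) < e0) \<and>
      (\<forall>t. N \<le> t \<and> t < n \<longrightarrow>
        (\<exists>k\<le>t. \<exists>c. \<kappa> x k = Some c \<and> (\<forall>j. k < j \<and> j \<le> t \<longrightarrow> \<kappa> x j = None) \<and>
           dist ((f ^^ t) x) ((f ^^ (t - k)) c) < e0))" by blast
    \<comment> \<open>A shadowing point can start only while the orbit is near \<open>C\<close>,
      because at time \<open>j\<close> it is \<open>c\<close> itself that is close.\<close>
    have \<kappa>1: "c \<in> C" "near x j" if "x \<in> X" "\<kappa> x j = Some c" for x j c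
    proof -
      have *: "c \<in> C" "dist ((f ^^ j) x) c < e0" using \<kappa> that by fastforce+
      then have "dist ((f ^^ j) x) c < e" using e0(2) by simp
      moreover from this have "c \<in> J"
        using e(3) *(1) julia_set_funpow[OF cont XJ(1)[OF that(1)]] by blast
      ultimately show "c \<in> C" "near x j" using *(1) by (auto simp: near_def)
    qed
    have \<kappa>2: "\<exists>k\<le>t. \<exists>c. \<kappa> x k = Some c \<and> (\<forall>j. k < j \<and> j \<le> t \<longrightarrow> \<kappa> x j = None) \<and>
           dist ((f ^^ t) x) ((f ^^ (t - k)) c) < e0" if "x \<in> X" "N \<le> t" "t < n" for x t
      using \<kappa> that by blast
    \<comment> \<open>At all other times the branch will be recovered from the shadowing
      point.\<close>
    define \<beta> where "\<beta> x t = (if t < N \<or> near x t then Some (idx (W (Suc t) x) (W t x)) else None)" for x t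
    define code where "code x = (\<lambda>t\<in>{..<n}. (\<kappa> x t, \<beta> x t))" for x
    define A where "A = (insert None (Some ` C)) \<times> (insert None (Some ` {..<D})) - {(None, None)}"
    have A: "finite A" "(None, None) \<notin> A" "card A \<le> Suc (card C) * Suc D"
    proof -
      let ?A = "(insert None (Some ` C)) \<times> (insert None (Some ` {..<D}))"
      have fin: "finite ?A" using finite_C by simp
      then show "finite A" "(None, None) \<notin> A" by (auto simp: A_def)
      have "card A \<le> card ?A" unfolding A_def using fin by (intro card_mono) auto
      also have "\<dots> = card (insert None (Some ` C)) * card (insert None (Some ` {..<D}))"
        by (rule card_cartesian_product)
      also have "card (insert None (Some ` C)) = Suc (card C)"
        using finite_C by (simp add: card_image image_iff)
      also have "card (insert None (Some ` {..<D})) = Suc D"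
        by (simp add: card_image image_iff)
      finally show "card A \<le> Suc (card C) * Suc D" .
    qed
    let ?b = "N + card (C \<inter> J) * Suc (n div M)"
    let ?Q = "{g \<in> {..<n} \<rightarrow>\<^sub>E insert (None, None) A. card {t. t < n \<and> g t \<noteq> (None, None)} \<le> ?b}"
    have code_Q: "code ` X \<subseteq> ?Q"
    proof (intro image_subsetI CollectI conjI)
      fix x assume x: "x \<in> X"
      show "code x \<in> {..<n} \<rightarrow>\<^sub>E insert (None, None) A"
      proof (rule PiE_I)
        fix t assume "t \<in> {..<n}"
        then have t: "t < n" by simp
        have "\<kappa> x t \<in> insert None (Some ` C)" using \<kappa>1(1)[OF x] by (cases "\<kappa> x t") auto
        moreover have "\<beta> x t \<in> insert None (Some ` {..<D})"
          using idx(2)[OF W_open W_conn W_comp[OF t x]] by (auto simp: \<beta>_def)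
        ultimately show "code x t \<in> insert (None, None) A"
          using t unfolding code_def A_def by auto
      qed (simp add: code_def)
      have "{t. t < n \<and> code x t \<noteq> (None, None)} \<subseteq> {..<N} \<union> {t. t < n \<and> (\<exists>c\<in>C \<inter> J. dist ((f ^^ t) x) c < e)}"
      proof
        fix t assume "t \<in> {t. t < n \<and> code x t \<noteq> (None, None)}"
        then have t: "t < n" "\<kappa> x t \<noteq> None \<or> \<beta> x t \<noteq> None" by (auto simp: code_def)
        then have "near x t \<or> t < N" using \<kappa>1(2)[OF x] by (auto simp: \<beta>_def split: if_splits)
        then show "t \<in> {..<N} \<union> {t. t < n \<and> (\<exists>c\<in>C \<inter> J. dist ((f ^^ t) x) c < e)}"
          using t(1) by (auto simp: near_def)
      qed
      then have "card {t. t < n \<and> code x t \<noteq> (None, None)} \<le>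
          card ({..<N} \<union> {t. t < n \<and> (\<exists>c\<in>C \<inter> J. dist ((f ^^ t) x) c < e)})"
        by (intro card_mono) auto
      also have "\<dots> \<le> card {..<N} + card {t. t < n \<and> (\<exists>c\<in>C \<inter> J. dist ((f ^^ t) x) c < e)}"
        by (rule card_Un_le)
      also have "\<dots> \<le> ?b"
        using card_near_critical_times[OF M e(2), of n x] by simp
      finally show "card {t. t < n \<and> code x t \<noteq> (None, None)} \<le> ?b" .
    qed
    \<comment> \<open>Decoding runs backwards from time \<open>n\<close>, where the pullback is
      \<open>B\<close>, to time 0.\<close>
    have code_inj: "W 0 x = W 0 x'" if x: "x \<in> X" "x' \<in> X" and eq: "code x = code x'" for x x'
    proof -
      have eqs: "\<kappa> x t = \<kappa> x' t" "\<beta> x t = \<beta> x' t" if "t < n" for t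
        using fun_cong[OF eq, of t] that by (auto simp: code_def)
      have "W t x = W t x'" if "t \<le> n" for t
        using that
      proof (induction t rule: inc_induct)
        case base
        have "W n z = B" if "z \<in> X" for z
          using connected_component_eq_self[OF B(2) XJ(2)[OF that]] by (simp add: W_def)
        then show ?case using x by simp
      next
        case (step t)
        let ?U = "W (Suc t) x"
        have U: "?U = W (Suc t) x'" by (rule step.IH)
        have comps: "W t x \<in> components (f -` ?U)" "W t x' \<in> components (f -` ?U)"
          using W_comp[OF step.hyps(2) x(1)] W_comp[OF step.hyps(2) x(2)] U by simp_all
        show ?case
        proof (cases "\<beta> x t = None")
          case False
          then have "idx ?U (W t x) = idx ?U (W t x')"
            using eqs(2)[OF step.hyps(2)] U by (auto simp: \<beta>_def split: if_splits)
          then show ?thesis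
            using inj_onD[OF idx(1)[OF W_open W_conn]] comps by blast
        next
          case True
          then have t: "N \<le> t" "\<not> near x t" by (auto simp: \<beta>_def split: if_splits)
          obtain k c where k: "k \<le> t" "\<kappa> x k = Some c" "\<forall>j. k < j \<and> j \<le> t \<longrightarrow> \<kappa> x j = None"
            "dist ((f ^^ t) x) ((f ^^ (t - k)) c) < e0" using \<kappa>2[OF x(1) t(1) step.hyps(2)] by blast
          obtain k' c' where k': "k' \<le> t" "\<kappa> x' k' = Some c'" "\<forall>j. k' < j \<and> j \<le> t \<longrightarrow> \<kappa> x' j = None"
            "dist ((f ^^ t) x') ((f ^^ (t - k')) c') < e0" using \<kappa>2[OF x(2) t(1) step.hyps(2)] by blast
          have "\<kappa> x k' = Some c'" using k' eqs(1)[of k'] step.hyps(2) by simp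
          moreover have "\<kappa> x' k = Some c" using k eqs(1)[of k] step.hyps(2) by simp
          \<comment> \<open>\<open>\<kappa> x\<close> and \<open>\<kappa> x'\<close> agree below
            \<open>n\<close>, so their last entries up to \<open>t\<close> coincide.\<close>
          ultimately have "k = k'" using k(1,3) k'(1,3) by (metis linorder_neqE_nat option.distinct(1))
          then have "c = c'" using \<open>\<kappa> x k' = Some c'\<close> k(2) by simp
          have close: "dist ((f ^^ t) x) ((f ^^ t) x') < 2 * e0"
            using k(4) k'(4) \<open>k = k'\<close> \<open>c = c'\<close>
              dist_triangle2[of "(f ^^ t) x" "(f ^^ t) x'" "(f ^^ (t - k)) c"] by simp
          \<comment> \<open>As the branch of \<open>x'\<close> is onto, it contains a point
            \<open>b\<close> with the same image as \<open>(f ^^ t) x\<close>. The two points are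
            close and the orbit of \<open>x\<close> is away from \<open>C\<close> at time
            \<open>t\<close>, so they are equal and both components share a point.\<close>
          have "f ((f ^^ t) x) \<in> ?U" using W_in[of "Suc t" x] step.hyps(2) x(1) by simp
          also have "?U = f ` W t x'"
            using component_image[OF W_open W_conn comps(2)] by simp
          finally obtain b where b: "b \<in> W t x'" "f ((f ^^ t) x) = f b" by blast
          have "dist ((f ^^ t) x') b \<le> \<delta> / 4"
            using W_small[OF W_in b(1)] step.hyps(2) x(2) by simp
          then have "dist ((f ^^ t) x) b < \<delta>"
            using close e0(3) \<delta>(1) dist_triangle[of "(f ^^ t) x" b "(f ^^ t) x'"] by simp
          moreover have "\<not> (\<exists>c\<in>C. dist ((f ^^ t) x) c < e)"
            using t(2) e(3) julia_set_funpow[OF cont XJ(1)[OF x(1)], of t] unfolding near_def by blast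
          ultimately have "(f ^^ t) x = b" using \<delta>(2) b(2) by blast
          then have "(f ^^ t) x \<in> W t x \<inter> W t x'" using b(1) W_in[of t x] step.hyps(2) x(1) by simp
          then show ?thesis using components_nonoverlap[OF comps] by blast
        qed
      qed
      from this[of 0] show ?thesis by simp
    qed
    have finQ: "finite ?Q"
    proof (rule finite_subset)
      show "finite ({..<n} \<rightarrow>\<^sub>E insert (None, None) A)" using A(1) by (intro finite_PiE) auto
    qed blast
    have W0: "W 0 = ?K n B" by (simp add: W_def fun_eq_iff)
    have card: "finite (W 0 ` X)" "card (W 0 ` X) \<le> card ?Q"
      using card_image_le_if_factors[OF finQ code_Q, of "W 0"] code_inj by blast+
    have "card (W 0 ` X) * \<theta> ^ ?b \<le> card ?Q * \<theta> ^ ?b"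
      using card(2) \<theta> by (intro mult_right_mono) auto
    also have "\<dots> \<le> (1 + \<theta> * card A) ^ n"
      by (rule card_sparse_words[OF A(1,2) \<theta>])
    also have "\<dots> \<le> (1 + \<theta> * (Suc (card C) * Suc D)) ^ n"
      using A(3) \<theta>(1) by (intro power_mono add_left_mono mult_left_mono) (auto simp flip: of_nat_mult)
    finally show ?thesis using card(1) unfolding W0 by simp
  qed
  then show ?thesis using \<rho>(1) \<rho>'(1) by blast
qed

section \<open>The covers and their Hausdorff sums\<close>

lemma compact_julia: "compact J"
  using compact_UNIV compact_Int_closed[of UNIV J] closed_julia_set[of f] by simp

theorem hausdorff_dim_nonconical:
  assumes TCE: "TCE f"
  shows "hausdorff_dim (J - conical_julia_set f) = 0"
proof (rule hausdorff_dim_eq_0I)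
  fix s :: real assume s: "0 < s"
  obtain \<Lambda> r where \<Lambda>: "1 < \<Lambda>" "0 < r" "\<forall>y\<in>J. \<forall>n\<ge>1. \<forall>W. connected W \<and> (f ^^ n) ` W \<subseteq> ball y r \<longrightarrow>
    diameter W \<le> 1 / \<Lambda> ^ n"
    using TCE_connected[OF TCE] by (elim exE conjE)
  \<comment> \<open>A component at level \<open>n\<close> contributes at most
    \<open>1 / \<mu> ^ n\<close> to the sum.\<close>
  define \<mu> where "\<mu> = \<Lambda> powr s"
  have \<mu>: "1 < \<mu>" using \<Lambda>(1) s by (simp add: \<mu>_def)
  define a :: real where "a = Suc (card C) * Suc D"
  have a: "1 \<le> a"
  proof -
    have "1 \<le> Suc (card C) * Suc D" by simp
    then show ?thesis unfolding a_def by linarith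
  qed
  \<comment> \<open>Makes the growth rate \<open>1 + \<theta> * a\<close> of the total weight of
    words at most the mean of 1 and \<open>\<mu>\<close>.\<close>
  define \<theta> where "\<theta> = min 1 ((\<mu> - 1) / (2 * a))"
  have \<theta>: "0 < \<theta>" "\<theta> \<le> 1" using \<mu> a by (auto simp: \<theta>_def)
  have "\<theta> * a \<le> (\<mu> - 1) / (2 * a) * a"
    using a by (intro mult_right_mono) (auto simp: \<theta>_def)
  also have "\<dots> = (\<mu> - 1) / 2" using a by simp
  finally have lt: "1 + \<theta> * a < \<mu>" using \<mu> by simp
  define \<nu> where "\<nu> = (1 + \<theta> * a) / \<mu>"
  have \<nu>: "0 < \<nu>" "\<nu> < 1" using lt \<theta>(1) a \<mu> by (auto simp: \<nu>_def intro!: divide_pos_pos add_pos_pos)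
  define q where "q = card (C \<inter> J)"
  \<comment> \<open>Passing from weights to numbers costs a factor \<open>1 / \<theta> ^ q\<close>
    per block of \<open>M\<close> steps; \<open>M\<close> is so large that the decay
    \<open>\<nu> ^ M\<close> outweighs it.\<close>
  obtain M0 where M0: "\<nu> ^ M0 < \<theta> ^ q" using real_arch_pow_inv[of "\<theta> ^ q" \<nu>] \<nu> \<theta> by auto
  define M where "M = Suc M0"
  have "\<nu> ^ M \<le> \<nu> ^ M0" using \<nu> by (intro power_decreasing) (auto simp: M_def)
  then have \<nu>M: "\<nu> ^ M < \<theta> ^ q" using M0 by simp
  define \<tau> where "\<tau> = \<nu> ^ M / \<theta> ^ q"
  have \<tau>: "0 \<le> \<tau>" "\<tau> < 1" using \<nu>M \<nu> \<theta> by (auto simp: \<tau>_def)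
  obtain \<rho> \<rho>' where \<rho>: "0 < \<rho>" "0 < \<rho>'" and count: "\<forall>N n B. \<forall>y\<in>J. open B \<and> connected B \<and> B \<subseteq> ball y \<rho>' \<longrightarrow>
    finite ((\<lambda>x. connected_component_set ((f ^^ n) -` B) x) ` {x \<in> noninjective_from \<rho> N. (f ^^ n) x \<in> B}) \<and>
    card ((\<lambda>x. connected_component_set ((f ^^ n) -` B) x) ` {x \<in> noninjective_from \<rho> N. (f ^^ n) x \<in> B})
      * \<theta> ^ (N + card (C \<inter> J) * Suc (n div M)) \<le> (1 + \<theta> * (Suc (card C) * Suc D)) ^ n"
  proof -
    have "0 < M" by (simp add: M_def)
    from card_pullbacks[OF TCE \<theta> this] show thesis using that by (elim exE conjE)
  qed
  \<comment> \<open>The locale does not make balls connected, so the component of the centre is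
    taken.\<close>
  define B where "B y = connected_component_set (ball y (min \<rho>' r)) y" for y :: 'a
  have B: "open (B y)" "connected (B y)" "B y \<subseteq> ball y \<rho>'" "B y \<subseteq> ball y r" "y \<in> B y"
    for y :: 'a
    using open_connected_component_set[of "ball y (min \<rho>' r)" y]
      connected_component_subset[of "ball y (min \<rho>' r)" y] \<rho>(2) \<Lambda>(2) by (auto simp: B_def)
  have "J \<subseteq> (\<Union>y\<in>J. B y)" using B(5) by blast
  then obtain Y where Y: "Y \<subseteq> J" "finite Y" "J \<subseteq> (\<Union>y\<in>Y. B y)"
    using compactE_image[OF compact_julia, of J B] B(1) by metis
  show "hausdorff_measure s (J - conical_julia_set f) = 0"
  proof (rule hausdorff_measure_eq_0I[OF s nonconical_subset[OF \<rho>(1)]])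
    fix N :: nat and \<delta> e :: real assume \<delta>: "0 < \<delta>" and e: "0 < e"
    \<comment> \<open>The factor independent of \<open>j\<close>, since
      \<open>N + q * Suc j = (N + q) + q * j\<close>.\<close>
    define L where "L = card Y / \<theta> ^ (N + q)"
    have "(\<lambda>j. L * \<tau> ^ j) \<longlonglongrightarrow> L * 0" using \<tau> by (intro tendsto_mult tendsto_const LIMSEQ_realpow_zero)
    then have 1: "\<forall>\<^sub>F j in sequentially. L * \<tau> ^ j < e"
      using e by (simp add: order_tendstoD(2))
    have "(\<lambda>j. (1 / \<Lambda>) ^ j) \<longlonglongrightarrow> 0" using \<Lambda>(1) by (intro LIMSEQ_realpow_zero) auto
    then have 2: "\<forall>\<^sub>F j in sequentially. (1 / \<Lambda>) ^ j < \<delta>"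
      using \<delta> by (simp add: order_tendstoD(2))
    have "\<forall>\<^sub>F j in sequentially. L * \<tau> ^ j < e \<and> (1 / \<Lambda>) ^ j < \<delta> \<and> 1 \<le> j"
      using 1 2 eventually_ge_at_top[of 1] by (intro eventually_conj)
    then obtain j where j: "L * \<tau> ^ j < e" "(1 / \<Lambda>) ^ j < \<delta>" "1 \<le> j"
      using eventually_happens'[OF sequentially_bot] by blast
    define n where "n = M * j"
    have "n div M = j" unfolding n_def by (rule nonzero_mult_div_cancel_left) (simp add: M_def)
    then have n: "1 \<le> n" "j \<le> n" "n div M = j" using j(3) by (auto simp: n_def M_def)
    let ?K = "\<lambda>y. (\<lambda>x. connected_component_set ((f ^^ n) -` B y) x) ` {x \<in> noninjective_from \<rho> N. (f ^^ n) x \<in> B y}"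
    let ?F = "\<Union>y\<in>Y. ?K y"
    have K: "finite (?K y)" "card (?K y) * \<theta> ^ (N + q * Suc j) \<le> (1 + \<theta> * a) ^ n" if "y \<in> Y" for y
      using count[rule_format, of y "B y" n N] B that Y(1) n(3) unfolding a_def q_def by auto
    have diam: "diameter W \<le> 1 / \<Lambda> ^ n" if W: "W \<in> ?F" for W
    proof -
      obtain y x where y: "y \<in> Y" "W = connected_component_set ((f ^^ n) -` B y) x" using W by blast
      then have "(f ^^ n) ` W \<subseteq> ball y r" using connected_component_subset[of "(f ^^ n) -` B y" x] B(4)[of y] by auto
      then show ?thesis using \<Lambda>(3) y Y(1) n(1) connected_connected_component by blast
    qed
    have powr: "diameter W powr s \<le> 1 / \<mu> ^ n" if "W \<in> ?F" for W
    proof -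
      have "diameter W powr s \<le> (1 / \<Lambda> ^ n) powr s"
        using diam[OF that] diameter_ge_0[OF bounded_any, of W] s by (intro powr_mono2) auto
      also have "\<dots> = 1 / \<mu> ^ n"
        using \<Lambda>(1) by (simp add: \<mu>_def powr_divide powr_power powr_powr mult.commute flip: powr_realpow)
      finally show ?thesis .
    qed
    have cardK: "real (card (?K y)) \<le> (1 + \<theta> * a) ^ n / \<theta> ^ (N + q * Suc j)" if "y \<in> Y" for y
      using K(2)[OF that] \<theta>(1) by (simp add: pos_le_divide_eq)
    have finF: "finite ?F" using K(1) Y(2) by blast
    have "real (card ?F) \<le> real (\<Sum>y\<in>Y. card (?K y))"
      by (intro of_nat_mono card_UN_le Y(2))
    also have "\<dots> = (\<Sum>y\<in>Y. real (card (?K y)))" by simp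
    also have "\<dots> \<le> (\<Sum>y\<in>Y. (1 + \<theta> * a) ^ n / \<theta> ^ (N + q * Suc j))"
      by (intro sum_mono cardK)
    also have "\<dots> = card Y * ((1 + \<theta> * a) ^ n / \<theta> ^ (N + q * Suc j))" by simp
    finally have cardF: "real (card ?F) \<le> card Y * ((1 + \<theta> * a) ^ n / \<theta> ^ (N + q * Suc j))" .
    have "(\<Sum>W\<in>?F. diameter W powr s) \<le> (\<Sum>W\<in>?F. 1 / \<mu> ^ n)" by (intro sum_mono powr)
    also have "\<dots> = card ?F * (1 / \<mu> ^ n)" by simp
    also have "\<dots> \<le> card Y * ((1 + \<theta> * a) ^ n / \<theta> ^ (N + q * Suc j)) * (1 / \<mu> ^ n)"
      using cardF \<mu> by (intro mult_right_mono) auto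
    also have "\<dots> = L * \<tau> ^ j"
    proof -
      have "\<tau> ^ j = ((1 + \<theta> * a) ^ n / \<mu> ^ n) / \<theta> ^ (q * j)"
        by (simp add: \<tau>_def \<nu>_def n_def power_divide power_mult power_mult_distrib)
      then show ?thesis by (simp add: L_def power_add)
    qed
    also have "\<dots> \<le> e" using j(1) by simp
    finally have sum: "(\<Sum>W\<in>?F. diameter W powr s) \<le> e" .
    have "1 / \<Lambda> ^ n \<le> (1 / \<Lambda>) ^ j"
      using \<Lambda>(1) n(2) by (simp add: power_divide frac_le power_increasing)
    then have small: "diameter W \<le> \<delta>" if "W \<in> ?F" for W using diam[OF that] j(2) by simp
    have cover: "noninjective_from \<rho> N \<subseteq> \<Union>?F"
    proof
      fix x assume x: "x \<in> noninjective_from \<rho> N"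
      then have "(f ^^ n) x \<in> J" using julia_set_funpow[OF cont] by (auto simp: noninjective_from_def)
      then obtain y where y: "y \<in> Y" "(f ^^ n) x \<in> B y" using Y(3) by blast
      then have "x \<in> connected_component_set ((f ^^ n) -` B y) x" by simp
      then show "x \<in> \<Union>?F" using x y by blast
    qed
    show "\<exists>F. finite F \<and> noninjective_from \<rho> N \<subseteq> \<Union>F \<and> (\<forall>W\<in>F. bounded W \<and> diameter W \<le> \<delta>) \<and>
        (\<Sum>W\<in>F. diameter W powr s) \<le> e"
      using finF cover bounded_any small sum by (intro exI[of _ ?F]) blast
  qed
qed

end

section \<open>Geometry of the sphere\<close>

lemma arcsin_le_4: assumes "0 \<le> t" "t \<le> 1" shows "arcsin t \<le> 4 * t"
proof (cases "t < 1 / 2")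
  case True
  have "t\<^sup>2 \<le> (1 / 2)\<^sup>2" using assms True by (intro power_mono) auto
  then have "(1 / 2)\<^sup>2 \<le> 1 - t\<^sup>2" by (simp add: power2_eq_square)
  then have s: "1 / 2 \<le> sqrt (1 - t\<^sup>2)" by (rule real_le_rsqrt)
  have "arcsin t = arctan (t / sqrt (1 - t\<^sup>2))" using assms True by (intro arcsin_arctan) auto
  also have "\<dots> \<le> t / sqrt (1 - t\<^sup>2)"
    using assms(1) s by (intro arctan_le_self divide_nonneg_pos) linarith+
  also have "\<dots> \<le> t / (1 / 2)"
    using assms(1) s by (intro divide_left_mono mult_pos_pos) linarith+
  finally show ?thesis using assms(1) by simp
next
  case False
  \<comment> \<open>Here \<open>arcsin t \<le> pi / 2 < 2 \<le> 4 * t\<close>.\<close>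
  then show ?thesis using arcsin_ubound[of t] assms pi_less_4 by simp
qed

lemma arcsin_ge_self: assumes "0 \<le> t" "t \<le> 1" shows "t \<le> arcsin t"
  using sin_x_le_x[of "arcsin t"] arcsin_nonneg[of t] assms by simp

text \<open>Keeps the argument of \<open>arcsin\<close> in its domain. After squaring, it rests on
  the square of \<open>1 - cmod z * cmod w\<close> being nonnegative.\<close>

lemma chordal_le_1: "cmod (z - w) / sqrt ((1 + (cmod z)\<^sup>2) * (1 + (cmod w)\<^sup>2)) \<le> 1"
proof -
  have "2 * (cmod z * cmod w) \<le> 1 + (cmod z)\<^sup>2 * (cmod w)\<^sup>2"
    using zero_le_power2[of "1 - cmod z * cmod w"] by (simp add: power2_diff power_mult_distrib)
  moreover have "(cmod (z - w))\<^sup>2 \<le> (cmod z + cmod w)\<^sup>2"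
    by (intro power_mono norm_triangle_ineq4) auto
  ultimately have "(cmod (z - w))\<^sup>2 \<le> (1 + (cmod z)\<^sup>2) * (1 + (cmod w)\<^sup>2)"
    by (simp add: power2_sum algebra_simps)
  then have "cmod (z - w) \<le> sqrt ((1 + (cmod z)\<^sup>2) * (1 + (cmod w)\<^sup>2))" by (rule real_le_rsqrt)
  then show ?thesis by (simp add: divide_le_eq_1)
qed

lemma dist_Fin_le: "dist (Fin z) (Fin w) \<le> 8 * cmod (z - w)"
proof -
  let ?s = "sqrt ((1 + (cmod z)\<^sup>2) * (1 + (cmod w)\<^sup>2))"
  have "1 * 1 \<le> (1 + (cmod z)\<^sup>2) * (1 + (cmod w)\<^sup>2)" by (intro mult_mono) auto
  then have s: "1 \<le> ?s" by (intro real_le_rsqrt) simp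
  have "dist (Fin z) (Fin w) \<le> 2 * (4 * (cmod (z - w) / ?s))"
    unfolding dist_Fin_Fin by (intro mult_left_mono arcsin_le_4 chordal_le_1) auto
  also have "\<dots> \<le> 8 * (cmod (z - w) / 1)"
    using divide_left_mono[of 1 ?s "8 * cmod (z - w)"] s by (simp del: real_sqrt_mult)
  finally show ?thesis by simp
qed

text \<open>The factor belonging to \<open>w\<close> is kept linear in \<open>cmod w\<close>, so
  that \<open>Fin_lower\<close> can absorb it when \<open>w\<close> is close to
  \<open>z\<close>.\<close>

lemma dist_Fin_ge:
  "2 * cmod (z - w) \<le> dist (Fin z) (Fin w) * (sqrt (1 + (cmod z)\<^sup>2) * (1 + cmod w))"
proof -
  let ?s = "sqrt ((1 + (cmod z)\<^sup>2) * (1 + (cmod w)\<^sup>2))"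
  have pos: "0 < ?s" by (simp add: real_sqrt_mult)
  have "1 + (cmod w)\<^sup>2 \<le> (1 + cmod w)\<^sup>2" by (simp add: power2_sum)
  then have "sqrt (1 + (cmod w)\<^sup>2) \<le> 1 + cmod w" by (intro real_le_lsqrt) auto
  then have s: "?s \<le> sqrt (1 + (cmod z)\<^sup>2) * (1 + cmod w)"
    unfolding real_sqrt_mult by (intro mult_left_mono) auto
  have "2 * (cmod (z - w) / ?s) \<le> dist (Fin z) (Fin w)"
    unfolding dist_Fin_Fin by (intro mult_left_mono arcsin_ge_self chordal_le_1) (auto simp: real_sqrt_mult)
  then have "2 * cmod (z - w) \<le> dist (Fin z) (Fin w) * ?s"
    using pos by (simp add: field_simps del: real_sqrt_mult)
  also have "\<dots> \<le> dist (Fin z) (Fin w) * (sqrt (1 + (cmod z)\<^sup>2) * (1 + cmod w))"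
    using s by (intro mult_left_mono) auto
  finally show ?thesis .
qed

definition inversion :: "riemann_sphere \<Rightarrow> riemann_sphere" where
  "inversion x = (case x of Fin z \<Rightarrow> if z = 0 then Infty else Fin (1 / z) | Infty \<Rightarrow> Fin 0)"

lemma inversion_inversion [simp]: "inversion (inversion x) = x"
  by (cases x) (auto simp: inversion_def)

text \<open>On the unit sphere \<open>1 / z\<close> is the half turn about the real axis; hence it
  is an isometry, and infinity looks metrically like 0.\<close>

lemma stereo_inversion: "stereo (inversion x) = (cnj (fst (stereo x)), - snd (stereo x))"
proof (cases x)
  case (Fin z)
  show ?thesis
  proof (cases "z = 0")
    case False
    define a where "a = (cmod z)\<^sup>2"
    have a: "0 < a" using False by (simp add: a_def)
    have az: "of_real a = z * cnj z" unfolding a_def by (rule complex_norm_square)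
    have "(cmod (1 / z))\<^sup>2 = 1 / a" by (simp add: a_def norm_divide power_divide)
    then have "stereo (inversion x) = ((2 / (1 + 1 / a)) *\<^sub>R (1 / z), (1 / a - 1) / (1 + 1 / a))"
      using False by (simp add: Fin inversion_def)
    also have "(1 / a - 1) / (1 + 1 / a) = - ((a - 1) / (1 + a))"
    proof -
      have "1 / a - 1 = - (a - 1) / a" "1 + 1 / a = (1 + a) / a" using a by (simp_all add: field_simps)
      then have "(1 / a - 1) / (1 + 1 / a) = (1 - a) / (1 + a)" using a by simp
      also have "\<dots> = - ((a - 1) / (1 + a))" by (metis minus_diff_eq minus_divide_left)
      finally show ?thesis .
    qed
    also have "(2 / (1 + 1 / a)) *\<^sub>R (1 / z) = (2 / (1 + a)) *\<^sub>R (of_real a * (1 / z))"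
    proof -
      have "2 / (1 + 1 / a) = (2 / (1 + a)) * a" using a by (simp add: divide_simps)
      then show ?thesis by (simp only: scaleR_conv_of_real of_real_mult mult.assoc)
    qed
    also have "of_real a * (1 / z) = cnj z" unfolding az using False by simp
    finally show ?thesis by (simp add: Fin a_def)
  qed (simp add: Fin inversion_def)
qed (simp add: inversion_def)

lemma dist_inversion [simp]: "dist (inversion x) (inversion y) = dist x y"
  by (simp add: dist_riemann_sphere_def stereo_inversion inner_prod_def inner_complex_def)

section \<open>Transfer to the Euclidean unit sphere\<close>

lemma stereo_surj: assumes "norm v = 1" obtains x where "stereo x = v"
proof -
  obtain w t where v: "v = (w, t)" by (cases v)
  have wt: "(cmod w)\<^sup>2 + t\<^sup>2 = 1" using assms by (simp add: v norm_Pair real_sqrt_eq_1_iff)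
  show thesis
  proof (cases "t = 1")
    case True
    then show thesis using that[of Infty] wt v by simp
  next
    case False
    have "t\<^sup>2 \<le> 1" using wt zero_le_power2[of "cmod w"] by linarith
    then have "t < 1" using False by (simp add: abs_square_le_1 abs_le_iff)
    \<comment> \<open>The inverse of stereographic projection from the north pole.\<close>
    define z where "z = (1 / (1 - t)) *\<^sub>R w"
    have "(cmod z)\<^sup>2 = (1 - t\<^sup>2) / (1 - t)\<^sup>2"
      using wt \<open>t < 1\<close> by (simp add: z_def power_divide)
    also have "\<dots> = (1 + t) / (1 - t)"
      using \<open>t < 1\<close> by (simp add: divide_simps power2_eq_square) (simp add: algebra_simps)
    finally have z: "(cmod z)\<^sup>2 = (1 + t) / (1 - t)" .
    have "1 + (cmod z)\<^sup>2 = 2 / (1 - t)" "(cmod z)\<^sup>2 - 1 = 2 * t / (1 - t)"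
      unfolding z using \<open>t < 1\<close> by (simp_all add: field_simps)
    then have "stereo (Fin z) = v"
      using \<open>t < 1\<close> by (simp add: v z_def)
    then show thesis by (rule that)
  qed
qed

lemma abs_inner_stereo_le: "\<bar>stereo x \<bullet> stereo y\<bar> \<le> 1"
  using Cauchy_Schwarz_ineq2[of "stereo x" "stereo y"] by simp

lemma cos_dist: "cos (dist x y) = stereo x \<bullet> stereo y"
  unfolding dist_riemann_sphere_def using abs_inner_stereo_le by (rule cos_arccos_abs)

lemma antipode: "\<exists>y. dist x y = pi" for x :: riemann_sphere
proof -
  obtain y where "stereo y = - stereo x" using stereo_surj[of "- stereo x"] by auto
  moreover have "stereo x \<bullet> stereo x = 1" using norm_stereo[of x] unfolding norm_eq_1 .
  ultimately have "dist x y = pi" by (simp add: dist_riemann_sphere_def)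
  then show ?thesis by blast
qed

text \<open>The left side is the length \<open>2 * sin (d / 2)\<close> of the chord that belongs to
  the angle \<open>d\<close>.\<close>

lemma dist_stereo_le: "dist (stereo x) (stereo y) \<le> dist x y"
proof -
  let ?d = "dist x y"
  have "(dist (stereo x) (stereo y))\<^sup>2 = 2 - 2 * (stereo x \<bullet> stereo y)"
    using norm_stereo[of x] norm_stereo[of y]
    unfolding dist_norm power2_norm_eq_inner norm_eq_1 by (simp add: inner_diff inner_commute)
  also have "\<dots> = (2 * sin (?d / 2))\<^sup>2"
    using cos_double_sin[of "?d / 2"] unfolding cos_dist[symmetric] by (simp add: power_mult_distrib)
  also have "\<dots> \<le> ?d\<^sup>2"
  proof (intro power_mono)
    have "0 \<le> ?d / 2" "?d / 2 \<le> pi" using dist_le_pi[of x y] zero_le_dist[of x y] by linarith+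
    then show "2 * sin (?d / 2) \<le> ?d" "0 \<le> 2 * sin (?d / 2)"
      using sin_x_le_x[of "?d / 2"] sin_ge_zero[of "?d / 2"] by simp_all
  qed
  finally show ?thesis by (rule power2_le_imp_le) simp
qed

lemma homeomorphism_stereo: "homeomorphism UNIV (sphere 0 1) stereo (inv stereo)"
proof (rule homeomorphismI)
  have inj: "inj stereo" by (auto simp: inj_def)
  show "continuous_on UNIV stereo"
    unfolding continuous_on_iff using dist_stereo_le by (meson order_le_less_trans)
  have inv: "stereo (inv stereo v) = v" if "v \<in> sphere 0 1" for v
    using stereo_surj[of v] that by (metis f_inv_into_f rangeI mem_sphere_0)
  show "continuous_on (sphere 0 1) (inv stereo)"
    unfolding continuous_on_iff
  proof (intro ballI allI impI)
    fix v :: "complex \<times> real" and e :: real assume v: "v \<in> sphere 0 1" and e: "0 < e"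
    have bd: "\<bar>u \<bullet> v\<bar> \<le> 1" if "u \<in> sphere 0 1" for u
      using Cauchy_Schwarz_ineq2[of u v] that v by simp
    \<comment> \<open>The distance is \<open>arccos\<close> of the inner product, so continuity of
      the inverse at \<open>v\<close> reduces to that of a real function.\<close>
    have "continuous_on (sphere 0 1) (\<lambda>u. arccos (u \<bullet> v))"
      using bd by (intro continuous_intros) (auto simp: abs_le_iff)
    then obtain d where d: "0 < d" "\<And>u. u \<in> sphere 0 1 \<Longrightarrow> dist u v < d \<Longrightarrow>
        dist (arccos (u \<bullet> v)) (arccos (v \<bullet> v)) < e"
      using v e unfolding continuous_on_iff by metis
    have "v \<bullet> v = 1" using v by (simp add: norm_eq_1)
    then have "dist (inv stereo u) (inv stereo v) < e" if "u \<in> sphere 0 1" "dist u v < d" for u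
      using d(2)[OF that] inv[OF that(1)] inv[OF v] by (simp add: dist_riemann_sphere_def)
    then show "\<exists>d>0. \<forall>u\<in>sphere 0 1. dist u v < d \<longrightarrow> dist (inv stereo u) (inv stereo v) < e"
      using d(1) by blast
  qed
  show "stereo ` UNIV \<subseteq> sphere 0 1" by auto
  show "inv stereo (stereo x) = x" for x using inj by simp
  show "inv stereo ` sphere 0 1 \<subseteq> UNIV" by simp
  show "stereo (inv stereo v) = v" if "v \<in> sphere 0 1" for v using inv[OF that] .
qed

lemma compact_riemann_sphere: "compact (UNIV :: riemann_sphere set)"
  using homeomorphism_stereo homeomorphic_compactness[of "UNIV :: riemann_sphere set"]
    compact_sphere homeomorphic_def by blast

lemma locally_path_connected_riemann_sphere: "locally path_connected (UNIV :: riemann_sphere set)"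
proof -
  have "(UNIV :: riemann_sphere set) homeomorphic (sphere 0 1 :: (complex \<times> real) set)"
    using homeomorphism_stereo homeomorphic_def by blast
  then have "locally path_connected (UNIV :: riemann_sphere set) \<longleftrightarrow>
      locally path_connected (sphere 0 1 :: (complex \<times> real) set)"
    by (rule homeomorphic_locally) (rule homeomorphic_path_connectedness)
  then show ?thesis using locally_path_connected_sphere by blast
qed

text \<open>Every point \<open>v\<close> of the cap is joined to \<open>- u\<close> by the radial projection of a segment.\<close>

lemma connected_cap:
  fixes u :: "'a::real_inner"
  assumes u: "norm u = 1" and \<kappa>: "\<kappa> \<le> 1"
  shows "connected {v \<in> sphere 0 1. v \<bullet> u < \<kappa>}" (is "connected ?A")
proof -
  have "\<exists>T. connected T \<and> T \<subseteq> ?A \<and> v \<in> T \<and> - u \<in> T" if v: "v \<in> ?A" for v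
  proof -
    define p where "p = v \<bullet> u"
    have p: "p < \<kappa>" "p < 1" "-1 \<le> p"
      using v \<kappa> u Cauchy_Schwarz_ineq2[of v u] by (auto simp: p_def abs_le_iff)
    have n: "v \<bullet> v = 1" "u \<bullet> u = 1" using u v by (auto simp: norm_eq_1)
    define w where "w t = (1 - t) *\<^sub>R v - t *\<^sub>R u" for t
    have wu: "w t \<bullet> u = (1 - t) * p - t" and wv: "w t \<bullet> v = (1 - t) - t * p" for t
      by (simp_all add: w_def inner_diff n p_def inner_commute)
    \<comment> \<open>\<open>p < 1\<close> means that \<open>v\<close> is not \<open>u\<close>, so
      the segment to \<open>- u\<close> avoids the origin.\<close>
    have w0: "w t \<noteq> 0" if t: "t \<in> {0..1}" for t
    proof
      assume "w t = 0"
      then have "(1 - t) * p - t = 0" "(1 - t) - t * p = 0" using wu[of t] wv[of t] by auto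
      then have "(1 - p) * 1 = 0" by (simp add: algebra_simps)
      then show False using p by simp
    qed
    \<comment> \<open>After normalisation the inner product with \<open>u\<close> never exceeds
      \<open>p\<close>. For \<open>p \<ge> 0\<close> this uses a lower bound on the norm of
      \<open>w t\<close> by its product with \<open>v\<close>, for \<open>p < 0\<close> the upper
      bound 1.\<close>
    have le: "w t \<bullet> u \<le> p * norm (w t)" if t: "t \<in> {0..1}" for t
    proof (cases "0 \<le> p")
      case True
      have "(1 - t) - t * p \<le> norm (w t)"
        using norm_cauchy_schwarz[of "w t" v] v wv[of t] by simp
      then have "p * ((1 - t) - t * p) \<le> p * norm (w t)" using True by (rule mult_left_mono)
      moreover have "t * p * p \<le> t * 1"
        using t True p by (simp add: mult_le_one mult.assoc mult_left_le)
      ultimately show ?thesis unfolding wu by (simp add: algebra_simps)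
    next
      case False
      have "norm (w t) \<le> (1 - t) * norm v + t * norm u"
        unfolding w_def using t norm_triangle_ineq4[of "(1 - t) *\<^sub>R v" "t *\<^sub>R u"] by simp
      then have "norm (w t) \<le> 1" using u v by simp
      then have "p * 1 \<le> p * norm (w t)" using False by (intro mult_left_mono_neg) auto
      moreover have "t * (- p) \<le> t * 1" using t p by (intro mult_left_mono) auto
      ultimately show ?thesis unfolding wu by (simp add: algebra_simps)
    qed
    define T where "T = (\<lambda>t. (1 / norm (w t)) *\<^sub>R w t) ` {0..1}"
    have "continuous_on {0..1} (\<lambda>t. (1 / norm (w t)) *\<^sub>R w t)"
      using w0 unfolding w_def by (intro continuous_intros) auto
    then have "connected T" unfolding T_def by (intro connected_continuous_image) auto
    moreover have "T \<subseteq> ?A"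
    proof
      fix x assume "x \<in> T"
      then obtain t where t: "t \<in> {0..1}" "x = (1 / norm (w t)) *\<^sub>R w t" by (auto simp: T_def)
      have "x \<bullet> u = (w t \<bullet> u) / norm (w t)" by (simp add: t(2))
      also have "\<dots> \<le> p" using le[OF t(1)] w0[OF t(1)] by (simp add: divide_le_eq)
      finally show "x \<in> ?A" using p(1) w0[OF t(1)] by (simp add: t(2))
    qed
    moreover have "v \<in> T"
      unfolding T_def using v by (intro image_eqI[of _ _ 0]) (auto simp: w_def)
    moreover have "- u \<in> T"
      unfolding T_def using u by (intro image_eqI[of _ _ 1]) (auto simp: w_def)
    ultimately show ?thesis by blast
  qed
  then have "connected_component ?A v (- u)" if "v \<in> ?A" for v
    using that unfolding connected_component_def by blast
  then show ?thesis
    unfolding connected_iff_connected_component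
    by (meson connected_component_sym connected_component_trans)
qed

text \<open>Since \<open>cos\<close> decreases on \<open>[0, pi]\<close>, the complement of the ball
  is the cap where the inner product with the centre is below \<open>cos r\<close>; a negative
  \<open>r\<close> leaves the whole sphere.\<close>

lemma connected_Compl_cball:
  fixes y :: riemann_sphere
  assumes "r < 1"
  shows "connected (- cball y r)"
proof (cases "r < 0")
  case True
  have "connected (sphere 0 1 :: (complex \<times> real) set)"
    using connected_sphere[of "0 :: complex \<times> real" 1] by simp
  then have "connected (inv stereo ` sphere 0 1)"
  proof (rule connected_continuous_image[rotated])
    show "continuous_on (sphere 0 1) (inv stereo)"
      using homeomorphism_stereo by (simp add: homeomorphism_def)
  qed
  then show ?thesis
  proof -
    have "inv stereo ` sphere 0 1 = (UNIV :: riemann_sphere set)"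
      using homeomorphism_stereo by (simp add: homeomorphism_def)
    moreover have "- cball y r = UNIV" using True by simp
    ultimately show ?thesis using \<open>connected (inv stereo ` sphere 0 1)\<close> by metis
  qed
next
  case False
  let ?A = "{v \<in> sphere 0 1. v \<bullet> stereo y < cos r}"
  have "connected ?A" by (rule connected_cap) auto
  moreover have "- cball y r = inv stereo ` ?A"
  proof -
    have iff: "r < dist y x \<longleftrightarrow> stereo x \<bullet> stereo y < cos r" for x
    proof -
      have "r < dist y x \<longleftrightarrow> cos (dist y x) < cos r"
        using False assms pi_gt3 dist_le_pi[of y x] by (subst cos_mono_less_eq) auto
      then show ?thesis by (simp add: cos_dist inner_commute)
    qed
    have inv: "inv stereo (stereo x) = x" "v \<in> sphere 0 1 \<Longrightarrow> stereo (inv stereo v) = v" for x v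
      using homeomorphism_stereo by (auto simp: homeomorphism_def)
    show ?thesis
    proof (intro set_eqI iffI)
      fix x assume "x \<in> - cball y r"
      then have *: "stereo x \<in> ?A" using iff[of x] by simp
      have "inv stereo (stereo x) \<in> inv stereo ` ?A" using * by (rule imageI)
      then show "x \<in> inv stereo ` ?A" by (simp only: inv(1))
    next
      fix x assume "x \<in> inv stereo ` ?A"
      then obtain v where v: "v \<in> ?A" "x = inv stereo v" by blast
      have "stereo x = v" unfolding v(2) by (rule inv(2)) (use v(1) in simp)
      then have "stereo x \<bullet> stereo y < cos r" using v(1) by simp
      then have "r < dist y x" by (simp only: iff)
      then show "x \<in> - cball y r" by simp
    qed
  qed
  moreover have "continuous_on ?A (inv stereo)"
    using homeomorphism_stereo by (auto simp: homeomorphism_def intro: continuous_on_subset)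
  ultimately show ?thesis by (simp add: connected_continuous_image)
qed

section \<open>Charts and local representations\<close>

text \<open>One chart omits \<open>Infty\<close>, the other \<open>Fin 0\<close>. As
  \<open>inversion\<close> is an isometry, every metric estimate for \<open>Fin\<close> carries over
  to both.\<close>

definition chart :: "(complex \<Rightarrow> riemann_sphere) \<Rightarrow> bool" where
  "chart \<phi> \<longleftrightarrow> \<phi> = Fin \<or> \<phi> = inversion \<circ> Fin"

lemma chart_dist: "chart \<phi> \<Longrightarrow> dist (\<phi> z) (\<phi> w) = dist (Fin z) (Fin w)"
  by (auto simp: chart_def)

lemma chart_dist_le: "chart \<phi> \<Longrightarrow> dist (\<phi> z) (\<phi> w) \<le> 8 * cmod (z - w)"
  using dist_Fin_le by (simp add: chart_dist)

lemma inj_chart: assumes "chart \<phi>" shows "inj \<phi>"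
proof (rule injI)
  fix z w assume "\<phi> z = \<phi> w"
  then have "dist (Fin z) (Fin w) = 0" using chart_dist[OF assms, of z w] by simp
  then show "z = w" by simp
qed

text \<open>Within distance \<open>1 / A\<close> of \<open>Fin z\<close> infinity is excluded, and
  in \<open>dist_Fin_ge\<close> the part that involves \<open>w\<close> is at most
  \<open>cmod (z - w)\<close>, one of the two copies on the left.\<close>

lemma Fin_lower:
  "\<exists>K>0. \<exists>d>0. \<forall>x. dist x (Fin z) < d \<longrightarrow> (\<exists>w. x = Fin w \<and> cmod (w - z) \<le> K * dist x (Fin z))"
proof -
  define A where "A = sqrt (1 + (cmod z)\<^sup>2)"
  have A: "1 \<le> A" unfolding A_def by simp
  have "\<exists>w. x = Fin w \<and> cmod (w - z) \<le> A * (1 + cmod z) * dist x (Fin z)"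
    if x: "dist x (Fin z) < 1 / A" for x
  proof (cases x)
    case (Fin w)
    let ?d = "dist (Fin z) (Fin w)"
    have dA: "?d * A \<le> 1" using x A by (simp add: Fin dist_commute field_simps)
    have "2 * cmod (z - w) \<le> ?d * (A * (1 + cmod w))" unfolding A_def by (rule dist_Fin_ge)
    also have "\<dots> \<le> ?d * (A * (1 + cmod z + cmod (z - w)))"
      using A norm_triangle_ineq4[of z "z - w"] by (intro mult_left_mono) auto
    also have "\<dots> = ?d * A * (1 + cmod z) + ?d * A * cmod (z - w)" by (simp add: algebra_simps)
    also have "\<dots> \<le> ?d * A * (1 + cmod z) + 1 * cmod (z - w)"
      using dA by (intro add_left_mono mult_right_mono) auto
    finally have "cmod (z - w) \<le> A * (1 + cmod z) * ?d" by (simp add: mult_ac)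
    then show ?thesis by (simp add: Fin norm_minus_commute dist_commute)
  next
    case Infty
    have "2 * (1 / A) \<le> dist (Fin z) Infty"
      unfolding dist_Fin_Infty A_def by (intro mult_left_mono arcsin_ge_self) auto
    moreover have "0 < 1 / A" using A by simp
    ultimately have "1 / A < dist (Fin z) Infty" by linarith
    then show ?thesis using x by (simp add: Infty dist_commute)
  qed
  then show ?thesis using A
    by (intro exI[of _ "A * (1 + cmod z)"] conjI exI[of _ "1 / A"]) (auto intro!: mult_pos_pos add_pos_nonneg)
qed

lemma chart_lower:
  assumes "chart \<phi>"
  shows "\<exists>K>0. \<exists>d>0. \<forall>x. dist x (\<phi> z) < d \<longrightarrow> (\<exists>w. x = \<phi> w \<and> cmod (w - z) \<le> K * dist x (\<phi> z))"
proof -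
  obtain K d where K: "0 < K" "0 < d"
    "\<forall>x. dist x (Fin z) < d \<longrightarrow> (\<exists>w. x = Fin w \<and> cmod (w - z) \<le> K * dist x (Fin z))"
    using Fin_lower[of z] by (elim exE conjE)
  consider "\<phi> = Fin" | "\<phi> = inversion \<circ> Fin" using assms by (auto simp: chart_def)
  then have "\<forall>x. dist x (\<phi> z) < d \<longrightarrow> (\<exists>w. x = \<phi> w \<and> cmod (w - z) \<le> K * dist x (\<phi> z))"
  proof cases
    case 2
    show ?thesis
    proof (intro allI impI)
      fix x assume x: "dist x (\<phi> z) < d"
      have eq: "dist (inversion x) (Fin z) = dist x (\<phi> z)"
        using dist_inversion[of "inversion x" "Fin z"] by (simp add: 2)
      then obtain w where w: "inversion x = Fin w" "cmod (w - z) \<le> K * dist x (\<phi> z)"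
        using K(3) x by metis
      have "x = \<phi> w" using w(1) inversion_inversion[of x] by (simp add: 2)
      then show "\<exists>w. x = \<phi> w \<and> cmod (w - z) \<le> K * dist x (\<phi> z)" using w(2) by blast
    qed
  qed (use K in simp)
  then show ?thesis using K(1,2) by blast
qed

lemma chart_nhds:
  assumes "chart \<phi>" "0 < e"
  shows "\<exists>d>0. ball (\<phi> z) d \<subseteq> \<phi> ` ball z e"
proof -
  obtain K d where K: "0 < K" "0 < d"
    "\<forall>x. dist x (\<phi> z) < d \<longrightarrow> (\<exists>w. x = \<phi> w \<and> cmod (w - z) \<le> K * dist x (\<phi> z))"
    using chart_lower[OF assms(1), of z] by (elim exE conjE)
  have "x \<in> \<phi> ` ball z e" if "x \<in> ball (\<phi> z) (min d (e / K))" for x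
  proof -
    have x: "dist x (\<phi> z) < d" "dist x (\<phi> z) < e / K" using that by (auto simp: dist_commute)
    then obtain w where w: "x = \<phi> w" "cmod (w - z) \<le> K * dist x (\<phi> z)" using K(3) by blast
    have "K * dist x (\<phi> z) < e" using x(2) K(1) by (simp add: field_simps)
    then show ?thesis using w by (auto simp: dist_norm norm_minus_commute)
  qed
  then show ?thesis using K assms(2) by (intro exI[of _ "min d (e / K)"]) auto
qed

lemma open_chart: assumes "chart \<phi>" "open U" shows "open (\<phi> ` U)"
  unfolding open_contains_ball
proof
  fix x assume "x \<in> \<phi> ` U"
  then obtain z where z: "x = \<phi> z" "z \<in> U" by blast
  then obtain e where "0 < e" "ball z e \<subseteq> U" using assms(2) openE by blast
  then show "\<exists>e>0. ball x e \<subseteq> \<phi> ` U"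
    using chart_nhds[OF assms(1), of e z] z(1) by (meson image_mono order_trans)
qed

lemma continuous_on_chart: assumes "chart \<phi>" shows "continuous_on S \<phi>"
  unfolding continuous_on_iff
proof (intro ballI allI impI)
  fix z and e :: real assume "0 < e"
  have "dist (\<phi> w) (\<phi> z) < e" if "dist w z < e / 8" for w
    using chart_dist_le[OF assms, of w z] that by (simp add: dist_norm)
  then show "\<exists>d>0. \<forall>w\<in>S. dist w z < d \<longrightarrow> dist (\<phi> w) (\<phi> z) < e"
    using \<open>0 < e\<close> by (intro exI[of _ "e / 8"]) auto
qed

lemma continuous_on_inv_chart: assumes "chart \<phi>" shows "continuous_on (range \<phi>) (inv \<phi>)"
proof (rule continuous_on_inverse_open_map[OF continuous_on_chart[OF assms] refl])
  show "inv \<phi> (\<phi> z) = z" for z using inj_chart[OF assms] by simp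
  fix U :: "complex set" assume "openin (top_of_set UNIV) U"
  then have "open (\<phi> ` U)" using open_chart[OF assms] by simp
  then show "openin (top_of_set (range \<phi>)) (\<phi> ` U)" by (simp add: open_subset image_mono)
qed

text \<open>Near \<open>z0\<close>, \<open>F - F z0\<close> is a power \<open>h ^ n\<close> with
  \<open>h\<close> injective. If \<open>F z0\<close> were outside the loop, the winding number would
  vanish and \<open>F - F z0\<close> would have a continuous logarithm \<open>q\<close> along the
  path, with equal ends. Then \<open>h / exp (q / n)\<close> takes only roots of unity as values, so
  it is constant, and \<open>h\<close> agrees at both ends of the path, against injectivity.\<close>

lemma holomorphic_encloses:
  assumes F: "F holomorphic_on ball z0 r" and r: "0 < r" and nc: "\<not> F constant_on ball z0 r"
  shows "\<exists>\<delta>>0. \<delta> \<le> r \<and> (\<forall>g. path g \<and> path_image g \<subseteq> ball z0 \<delta> \<and> pathstart g \<noteq> pathfinish g \<and>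
     F (pathstart g) = F (pathfinish g) \<longrightarrow>
     F z0 \<in> path_image (F \<circ> g) \<union> inside (path_image (F \<circ> g)))"
proof -
  \<comment> \<open>If all derivatives vanished, \<open>F\<close> would be constant by the identity
    theorem.\<close>
  have "\<exists>n>0. (deriv ^^ n) F z0 \<noteq> 0"
  proof (rule ccontr)
    assume "\<not> ?thesis"
    then have 0: "\<And>n. 0 < n \<Longrightarrow> (deriv ^^ n) F z0 = 0" by blast
    have "F w = F z0" if "w \<in> ball z0 r" for w
      by (rule holomorphic_fun_eq_const_on_connected[OF F _ _ 0]) (use that r in auto)
    then show False using nc by (auto simp: constant_on_def)
  qed
  define n where "n = (LEAST n. 0 < n \<and> (deriv ^^ n) F z0 \<noteq> 0)"
  have n: "0 < n" "(deriv ^^ n) F z0 \<noteq> 0"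
    using LeastI_ex[of "\<lambda>n. 0 < n \<and> (deriv ^^ n) F z0 \<noteq> 0"] \<open>\<exists>n>0. _\<close> by (auto simp: n_def)
  have min: "(deriv ^^ i) F z0 = 0" if "0 < i" "i < n" for i
    using not_less_Least[of i "\<lambda>n. 0 < n \<and> (deriv ^^ n) F z0 \<noteq> 0"] that by (auto simp: n_def)
  obtain g s where s: "0 < s" "g holomorphic_on ball z0 s"
    "\<And>w. w \<in> ball z0 s \<Longrightarrow> F w - F z0 = ((w - z0) * g w) ^ n" "\<And>w. w \<in> ball z0 s \<Longrightarrow> g w \<noteq> 0"
    using holomorphic_factor_order_of_zero_strong[OF F open_ball _ n min, of thesis] r by simp
  define h where "h w = (w - z0) * g w" for w
  have h: "h holomorphic_on ball z0 s" unfolding h_def using s(2) by (intro holomorphic_intros)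
  have "(g has_field_derivative deriv g z0) (at z0)"
    using s(1,2) by (intro holomorphic_derivI[of _ "ball z0 s"]) auto
  then have "(h has_field_derivative g z0) (at z0)"
    unfolding h_def by (auto intro!: derivative_eq_intros)
  then have "deriv h z0 \<noteq> 0" using s(1,4) by (simp add: DERIV_imp_deriv)
  then obtain \<rho> where \<rho>: "0 < \<rho>" "inj_on h (ball z0 \<rho>)"
    using has_complex_derivative_locally_injective[OF h] s(1) by (metis centre_in_ball open_ball)
  define \<delta> where "\<delta> = min r (min s \<rho>)"
  have "F z0 \<in> path_image (F \<circ> p) \<union> inside (path_image (F \<circ> p))"
    if p: "path p" "path_image p \<subseteq> ball z0 \<delta>" "pathstart p \<noteq> pathfinish p" "F (pathstart p) = F (pathfinish p)" for p
  proof (rule ccontr)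
    assume "\<not> ?thesis"
    then have out: "F z0 \<notin> path_image (F \<circ> p)" "F z0 \<in> outside (path_image (F \<circ> p))"
      using inside_Un_outside[of "path_image (F \<circ> p)"] by blast+
    have pt: "p t \<in> ball z0 r" "p t \<in> ball z0 s" "p t \<in> ball z0 \<rho>" if "t \<in> {0..1}" for t
    proof -
      have "p t \<in> path_image p" using that by (simp add: path_image_def)
      then have "p t \<in> ball z0 \<delta>" using p(2) by blast
      then show "p t \<in> ball z0 r" "p t \<in> ball z0 s" "p t \<in> ball z0 \<rho>" by (simp_all add: \<delta>_def)
    qed
    have path: "path (F \<circ> p)"
      using p(1) by (rule path_continuous_image)
        (use pt(1) in \<open>auto simp: path_image_def intro!: continuous_on_subset[OF holomorphic_on_imp_continuous_on[OF F]]\<close>)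
    have "winding_number (F \<circ> p) (F z0) = 0"
      using p(4) by (intro winding_number_zero_in_outside path out) (simp add: pathstart_def pathfinish_def)
    then obtain q where q: "path q" "pathfinish q = pathstart q"
      "\<And>t. t \<in> {0..1} \<Longrightarrow> (F \<circ> p) t = F z0 + exp (q t)"
      using winding_number_as_continuous_log[OF path out(1)] by (metis eq_iff_diff_eq_0 mult_zero_right)
    define u where "u t = h (p t) / exp (q t / n)" for t
    have "continuous_on {0..1} (\<lambda>t. h (p t))"
      by (rule continuous_on_compose2[OF holomorphic_on_imp_continuous_on[OF h]])
        (use p(1) pt(2) in \<open>auto simp: path_def\<close>)
    then have "continuous_on {0..1} u"
      unfolding u_def using q(1) n(1) by (intro continuous_intros) (auto simp: path_def)
    moreover have "u t ^ n = 1" if t: "t \<in> {0..1}" for t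
    proof -
      have "h (p t) ^ n = exp (q t)" using s(3)[OF pt(2)[OF t]] q(3)[OF t] by (simp add: h_def)
      moreover have "exp (q t / n) ^ n = exp (q t)" using n(1) by (simp flip: exp_of_nat_mult)
      ultimately show ?thesis by (simp add: u_def power_divide)
    qed
    then have "finite (u ` {0..1})"
      by (intro finite_subset[OF _ finite_nth_roots[OF n(1), of 1]]) auto
    ultimately have "u constant_on {0..1}"
      by (intro continuous_finite_range_constant) auto
    then have "u 0 = u 1" by (metis atLeastAtMost_iff constant_on_def order_refl zero_le_one)
    then have "h (p 0) = h (p 1)" using q(2) by (simp add: u_def pathstart_def pathfinish_def)
    then have "p 0 = p 1" using inj_onD[OF \<rho>(2)] pt(3) by simp
    then show False using p(3) by (simp add: pathstart_def pathfinish_def)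
  qed
  then show ?thesis using r s(1) \<rho>(1) by (intro exI[of _ \<delta>]) (auto simp: \<delta>_def)
qed

text \<open>Reads \<open>f\<close> near \<open>a\<close> as a holomorphic \<open>F\<close>, so that
  later arguments need no cases for infinity in source or target.\<close>

definition local_rep :: "(riemann_sphere \<Rightarrow> riemann_sphere) \<Rightarrow> riemann_sphere \<Rightarrow> (complex \<Rightarrow> riemann_sphere) \<Rightarrow>
    (complex \<Rightarrow> riemann_sphere) \<Rightarrow> complex \<Rightarrow> real \<Rightarrow> (complex \<Rightarrow> complex) \<Rightarrow> bool" where
  "local_rep f a \<phi> \<psi> z0 r F \<longleftrightarrow> chart \<phi> \<and> chart \<psi> \<and> 0 < r \<and> \<phi> z0 = a \<and> F holomorphic_on ball z0 r \<and>
     (\<forall>z\<in>ball z0 r. f (\<phi> z) = \<psi> (F z))"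

lemma local_repD:
  assumes "local_rep f a \<phi> \<psi> z0 r F"
  shows "chart \<phi>" "chart \<psi>" "0 < r" "\<phi> z0 = a" "F holomorphic_on ball z0 r"
    "\<And>z. z \<in> ball z0 r \<Longrightarrow> f (\<phi> z) = \<psi> (F z)" "f a = \<psi> (F z0)"
  using assms by (auto simp: local_rep_def)

text \<open>\<open>K\<close> measures the distortion of the charts and does not depend on
  \<open>e\<close>. So \<open>e = 1\<close> yields a Lipschitz bound, and a vanishing derivative
  yields arbitrarily small slopes.\<close>

lemma local_rep_dist:
  assumes "local_rep f a \<phi> \<psi> z0 r F"
  shows "\<exists>K>0. \<forall>e>0. \<exists>\<delta>>0. \<forall>x. dist x a < \<delta> \<longrightarrow> dist (f x) (f a) \<le> K * (cmod (deriv F z0) + e) * dist x a"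
proof -
  note rep = local_repD[OF assms]
  obtain K d where K: "0 < K" "0 < d"
    "\<forall>x. dist x (\<phi> z0) < d \<longrightarrow> (\<exists>w. x = \<phi> w \<and> cmod (w - z0) \<le> K * dist x (\<phi> z0))"
    using chart_lower[OF rep(1), of z0] by (elim exE conjE)
  have der: "(F has_field_derivative deriv F z0) (at z0)"
    using rep(3,5) by (intro holomorphic_derivI[of _ "ball z0 r"]) auto
  have "\<exists>\<delta>>0. \<forall>x. dist x a < \<delta> \<longrightarrow> dist (f x) (f a) \<le> 8 * K * (cmod (deriv F z0) + e) * dist x a"
    if e: "0 < e" for e
  proof -
    obtain s where s: "0 < s" "\<And>w. cmod (w - z0) < s \<Longrightarrow>
        cmod (F w - F z0 - deriv F z0 * (w - z0)) \<le> e * cmod (w - z0)"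
      using der e unfolding has_field_derivative_def has_derivative_at_alt by blast
    have "dist (f x) (f a) \<le> 8 * K * (cmod (deriv F z0) + e) * dist x a"
      if x: "dist x a < min d (min r s / K)" for x
    proof -
      obtain w where w: "x = \<phi> w" "cmod (w - z0) \<le> K * dist x a"
        using K(3) x rep(4) by auto
      have "K * dist x a < min r s" using x K(1) by (simp add: field_simps)
      then have wr: "w \<in> ball z0 r" "cmod (w - z0) < s" using w(2) by (auto simp: dist_norm norm_minus_commute)
      have "cmod (F w - F z0) \<le> cmod (F w - F z0 - deriv F z0 * (w - z0)) + cmod (deriv F z0 * (w - z0))"
        using norm_triangle_ineq[of "F w - F z0 - deriv F z0 * (w - z0)" "deriv F z0 * (w - z0)"] by simp
      also have "\<dots> \<le> (cmod (deriv F z0) + e) * cmod (w - z0)"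
        using s(2)[OF wr(2)] by (simp only: norm_mult distrib_right)
      also have "\<dots> \<le> (cmod (deriv F z0) + e) * (K * dist x a)"
        using w(2) e by (intro mult_left_mono) auto
      finally have "8 * cmod (F w - F z0) \<le> 8 * ((cmod (deriv F z0) + e) * (K * dist x a))" by simp
      moreover have "dist (f x) (f a) \<le> 8 * cmod (F w - F z0)"
        using chart_dist_le[OF rep(2)] rep(6)[OF wr(1)] rep(7) w(1) by simp
      ultimately show ?thesis by (simp add: mult_ac)
    qed
    moreover have "0 < min d (min r s / K)" using K rep(3) s(1) by simp
    ultimately show ?thesis by blast
  qed
  then show ?thesis using K(1) by (intro exI[of _ "8 * K"]) auto
qed

lemma local_rep_inj:
  assumes "local_rep f a \<phi> \<psi> z0 r F" "deriv F z0 \<noteq> 0"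
  shows "\<exists>e>0. inj_on f (ball a e)"
proof -
  note rep = local_repD[OF assms(1)]
  obtain s where s: "0 < s" "ball z0 s \<subseteq> ball z0 r" "inj_on F (ball z0 s)"
    using has_complex_derivative_locally_injective[OF rep(5) _ _ assms(2)] rep(3)
    by (metis centre_in_ball open_ball)
  obtain e where e: "0 < e" "ball a e \<subseteq> \<phi> ` ball z0 s" using chart_nhds[OF rep(1) s(1)] rep(4) by blast
  have "inj_on f (\<phi> ` ball z0 s)"
  proof (rule inj_onI)
    fix x y assume "x \<in> \<phi> ` ball z0 s" "y \<in> \<phi> ` ball z0 s" and eq: "f x = f y"
    then obtain z w where zw: "x = \<phi> z" "y = \<phi> w" "z \<in> ball z0 s" "w \<in> ball z0 s" by blast
    then have "\<psi> (F z) = \<psi> (F w)" using eq rep(6) s(2) by (metis subsetD)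
    then have "F z = F w" using inj_chart[OF rep(2)] by (simp add: inj_eq)
    then show "x = y" using inj_onD[OF s(3)] zw by blast
  qed
  then show ?thesis using e inj_on_subset by blast
qed

text \<open>A constant \<open>F\<close> would put an open disc into a single fibre.\<close>

lemma local_rep_not_constant:
  assumes "local_rep f a \<phi> \<psi> z0 r F" "\<And>y. finite (f -` {y})"
  shows "\<not> F constant_on ball z0 r"
proof
  note rep = local_repD[OF assms(1)]
  assume "F constant_on ball z0 r"
  then obtain c where "\<And>z. z \<in> ball z0 r \<Longrightarrow> F z = c" by (auto simp: constant_on_def)
  then have "\<phi> ` ball z0 r \<subseteq> f -` {\<psi> c}" using rep(6) by auto
  then have "finite (\<phi> ` ball z0 r)" using assms(2) finite_subset by blast
  then have "finite (ball z0 r)" using finite_imageD inj_on_subset[OF inj_chart[OF rep(1)]] by blast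
  then show False using finite_imp_not_open[of "ball z0 r"] rep(3) by simp
qed

lemma local_rep_open:
  assumes "local_rep f a \<phi> \<psi> z0 r F" "\<And>y. finite (f -` {y})" "open U" "a \<in> U"
  shows "\<exists>V. open V \<and> f a \<in> V \<and> V \<subseteq> f ` U"
proof -
  note rep = local_repD[OF assms(1)]
  define S where "S = ball z0 r \<inter> \<phi> -` U"
  have "open (\<phi> -` U)" using continuous_on_chart[OF rep(1), of UNIV] assms(3) by (simp add: continuous_on_open_vimage)
  then have S: "open S" "z0 \<in> S" "S \<subseteq> ball z0 r" using assms(4) rep(3,4) by (auto simp: S_def)
  have "open (F ` S)"
    using open_mapping_thm[OF rep(5) _ _ S(1,3) local_rep_not_constant[OF assms(1,2)]] by simp
  then have "open (\<psi> ` F ` S)" by (rule open_chart[OF rep(2)])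
  moreover have "f a \<in> \<psi> ` F ` S" using S(2) rep(7) by blast
  moreover have "\<psi> ` F ` S \<subseteq> f ` U"
  proof
    fix y assume "y \<in> \<psi> ` F ` S"
    then obtain z where "z \<in> S" "y = \<psi> (F z)" by blast
    then have "y = f (\<phi> z)" "\<phi> z \<in> U" using rep(6) by (auto simp: S_def)
    then show "y \<in> f ` U" by blast
  qed
  ultimately show ?thesis by blast
qed

text \<open>\<open>G\<close> is the inside of the image loop, carried over by \<open>\<psi>\<close>.
  It is small because the complement of a disc containing the loop lies outside the loop; its
  frontier is on the loop because loop and inside together are compact.\<close>

lemma local_rep_encloses:
  assumes "local_rep f c \<phi> \<psi> z0 r F" "\<And>y. finite (f -` {y})" and e: "0 < e"
  shows "\<exists>\<delta>>0. \<forall>g. path g \<and> path_image g \<subseteq> ball c \<delta> \<and>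
            pathstart g \<noteq> pathfinish g \<and> f (pathstart g) = f (pathfinish g) \<longrightarrow>
            (\<exists>G. open G \<and> G \<subseteq> ball (f c) e \<and> frontier G \<subseteq> f ` path_image g \<and>
              f c \<in> G \<union> f ` path_image g)"
proof -
  note rep = local_repD[OF assms(1)]
  obtain s where s: "0 < s" "s \<le> r" "\<forall>g. path g \<and> path_image g \<subseteq> ball z0 s \<and> pathstart g \<noteq> pathfinish g \<and>
     F (pathstart g) = F (pathfinish g) \<longrightarrow>
     F z0 \<in> path_image (F \<circ> g) \<union> inside (path_image (F \<circ> g))"
    using holomorphic_encloses[OF rep(5,3) local_rep_not_constant[OF assms(1,2)]] by (elim exE conjE)
  have "continuous (at z0) F"
    using holomorphic_on_imp_continuous_on[OF rep(5)] rep(3) continuous_on_interior[of "ball z0 r" F z0] by simp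
  moreover have "0 < e / 8" using e by simp
  ultimately obtain d where d: "0 < d" "\<And>z. dist z z0 < d \<Longrightarrow> dist (F z) (F z0) < e / 8"
    unfolding continuous_at_eps_delta by (metis dist_commute)
  obtain \<delta> where \<delta>: "0 < \<delta>" "ball c \<delta> \<subseteq> \<phi> ` ball z0 (min s d)"
    using chart_nhds[OF rep(1), of "min s d" z0] s(1) d(1) rep(4) by auto
  have "\<exists>G. open G \<and> G \<subseteq> ball (f c) e \<and> frontier G \<subseteq> f ` path_image g \<and> f c \<in> G \<union> f ` path_image g"
    if g: "path g" "path_image g \<subseteq> ball c \<delta>" "pathstart g \<noteq> pathfinish g" "f (pathstart g) = f (pathfinish g)" for g
  proof -
    define p where "p = inv \<phi> \<circ> g"
    have gp: "g t = \<phi> (p t)" "p t \<in> ball z0 s" "p t \<in> ball z0 d" if "t \<in> {0..1}" for t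
    proof -
      have "g t \<in> path_image g" using that by (simp add: path_image_def)
      then have "g t \<in> \<phi> ` ball z0 (min s d)" using g(2) \<delta>(2) by blast
      then obtain z where z: "g t = \<phi> z" "z \<in> ball z0 (min s d)" by blast
      then have "p t = z" using inj_chart[OF rep(1)] by (simp add: p_def)
      then show "g t = \<phi> (p t)" "p t \<in> ball z0 s" "p t \<in> ball z0 d" using z by auto
    qed
    have p: "path p"
      unfolding p_def using g(1)
      by (rule path_continuous_image)
        (use gp(1) in \<open>auto simp: path_image_def intro!: continuous_on_subset[OF continuous_on_inv_chart[OF rep(1)]]\<close>)
    have fg: "f (g t) = \<psi> (F (p t))" if "t \<in> {0..1}" for t
      using rep(6)[of "p t"] gp[OF that] s(2) by auto
    have psub: "path_image p \<subseteq> ball z0 s" using gp(2) by (auto simp: path_image_def)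
    have "pathstart p \<noteq> pathfinish p" using g(3) gp(1)[of 0] gp(1)[of 1] by (auto simp: pathstart_def pathfinish_def)
    moreover have "F (pathstart p) = F (pathfinish p)"
      using g(4) fg[of 0] fg[of 1] inj_chart[OF rep(2)] by (auto simp: pathstart_def pathfinish_def inj_eq)
    ultimately have encl: "F z0 \<in> path_image (F \<circ> p) \<union> inside (path_image (F \<circ> p))"
      using s(3) p psub by blast
    let ?L = "path_image (F \<circ> p)"
    have L: "\<psi> ` ?L = f ` path_image g" using fg by (auto simp: path_image_def image_image)
    have path: "path (F \<circ> p)"
      using p by (rule path_continuous_image)
        (use psub s(2) in \<open>auto intro!: continuous_on_subset[OF holomorphic_on_imp_continuous_on[OF rep(5)]]\<close>)
    have bd: "bounded ?L" "closed ?L" using path bounded_path_image closed_path_image by auto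
    define G where "G = \<psi> ` inside ?L"
    have G: "open G" unfolding G_def by (intro open_chart[OF rep(2)] open_inside bd)
    have "?L \<subseteq> ball (F z0) (e / 8)"
    proof
      fix y assume "y \<in> ?L"
      then obtain t where t: "t \<in> {0..1}" "y = F (p t)" by (auto simp: path_image_def)
      have "dist (p t) z0 < d" using gp(3)[OF t(1)] by (simp add: dist_commute)
      from d(2)[OF this] show "y \<in> ball (F z0) (e / 8)" by (simp add: t(2) dist_commute)
    qed
    then have "- ball (F z0) (e / 8) \<subseteq> outside ?L" by (intro outside_subset_convex convex_ball)
    then have ins: "inside ?L \<subseteq> ball (F z0) (e / 8)" using inside_Int_outside[of ?L] by blast
    have Ge: "G \<subseteq> ball (f c) e"
    proof
      fix y assume "y \<in> G"
      then obtain z where z: "y = \<psi> z" "z \<in> ball (F z0) (e / 8)" using ins by (auto simp: G_def)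
      then show "y \<in> ball (f c) e" using chart_dist_le[OF rep(2), of "F z0" z] by (simp add: rep(7) dist_norm)
    qed
    have "compact (?L \<union> inside ?L)"
      using closed_path_image_Un_inside[OF path] bd bounded_inside[OF bd(1)] by (simp add: compact_eq_bounded_closed)
    then have "compact (\<psi> ` (?L \<union> inside ?L))"
      by (intro compact_continuous_image continuous_on_chart[OF rep(2)])
    then have "closure G \<subseteq> \<psi> ` (?L \<union> inside ?L)"
      unfolding G_def by (intro closure_minimal compact_imp_closed) auto
    then have "frontier G \<subseteq> f ` path_image g"
      using interior_open[OF G] unfolding frontier_def image_Un L G_def by blast
    moreover have "f c \<in> G \<union> f ` path_image g"
      using encl rep(7) unfolding G_def L[symmetric] by blast
    ultimately show ?thesis using G Ge by blast
  qed
  then show ?thesis using \<delta>(1) by blast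
qed

section \<open>Rational maps\<close>

context
  fixes p q :: "complex poly" and d :: nat
  assumes coprime: "coprime p q" and d: "max (degree p) (degree q) = d" and d_pos: "0 < d"
begin

text \<open>The numerator of the derivative of \<open>p / q\<close> and, up to sign, of
  \<open>q / p\<close>; so this one polynomial also detects critical points at poles.\<close>

definition wronskian :: "complex poly" where
  "wronskian = pderiv p * q - p * pderiv q"

text \<open>Otherwise coprimality would force \<open>p\<close> and \<open>q\<close> to divide their
  own derivatives, so both would have degree 0.\<close>

lemma wronskian_nonzero: "wronskian \<noteq> 0"
proof
  assume "wronskian = 0"
  then have eq: "pderiv p * q = p * pderiv q" by (simp add: wronskian_def)
  have "q dvd p * pderiv q" unfolding eq[symmetric] by simp
  then have "q dvd pderiv q"
    by (simp only: coprime_dvd_mult_right_iff[OF coprime[unfolded coprime_commute[of p q]]])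
  moreover have "p dvd pderiv p * q" unfolding eq by simp
  then have "p dvd pderiv p" by (simp only: coprime_dvd_mult_left_iff[OF coprime])
  ultimately have "degree p = 0" "degree q = 0" by simp_all
  then show False using d d_pos by simp
qed

lemma combination_nonzero: "p - smult w q \<noteq> 0" and q_nonzero: "q \<noteq> 0"
proof -
  show "q \<noteq> 0"
  proof
    assume "q = 0"
    then have "is_unit p" using coprime by simp
    then have "degree p = 0" by (rule is_unit_iff_degree[THEN iffD1, rotated]) (use \<open>is_unit p\<close> in auto)
    then show False using d d_pos \<open>q = 0\<close> by simp
  qed
  show "p - smult w q \<noteq> 0"
  proof
    assume "p - smult w q = 0"
    then have eq: "p = smult w q" by simp
    then have "q dvd p" by (simp add: dvd_smult)
    then have "is_unit q" using coprime by (metis coprime_common_divisor dvd_refl)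
    then have "degree q = 0" using \<open>q \<noteq> 0\<close> by (simp add: is_unit_iff_degree)
    moreover have "degree p \<le> degree q" unfolding eq by (rule degree_smult_le)
    ultimately show False using d d_pos by simp
  qed
qed

text \<open>In the plane the preimages of \<open>Fin w\<close> are roots of
  \<open>p - smult w q\<close>, those of \<open>Infty\<close> roots of \<open>q\<close>. The
  successor accounts for \<open>Infty\<close>, which is added without checking its value.\<close>

lemma rat_fun_fibre: "finite (rat_fun p q -` {y})" "card (rat_fun p q -` {y}) \<le> Suc d"
proof -
  obtain r where r: "r \<noteq> 0" "degree r \<le> d" "rat_fun p q -` {y} \<subseteq> insert Infty (Fin ` {z. poly r z = 0})"
  proof (cases y)
    case (Fin w)
    have "degree (p - smult w q) \<le> d"
      using d degree_smult_le[of w q] by (intro degree_diff_le) auto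
    moreover have "rat_fun p q -` {y} \<subseteq> insert Infty (Fin ` {z. poly (p - smult w q) z = 0})"
    proof
      fix x assume "x \<in> rat_fun p q -` {y}"
      then show "x \<in> insert Infty (Fin ` {z. poly (p - smult w q) z = 0})"
        by (cases x) (auto simp: rat_fun_def Fin split: if_splits)
    qed
    ultimately show thesis using that combination_nonzero by blast
  next
    case Infty
    have "rat_fun p q -` {y} \<subseteq> insert Infty (Fin ` {z. poly q z = 0})"
    proof
      fix x assume "x \<in> rat_fun p q -` {y}"
      then show "x \<in> insert Infty (Fin ` {z. poly q z = 0})"
        by (cases x) (auto simp: rat_fun_def Infty split: if_splits)
    qed
    moreover have "degree q \<le> d" using d by simp
    ultimately show thesis using that q_nonzero by blast
  qed
  have fin: "finite {z. poly r z = 0}" using r(1) by (rule poly_roots_finite)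
  show "finite (rat_fun p q -` {y})" using r(3) fin finite_subset by blast
  have "card (rat_fun p q -` {y}) \<le> card (insert Infty (Fin ` {z. poly r z = 0}))"
    using r(3) fin by (intro card_mono) auto
  also have "\<dots> \<le> Suc (card (Fin ` {z. poly r z = 0}))"
    by (rule card_insert_le_m1) auto
  also have "card (Fin ` {z. poly r z = 0}) \<le> card {z. poly r z = 0}"
    using fin by (rule card_image_le)
  also have "\<dots> \<le> d" using card_poly_roots_bound[OF r(1)] r(2) by simp
  finally show "card (rat_fun p q -` {y}) \<le> Suc d" by simp
qed

lemma local_rep_Fin:
  obtains \<phi> \<psi> r F where "local_rep (rat_fun p q) (Fin z0) \<phi> \<psi> z0 r F"
    "poly wronskian z0 \<noteq> 0 \<Longrightarrow> deriv F z0 \<noteq> 0"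
proof (cases "poly q z0 = 0")
  case False
  have "open {z. poly q z \<noteq> 0}" by (intro open_Collect_neq continuous_intros)
  then obtain r where r: "0 < r" "ball z0 r \<subseteq> {z. poly q z \<noteq> 0}" using False openE by blast
  define F where "F z = poly p z / poly q z" for z
  have "F holomorphic_on ball z0 r"
    unfolding F_def using r(2) by (intro holomorphic_intros) auto
  moreover have "rat_fun p q (Fin z) = Fin (F z)" if "z \<in> ball z0 r" for z
    using r(2) that by (auto simp: rat_fun_def F_def)
  ultimately have "local_rep (rat_fun p q) (Fin z0) Fin Fin z0 r F"
    using r(1) by (simp add: local_rep_def chart_def)
  moreover have "(F has_field_derivative poly wronskian z0 / (poly q z0)\<^sup>2) (at z0)"
    unfolding F_def wronskian_def using False
    by (auto intro!: derivative_eq_intros poly_DERIV simp: power2_eq_square algebra_simps)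
  then have "poly wronskian z0 \<noteq> 0 \<Longrightarrow> deriv F z0 \<noteq> 0" using False by (simp add: DERIV_imp_deriv)
  ultimately show thesis by (rule that)
next
  case True
  \<comment> \<open>At a pole the target chart is the one around infinity, in which the map reads
    \<open>q / p\<close>.\<close>
  then have p0: "poly p z0 \<noteq> 0" using coprime_poly_0[OF coprime, of z0] by simp
  have "open {z. poly p z \<noteq> 0}" by (intro open_Collect_neq continuous_intros)
  then obtain r where r: "0 < r" "ball z0 r \<subseteq> {z. poly p z \<noteq> 0}" using p0 openE by blast
  define F where "F z = poly q z / poly p z" for z
  have "F holomorphic_on ball z0 r"
    unfolding F_def using r(2) by (intro holomorphic_intros) auto
  moreover have "rat_fun p q (Fin z) = (inversion \<circ> Fin) (F z)" if "z \<in> ball z0 r" for z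
    using r(2) that by (auto simp: rat_fun_def F_def inversion_def)
  ultimately have "local_rep (rat_fun p q) (Fin z0) Fin (inversion \<circ> Fin) z0 r F"
    using r(1) by (simp add: local_rep_def chart_def)
  moreover have "(F has_field_derivative - poly wronskian z0 / (poly p z0)\<^sup>2) (at z0)"
    unfolding F_def wronskian_def using p0
    by (auto intro!: derivative_eq_intros poly_DERIV simp: power2_eq_square algebra_simps)
  then have "poly wronskian z0 \<noteq> 0 \<Longrightarrow> deriv F z0 \<noteq> 0" using p0 by (simp add: DERIV_imp_deriv)
  ultimately show thesis by (rule that)
qed

text \<open>\<open>P\<close> and \<open>Q\<close> are the polynomials \<open>z ^ d * p (1 / z)\<close> and \<open>z ^ d * q (1 / z)\<close>.\<close>

lemma local_rep_Infty:
  obtains \<phi> \<psi> r F where "local_rep (rat_fun p q) Infty \<phi> \<psi> 0 r F"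
proof -
  define rv where "rv s z = (\<Sum>i\<le>d. coeff s i * z ^ (d - i))" for s :: "complex poly" and z
  define P Q where "P = rv p" and "Q = rv q"
  have rv: "rv s z = z ^ d * poly s (1 / z)" if "z \<noteq> 0" "degree s \<le> d" for s z
  proof -
    have "poly s (1 / z) = (\<Sum>i\<le>d. coeff s i * (1 / z) ^ i)"
      unfolding poly_altdef using that(2) by (intro sum.mono_neutral_left) (auto simp: coeff_eq_0)
    also have "z ^ d * \<dots> = rv s z"
      unfolding rv_def sum_distrib_left
    proof (rule sum.cong)
      fix i assume "i \<in> {..d}"
      then have "z ^ d = z ^ (d - i) * z ^ i" by (simp flip: power_add)
      then show "z ^ d * (coeff s i * (1 / z) ^ i) = coeff s i * z ^ (d - i)"
        using that(1) by (simp add: power_divide)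
    qed simp
    finally show ?thesis by simp
  qed
  have P: "P z = z ^ d * poly p (1 / z)" and Q: "Q z = z ^ d * poly q (1 / z)" if "z \<noteq> 0" for z
    using rv[OF that] d by (auto simp: P_def Q_def)
  have rv0: "rv s 0 = coeff s d" for s
  proof -
    have "rv s 0 = (\<Sum>i\<le>d. if i = d then coeff s d else 0)"
      unfolding rv_def by (intro sum.cong) auto
    then show ?thesis by simp
  qed
  have 0: "P 0 = coeff p d" "Q 0 = coeff q d" by (simp_all add: P_def Q_def rv0)
  have hol: "P holomorphic_on UNIV" "Q holomorphic_on UNIV"
    unfolding P_def Q_def rv_def by (intro holomorphic_intros)+
  have cont: "continuous_on UNIV P" "continuous_on UNIV Q"
    using hol holomorphic_on_imp_continuous_on by blast+
  \<comment> \<open>The coefficients that define \<open>rat_fun\<close> at \<open>Infty\<close> are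
    the values of \<open>P\<close> and \<open>Q\<close> at 0.\<close>
  have f0: "rat_fun p q ((inversion \<circ> Fin) 0) = (if Q 0 = 0 then Infty else Fin (P 0 / Q 0))"
    using d by (simp add: inversion_def rat_fun_def 0 Let_def)
  have f: "rat_fun p q ((inversion \<circ> Fin) z) = (if Q z = 0 then Infty else Fin (P z / Q z))" for z
    by (cases "z = 0") (use f0 in \<open>auto simp: inversion_def rat_fun_def P Q\<close>)
  show thesis
  proof (cases "Q 0 = 0")
    case False
    have "open {z. Q z \<noteq> 0}" by (intro open_Collect_neq continuous_intros cont)
    then obtain r where r: "0 < r" "ball 0 r \<subseteq> {z. Q z \<noteq> 0}" using False openE by blast
    have "(\<lambda>z. P z / Q z) holomorphic_on ball 0 r"
      using r(2) by (intro holomorphic_intros holomorphic_on_subset[OF hol(1)] holomorphic_on_subset[OF hol(2)]) auto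
    moreover have "rat_fun p q ((inversion \<circ> Fin) z) = Fin (P z / Q z)" if "z \<in> ball 0 r" for z
      using r(2) that unfolding f by auto
    ultimately have "local_rep (rat_fun p q) Infty (inversion \<circ> Fin) Fin 0 r (\<lambda>z. P z / Q z)"
      using r(1) by (simp add: local_rep_def chart_def inversion_def)
    then show thesis by (rule that)
  next
    case True
    \<comment> \<open>One of \<open>p\<close> and \<open>q\<close> has degree \<open>d\<close>, so
      their coefficients of degree \<open>d\<close> do not both vanish.\<close>
    have "P 0 \<noteq> 0"
    proof
      assume "P 0 = 0"
      then have "coeff p d = 0" "coeff q d = 0" using True 0 by auto
      moreover have "degree p = d \<or> degree q = d" using d by linarith
      ultimately have "degree p = 0 \<and> d = 0 \<or> degree q = 0 \<and> d = 0"
        by (metis degree_0 leading_coeff_0_iff)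
      then show False using d_pos by simp
    qed
    have "open {z. P z \<noteq> 0}" by (intro open_Collect_neq continuous_intros cont)
    then obtain r where r: "0 < r" "ball 0 r \<subseteq> {z. P z \<noteq> 0}" using \<open>P 0 \<noteq> 0\<close> openE by blast
    have "(\<lambda>z. Q z / P z) holomorphic_on ball 0 r"
      using r(2) by (intro holomorphic_intros holomorphic_on_subset[OF hol(1)] holomorphic_on_subset[OF hol(2)]) auto
    moreover have "rat_fun p q ((inversion \<circ> Fin) z) = (inversion \<circ> Fin) (Q z / P z)" if "z \<in> ball 0 r" for z
      using r(2) that unfolding f by (auto simp: inversion_def)
    ultimately have "local_rep (rat_fun p q) Infty (inversion \<circ> Fin) (inversion \<circ> Fin) 0 r (\<lambda>z. Q z / P z)"
      using r(1) by (simp add: local_rep_def chart_def inversion_def)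
    then show thesis by (rule that)
  qed
qed

lemma local_rep_rat_fun: "\<exists>\<phi> \<psi> z0 r F. local_rep (rat_fun p q) x \<phi> \<psi> z0 r F"
proof (cases x)
  case (Fin z)
  then show ?thesis using local_rep_Fin[of z] by metis
next
  case Infty
  then show ?thesis using local_rep_Infty by metis
qed

text \<open>In the plane such points are roots of the Wronskian. \<open>Infty\<close> is simply
  added, so \<open>local_rep_Infty\<close> can do without a clause on the derivative.\<close>

lemma finite_not_locally_inj: "finite {c. \<forall>e>0. \<not> inj_on (rat_fun p q) (ball c e)}"
proof (rule finite_subset)
  show "{c. \<forall>e>0. \<not> inj_on (rat_fun p q) (ball c e)} \<subseteq> insert Infty (Fin ` {z. poly wronskian z = 0})"
  proof
    fix c assume c: "c \<in> {c. \<forall>e>0. \<not> inj_on (rat_fun p q) (ball c e)}"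
    show "c \<in> insert Infty (Fin ` {z. poly wronskian z = 0})"
    proof (cases c)
      case (Fin z)
      obtain \<phi> \<psi> r F where F: "local_rep (rat_fun p q) (Fin z) \<phi> \<psi> z r F"
        "poly wronskian z \<noteq> 0 \<Longrightarrow> deriv F z \<noteq> 0"         using local_rep_Fin[of z] by metis
      have "poly wronskian z = 0"
        using local_rep_inj[OF F(1)] F(2) c Fin by blast
      then show ?thesis by (simp add: Fin)
    qed simp
  qed
  show "finite (insert Infty (Fin ` {z. poly wronskian z = 0}))"
    using poly_roots_finite[OF wronskian_nonzero] by simp
qed

end

section \<open>The theorem\<close>

text \<open>With \<open>C\<close> defined by failure of local injectivity,
  \<open>locally_inj\<close> is immediate, and \<open>critical_at\<close> follows because a nonzero
  derivative would make \<open>f\<close> injective nearby.\<close>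

lemma branched_map_rat_fun:
  assumes f: "f = rat_fun p q" "coprime p q" "max (degree p) (degree q) = d" "0 < d"
  shows "branched_map f {c. \<forall>e>0. \<not> inj_on f (ball c e)} (Suc d) 1"
proof -
  have fibre: "finite (f -` {y})" "card (f -` {y}) \<le> Suc d" for y
    using rat_fun_fibre[OF f(2-4)] by (simp_all add: f(1))
  have rep: "\<exists>\<phi> \<psi> z0 r F. local_rep f x \<phi> \<psi> z0 r F" for x
    using local_rep_rat_fun[OF f(2-4)] by (simp add: f(1))
  have lip: "\<exists>K>0. \<exists>e>0. \<forall>z. dist z a < e \<longrightarrow> dist (f z) (f a) \<le> K * dist z a" for a
  proof -
    obtain \<phi> \<psi> z0 r F where F: "local_rep f a \<phi> \<psi> z0 r F" using rep by blast
    obtain K where K: "0 < K" "\<forall>e>0. \<exists>\<delta>>0. \<forall>x. dist x a < \<delta> \<longrightarrow>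
        dist (f x) (f a) \<le> K * (cmod (deriv F z0) + e) * dist x a"
      using local_rep_dist[OF F] by (elim exE conjE)
    obtain \<delta> where "0 < \<delta>" "\<forall>x. dist x a < \<delta> \<longrightarrow> dist (f x) (f a) \<le> K * (cmod (deriv F z0) + 1) * dist x a"
      using K(2) zero_less_one by blast
    moreover have "0 < K * (cmod (deriv F z0) + 1)"
      using K(1) by (intro mult_pos_pos) (simp_all add: add_nonneg_pos)
    ultimately show ?thesis by blast
  qed
  show ?thesis
  proof
    show "compact (UNIV :: riemann_sphere set)" by (rule compact_riemann_sphere)
    show "locally path_connected (UNIV :: riemann_sphere set)" by (rule locally_path_connected_riemann_sphere)
    show "connected (- cball y r)" if "r < 1" for y :: riemann_sphere and r
      using that by (rule connected_Compl_cball)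
    show "\<exists>z. 1 \<le> dist y z" for y :: riemann_sphere
      using antipode[of y] pi_gt3 by (metis le_less_trans less_imp_le not_less one_le_numeral)
    show "\<exists>y. y \<noteq> x \<and> dist x y < e" if e: "0 < e" for x :: riemann_sphere and e
    proof -
      obtain \<phi> \<psi> z0 r F where F: "local_rep f x \<phi> \<psi> z0 r F" using rep by blast
      note ch = local_repD(1,4)[OF F]
      have "dist x (\<phi> (z0 + of_real (e / 16))) \<le> 8 * cmod (z0 - (z0 + of_real (e / 16)))"
        using chart_dist_le[OF ch(1), of z0] ch(2) by blast
      also have "\<dots> < e" using e by (simp add: norm_divide)
      finally have "dist x (\<phi> (z0 + of_real (e / 16))) < e" .
      moreover have "\<phi> (z0 + of_real (e / 16)) \<noteq> x"
        using e inj_chart[OF ch(1)] unfolding ch(2)[symmetric] by (simp add: inj_eq)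
      ultimately show ?thesis by blast
    qed
    show "continuous_on UNIV f"
      unfolding continuous_on_iff
    proof (intro ballI allI impI)
      fix a and e :: real assume e: "0 < e"
      obtain K d where K: "0 < K" "0 < d" "\<forall>z. dist z a < d \<longrightarrow> dist (f z) (f a) \<le> K * dist z a"
        using lip[of a] by (elim exE conjE)
      have "dist (f z) (f a) < e" if "dist z a < min d (e / K)" for z
      proof -
        have "dist (f z) (f a) \<le> K * dist z a" using K(3) that by simp
        also have "\<dots> < e" using that K(1) by (simp add: field_simps)
        finally show ?thesis .
      qed
      then show "\<exists>d>0. \<forall>z\<in>UNIV. dist z a < d \<longrightarrow> dist (f z) (f a) < e"
        using K e by (intro exI[of _ "min d (e / K)"]) auto
    qed
    show "open (f ` U)" if U: "open U" for U
    proof (subst openin_subopen[of euclidean, simplified], intro ballI)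
      fix y assume "y \<in> f ` U"
      then obtain a where a: "a \<in> U" "y = f a" by blast
      obtain \<phi> \<psi> z0 r F where F: "local_rep f a \<phi> \<psi> z0 r F" using rep by blast
      show "\<exists>T. open T \<and> y \<in> T \<and> T \<subseteq> f ` U"
        using local_rep_open[OF F fibre(1) U a(1)] a(2) by simp
    qed
    show "finite (f -` {y})" "card (f -` {y}) \<le> Suc d" for y by (fact fibre)+
    show "finite {c. \<forall>e>0. \<not> inj_on f (ball c e)}"
      using finite_not_locally_inj[OF f(2-4)] by (simp add: f(1))
    show "\<exists>e>0. inj_on f (ball a e)" if "a \<notin> {c. \<forall>e>0. \<not> inj_on f (ball c e)}" for a
      using that by blast
    show "\<exists>K>0. \<exists>e>0. \<forall>z. dist z a < e \<longrightarrow> dist (f z) (f a) \<le> K * dist z a" for a by (rule lip)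
    show "\<exists>\<delta>>0. \<forall>z. dist z c < \<delta> \<longrightarrow> dist (f z) (f c) \<le> e * dist z c"
      if c: "c \<in> {c. \<forall>e>0. \<not> inj_on f (ball c e)}" and e: "0 < e" for c e
    proof -
      obtain \<phi> \<psi> z0 r F where F: "local_rep f c \<phi> \<psi> z0 r F" using rep by blast
      have "deriv F z0 = 0" using local_rep_inj[OF F] c by blast
      moreover obtain K where "0 < K" "\<forall>e>0. \<exists>\<delta>>0. \<forall>x. dist x c < \<delta> \<longrightarrow>
          dist (f x) (f c) \<le> K * (cmod (deriv F z0) + e) * dist x c"
        using local_rep_dist[OF F] by (elim exE conjE)
      moreover from this(1) have "0 < e / K" using e by simp
      ultimately obtain \<delta> where "0 < \<delta>"
        "\<forall>x. dist x c < \<delta> \<longrightarrow> dist (f x) (f c) \<le> K * (cmod (deriv F z0) + e / K) * dist x c" by blast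
      moreover have "K * (cmod (deriv F z0) + e / K) = e" using \<open>deriv F z0 = 0\<close> \<open>0 < K\<close> by simp
      ultimately show ?thesis by metis
    qed
    show "\<exists>\<delta>>0. \<forall>g. path g \<and> path_image g \<subseteq> ball c \<delta> \<and>
            pathstart g \<noteq> pathfinish g \<and> f (pathstart g) = f (pathfinish g) \<longrightarrow>
            (\<exists>G. open G \<and> G \<subseteq> ball (f c) e \<and> frontier G \<subseteq> f ` path_image g \<and>
              f c \<in> G \<union> f ` path_image g)" if e: "0 < e" for c e
    proof -
      obtain \<phi> \<psi> z0 r F where F: "local_rep f c \<phi> \<psi> z0 r F" using rep by blast
      show ?thesis by (rule local_rep_encloses[OF F fibre(1) e])
    qed
  qed simp
qed

theorem mainTheorem7:
  fixes f :: "riemann_sphere \<Rightarrow> riemann_sphere" and d :: nat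
  assumes "rational_map f d" and "d \<ge> 2" and "TCE f"
  shows "hausdorff_dim (julia_set f - conical_julia_set f) = 0"
proof -
  obtain p q where pq: "coprime p q" "max (degree p) (degree q) = d" "f = rat_fun p q"
    using assms(1) by (auto simp: rational_map_def)
  interpret branched_map f "{c. \<forall>e>0. \<not> inj_on f (ball c e)}" "Suc d" 1
    using pq assms(2) by (intro branched_map_rat_fun) auto
  show ?thesis using hausdorff_dim_nonconical[OF assms(3)] .
qed

end
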